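(* Let $\sigma\in\{0,1\}$, $\nu>0$, $T>0$. Let $V\in C^1_tC^2_y([0,T]\times[-1,1])$ be real-valued and such that for every $t\in[0,T]$ the function $V(t,\cdot)$ has finitely many critical points $\{y_i(t)\}_{i=1}^{N(t)}$. Assume that there exist $m_0\in\mathbb{N}$, $r_0>0$ and $\mathfrak{C}_2,\mathfrak{C}_3\ge1$ such that $$\|\partial_{ty}V\|_{L^\infty([0,T]\times[-1,1])}\le\mathfrak{C}_2\,\nu,$$ and, for all $t\in[0,T]$ and $i\in\{1,\dots,N(t)\}$, $$|y-y_i(t)|^{m_0}\le\mathfrak{C}_3\,|\partial_yV(t,y)|,\qquad\forall y\in[-1,1]\text{ with }|y-y_i(t)|\le r_0 .$$ Let $f_0\in H^1_0(\mathbb{R}\times[-1,1])$ and let $f$ be the solution on $[0,T]\times\mathbb{R}\times[-1,1]$ of $$\partial_tf+V(t,y)\partial_xf=\nu(\sigma\partial_x^2+\partial_y^2)f,\qquad f(t,x,\pm1)=0,\qquad f(0,x,y)=f_0(x,y).$$ Then there exists a constant $\delta\in(0,1)$, depending only on the parameters $m_0,r_0,\mathfrak{C}_2,\mathfrak{C}_3$ and the sup norms of $\partial_yV,\partial_{yy}V$ on $[0,T]\times[-1,1]$, such that for (almost) every $k\in\mathbb{R}$ with $0<|k|\le\nu$, $$\|f_k(t)\|_{L^2([-1,1])}\le e\,\|f_k(0)\|_{L^2([-1,1])}\exp\left\{-\delta\,\frac{|k|^2}{\nu}\,t\right\},\qquad\forall t\in[0,T].$$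
   Context: $f_k(t,y)$ denotes the Fourier transform of $f(t,\cdot,y)$ in $x\in\mathbb{R}$ at frequency $k\in\mathbb{R}$; it solves $\partial_tf_k+ikV(t,y)f_k=\nu\partial_y^2f_k-\sigma\nu|k|^2f_k$ on $[-1,1]$ with $f_k(t,\pm1)=0$. $H^1_0$ is the space of $H^1$ functions with zero trace on the boundary. A critical point of $V(t,\cdot)$ is a point where $\partial_yV(t,\cdot)$ vanishes. *)

theory Defs
  imports "HOL-Analysis.Analysis"
begin

text \<open>Elements of \<open>L\<^sup>2\<close> are represented by Borel functions; every notion below that is applied to
  such functions is insensitive to changes on null sets.\<close>

definition square_integrable :: "'a::euclidean_space set \<Rightarrow> ('a \<Rightarrow> complex) \<Rightarrow> bool" where
  "square_integrable A g \<longleftrightarrow>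
     set_borel_measurable lborel A g \<and> set_integrable lborel A (\<lambda>x. (cmod (g x))\<^sup>2)"

definition L2_norm :: "'a::euclidean_space set \<Rightarrow> ('a \<Rightarrow> complex) \<Rightarrow> real" where
  "L2_norm A g = sqrt (LINT x:A|lborel. (cmod (g x))\<^sup>2)"

text \<open>The first conjunct is needed because \<^const>\<open>L2_norm\<close> is \<open>0\<close> on functions that are not
  square integrable.\<close>

definition L2_tendsto ::
  "'a::euclidean_space set \<Rightarrow> ('i \<Rightarrow> 'a \<Rightarrow> complex) \<Rightarrow> ('a \<Rightarrow> complex) \<Rightarrow> 'i filter \<Rightarrow> bool" where
  "L2_tendsto A u g Fl \<longleftrightarrow>
     (\<forall>\<^sub>F i in Fl. square_integrable A (\<lambda>x. u i x - g x)) \<and>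
     ((\<lambda>i. L2_norm A (\<lambda>x. u i x - g x)) \<longlongrightarrow> 0) Fl"

definition L2_continuous_on ::
  "real set \<Rightarrow> 'a::euclidean_space set \<Rightarrow> (real \<Rightarrow> 'a \<Rightarrow> complex) \<Rightarrow> bool" where
  "L2_continuous_on I A u \<longleftrightarrow>
     (\<forall>t\<in>I. square_integrable A (u t) \<and> L2_tendsto A u (u t) (at t within I))"

subsection \<open>The velocity profile\<close>

definition dt :: "real \<Rightarrow> (real \<Rightarrow> real \<Rightarrow> real) \<Rightarrow> real \<Rightarrow> real \<Rightarrow> real" where
  "dt T W t y = vector_derivative (\<lambda>s. W s y) (at t within {0..T})"

definition dy :: "(real \<Rightarrow> real \<Rightarrow> real) \<Rightarrow> real \<Rightarrow> real \<Rightarrow> real" where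
  "dy W t y = vector_derivative (W t) (at y within {-1..1})"

text \<open>\<open>C\<^sup>1([0,T]; C\<^sup>2([-1,1]))\<close>: all derivatives of order at most one in \<open>t\<close> and at most two in \<open>y\<close>
  exist (one-sided at the end points) and are jointly continuous.\<close>

definition C1t_C2y :: "real \<Rightarrow> (real \<Rightarrow> real \<Rightarrow> real) \<Rightarrow> bool" where
  "C1t_C2y T V \<longleftrightarrow>
     (\<forall>W\<in>{V, dy V}. \<forall>t\<in>{0..T}. \<forall>y\<in>{-1..1}. W t differentiable (at y within {-1..1})) \<and>
     (\<forall>W\<in>{V, dy V, dy (dy V)}.
        continuous_on ({0..T} \<times> {-1..1}) (\<lambda>(t, y). W t y) \<and>
        (\<forall>t\<in>{0..T}. \<forall>y\<in>{-1..1}. (\<lambda>s. W s y) differentiable (at t within {0..T})) \<and>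
        continuous_on ({0..T} \<times> {-1..1}) (\<lambda>(t, y). dt T W t y))"

definition sup_norm :: "real \<Rightarrow> (real \<Rightarrow> real \<Rightarrow> real) \<Rightarrow> real" where
  "sup_norm T W = (SUP (t, y)\<in>{0..T} \<times> {-1..1}. \<bar>W t y\<bar>)"

definition critical_points :: "(real \<Rightarrow> real \<Rightarrow> real) \<Rightarrow> real \<Rightarrow> real set" where
  "critical_points V t = {y \<in> {-1..1}. dy V t y = 0}"

subsection \<open>Sobolev functions on the strip\<close>

definition strip :: "(real \<times> real) set" where
  "strip = UNIV \<times> {-1<..<1}"

text \<open>\<open>\<phi>\<close> is \<open>C\<^sup>1\<close> on the plane with partial derivatives \<open>\<phi>x\<close>, \<open>\<phi>y\<close>, and has compact support
  contained in \<open>U\<close>.\<close>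

definition C1_compact ::
  "(real \<times> real) set \<Rightarrow> (real \<times> real \<Rightarrow> complex) \<Rightarrow> (real \<times> real \<Rightarrow> complex)
     \<Rightarrow> (real \<times> real \<Rightarrow> complex) \<Rightarrow> bool" where
  "C1_compact U \<phi> \<phi>x \<phi>y \<longleftrightarrow>
     (\<forall>x y. ((\<lambda>z. \<phi> (z, y)) has_vector_derivative \<phi>x (x, y)) (at x)) \<and>
     (\<forall>x y. ((\<lambda>z. \<phi> (x, z)) has_vector_derivative \<phi>y (x, y)) (at y)) \<and>
     continuous_on UNIV \<phi>x \<and> continuous_on UNIV \<phi>y \<and>
     (\<exists>K. compact K \<and> K \<subseteq> U \<and> (\<forall>p. p \<notin> K \<longrightarrow> \<phi> p = 0))"

text \<open>\<open>u \<in> H\<^sup>1\<close> of the strip, with weak gradient \<open>(ux, uy)\<close>.\<close>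

definition H1 ::
  "(real \<times> real \<Rightarrow> complex) \<Rightarrow> (real \<times> real \<Rightarrow> complex) \<Rightarrow> (real \<times> real \<Rightarrow> complex) \<Rightarrow> bool" where
  "H1 u ux uy \<longleftrightarrow>
     square_integrable strip u \<and> square_integrable strip ux \<and> square_integrable strip uy \<and>
     (\<forall>\<phi> \<phi>x \<phi>y. C1_compact strip \<phi> \<phi>x \<phi>y \<longrightarrow>
        (LINT p:strip|lborel. u p * \<phi>x p) = - (LINT p:strip|lborel. ux p * \<phi> p) \<and>
        (LINT p:strip|lborel. u p * \<phi>y p) = - (LINT p:strip|lborel. uy p * \<phi> p))"

text \<open>The trace operator is the continuous extension to \<open>H\<^sup>1\<close> of the restriction to the boundary
  lines \<open>y = -1\<close> and \<open>y = 1\<close>, which is defined on the dense subspace of functions that are \<open>C\<^sup>1\<close> up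
  to the boundary; \<open>g b\<close> is the trace on the line \<open>y = b\<close>.\<close>

definition has_trace ::
  "(real \<times> real \<Rightarrow> complex) \<Rightarrow> (real \<times> real \<Rightarrow> complex) \<Rightarrow> (real \<times> real \<Rightarrow> complex)
     \<Rightarrow> (real \<Rightarrow> real \<Rightarrow> complex) \<Rightarrow> bool" where
  "has_trace u ux uy g \<longleftrightarrow>
     (\<exists>\<phi> \<phi>x \<phi>y. (\<forall>n::nat. C1_compact UNIV (\<phi> n) (\<phi>x n) (\<phi>y n)) \<and>
        L2_tendsto strip \<phi> u sequentially \<and>
        L2_tendsto strip \<phi>x ux sequentially \<and>
        L2_tendsto strip \<phi>y uy sequentially \<and>
        (\<forall>b\<in>{-1, 1}. L2_tendsto UNIV (\<lambda>n x. \<phi> n (x, b)) (g b) sequentially))"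

definition H10_grad ::
  "(real \<times> real \<Rightarrow> complex) \<Rightarrow> (real \<times> real \<Rightarrow> complex) \<Rightarrow> (real \<times> real \<Rightarrow> complex) \<Rightarrow> bool" where
  "H10_grad u ux uy \<longleftrightarrow> H1 u ux uy \<and> has_trace u ux uy (\<lambda>_ _. 0)"

definition H10 :: "(real \<times> real \<Rightarrow> complex) set" where
  "H10 = {u. \<exists>ux uy. H10_grad u ux uy}"

subsection \<open>The equation\<close>

text \<open>Weak solutions \<open>f \<in> C([0,T]; L\<^sup>2) \<inter> L\<^sup>2(0,T; H\<^sup>1\<^sub>0)\<close> of
  \<open>\<partial>\<^sub>t f + V \<partial>\<^sub>x f = \<nu> (\<sigma> \<partial>\<^sub>x\<^sup>2 + \<partial>\<^sub>y\<^sup>2) f\<close> with \<open>f(t, x, -1) = f(t, x, 1) = 0\<close> and \<open>f(0) = f0\<close>. The equation is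
  tested against \<open>\<phi>(x, y)\<close> and integrated over \<open>[0,t]\<close>; the boundary condition is contained in
  \<open>f(t) \<in> H\<^sup>1\<^sub>0\<close>. The functions \<open>fx\<close>, \<open>fy\<close> are the weak derivatives of \<open>f\<close> in \<open>x\<close> and \<open>y\<close>.
  Also for \<open>\<sigma> = 0\<close> an initial value in \<open>H\<^sup>1\<^sub>0\<close> leads to \<open>\<partial>\<^sub>x f \<in> L\<^sup>2\<close>, since \<open>\<partial>\<^sub>x f\<close> satisfies the same
  equation.\<close>

definition is_solution ::
  "real \<Rightarrow> real \<Rightarrow> real \<Rightarrow> (real \<Rightarrow> real \<Rightarrow> real) \<Rightarrow> (real \<times> real \<Rightarrow> complex)
     \<Rightarrow> (real \<Rightarrow> real \<times> real \<Rightarrow> complex) \<Rightarrow> bool" where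
  "is_solution \<sigma> \<nu> T V f0 f \<longleftrightarrow>
     L2_continuous_on {0..T} strip f \<and>
     (AE p in lborel. p \<in> strip \<longrightarrow> f 0 p = f0 p) \<and>
     (\<exists>fx fy.
        square_integrable ({0..T} \<times> strip) (\<lambda>(t, p). fx t p) \<and>
        square_integrable ({0..T} \<times> strip) (\<lambda>(t, p). fy t p) \<and>
        (AE t in lborel. t \<in> {0..T} \<longrightarrow> H10_grad (f t) (fx t) (fy t)) \<and>
        (\<forall>\<phi> \<phi>x \<phi>y. C1_compact strip \<phi> \<phi>x \<phi>y \<longrightarrow>
           (\<forall>t\<in>{0..T}.
              (LINT p:strip|lborel. f t p * \<phi> p) - (LINT p:strip|lborel. f0 p * \<phi> p)
              = - (LINT (s, p):{0..t} \<times> strip|lborel.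
                     of_real (V s (snd p)) * fx s p * \<phi> p
                     + of_real \<nu> * (of_real \<sigma> * fx s p * \<phi>x p + fy s p * \<phi>y p)))))"

subsection \<open>Fourier transform in the first variable\<close>

text \<open>\<open>G\<close> is the \<open>L\<^sup>2\<close> (Plancherel) Fourier transform of \<open>g\<close>, as limit in the mean of the truncated
  Fourier integrals, with kernel \<open>exp (-i k x)\<close>.\<close>

definition is_fourier :: "(real \<Rightarrow> complex) \<Rightarrow> (real \<Rightarrow> complex) \<Rightarrow> bool" where
  "is_fourier g G \<longleftrightarrow>
     square_integrable UNIV g \<and> square_integrable UNIV G \<and>
     L2_tendsto UNIV (\<lambda>R k. LINT x:{-R..R}|lborel. g x * cis (- (k * x))) G at_top"

text \<open>\<open>F k t y\<close> is the Fourier transform of \<open>f(t, \<cdot>, y)\<close> at frequency \<open>k\<close>. For fixed \<open>t\<close> this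
  determines \<open>F k t\<close> only for almost every \<open>k\<close>, with an exceptional set depending on \<open>t\<close>. For
  \<open>F k t\<close> to be meaningful at all times simultaneously for almost every \<open>k\<close>, one takes the version
  that is continuous in \<open>t\<close> with values in \<open>L\<^sup>2([-1,1])\<close>; it is unique up to a null set of
  frequencies \<open>k\<close> independent of \<open>t\<close>.\<close>

definition is_fourier_x ::
  "real \<Rightarrow> (real \<Rightarrow> real \<times> real \<Rightarrow> complex) \<Rightarrow> (real \<Rightarrow> real \<Rightarrow> real \<Rightarrow> complex) \<Rightarrow> bool" where
  "is_fourier_x T f F \<longleftrightarrow>
     (\<forall>t\<in>{0..T}.
        set_borel_measurable lborel (UNIV \<times> {-1..1}) (\<lambda>(k, y). F k t y) \<and>
        (AE y in lborel. y \<in> {-1..1} \<longrightarrow> is_fourier (\<lambda>x. f t (x, y)) (\<lambda>k. F k t y))) \<and>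
     (AE k in lborel. L2_continuous_on {0..T} {-1..1} (F k))"

end

theory Submission
  imports Defs "HOL-Probability.Characteristic_Functions"
begin

text \<open>Since \<open>f\<^sub>k\<close> vanishes at \<open>y = \<plusminus>1\<close> and the lowest Dirichlet eigenvalue of \<open>-\<partial>\<^sub>y\<^sup>2\<close> on \<open>[-1, 1]\<close>
  exceeds \<open>1\<close>, the energy estimate gives the decay rate \<open>\<nu>\<close>, and \<open>\<bar>k\<bar>\<^sup>2 / \<nu> \<le> \<nu>\<close> for \<open>\<bar>k\<bar> \<le> \<nu>\<close>. To derive the
  estimate from the weak formulation, the solution is tested against \<open>a(x) b\<^sub>n(y)\<close>, where \<open>a\<close> is the
  Fourier transform of a bounded function \<open>h\<close> of compact support and \<open>b\<^sub>n\<close> is a Dirichlet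
  eigenfunction with eigenvalue \<open>\<lambda>\<^sub>n\<close>. As \<open>h\<close> is arbitrary, for almost every \<open>k\<close> the coefficients
  \<open>c\<^sub>n = \<langle>f\<^sub>k, b\<^sub>n\<rangle>\<close> solve \<open>c\<^sub>n' = - i k \<langle>V f\<^sub>k, b\<^sub>n\<rangle> - \<nu> (\<sigma> k\<^sup>2 + \<lambda>\<^sub>n) c\<^sub>n\<close>. In the sum of \<open>\<bar>c\<^sub>n\<bar>\<^sup>2\<close> over
  \<open>n < N\<close>, the transport term tends to \<open>2 Re (- i k \<langle>V f\<^sub>k, f\<^sub>k\<rangle>) = 0\<close> as \<open>N \<longlonglongrightarrow> \<infinity>\<close>.\<close>

subsection \<open>Square-integrable functions\<close>

text \<open>Pairing with the sines asks for neither. The boundary condition enters through the zero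
  trace of f, when the y-derivative is moved onto the test function, and the price is a transport
  term that does not cancel in the truncation. Three obstacles shape the rest. The products a(x)
  b_n(y) have no compact support in the open strip; they are reached by cutoffs, whose steep slope
  near the boundary is compensated by the zeros of b_n. The Fourier transform is only a limit in the
  mean, so f and F are compared through pairings with the transform of h, which must first be shown
  to be square integrable. Finally, the null set of bad frequencies must not depend on time or on n;
  the equation is derived at countably many times, on sets of frequencies where the norm of
  \<open>F k s\<close> is bounded uniformly in s, and extended by continuity.\<close>

lemma square_integrable_measurable:
  "square_integrable A f \<Longrightarrow> (\<lambda>x. indicator A x *\<^sub>R f x) \<in> borel_measurable borel"
  by (simp add: square_integrable_def set_borel_measurable_def)

lemma square_integrableI:
  assumes "(\<lambda>x. indicator A x *\<^sub>R f x) \<in> borel_measurable borel"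
    and "set_integrable lborel A g" and "\<And>x. x \<in> A \<Longrightarrow> (cmod (f x))\<^sup>2 \<le> g x"
  shows "square_integrable A f"
  unfolding square_integrable_def set_borel_measurable_def
proof
  have "(\<lambda>x. (cmod (indicator A x *\<^sub>R f x))\<^sup>2) \<in> borel_measurable borel"
    using assms(1) by measurable
  moreover have "(\<lambda>x. (cmod (indicator A x *\<^sub>R f x))\<^sup>2) = (\<lambda>x. indicator A x *\<^sub>R (cmod (f x))\<^sup>2)"
    by (auto simp: indicator_def)
  ultimately have meas: "set_borel_measurable lborel A (\<lambda>x. (cmod (f x))\<^sup>2)"
    by (simp add: set_borel_measurable_def)
  have "norm ((cmod (f x))\<^sup>2) \<le> norm (g x)" if "x \<in> A" for x
    using assms(3)[OF that] by auto
  then show "set_integrable lborel A (\<lambda>x. (cmod (f x))\<^sup>2)"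
    by (intro set_integrable_bound[OF assms(2) meas] AE_I2 impI)
qed (use assms(1) in simp)

lemma square_integrable_set_mult:
  assumes "square_integrable A f" and "square_integrable A g"
  shows "set_integrable lborel A (\<lambda>x. f x * g x)"
proof (rule set_integrable_bound)
  show "set_integrable lborel A (\<lambda>x. (cmod (f x))\<^sup>2 + (cmod (g x))\<^sup>2)"
    using assms by (auto simp: square_integrable_def)
  note [measurable] = assms[THEN square_integrable_measurable]
  have "(\<lambda>x. (indicator A x *\<^sub>R f x) * (indicator A x *\<^sub>R g x)) \<in> borel_measurable borel"
    by measurable
  also have "(\<lambda>x. (indicator A x *\<^sub>R f x) * (indicator A x *\<^sub>R g x)) = (\<lambda>x. indicator A x *\<^sub>R (f x * g x))"
    by (auto simp: indicator_def)
  finally show "set_borel_measurable lborel A (\<lambda>x. f x * g x)"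
    by (simp add: set_borel_measurable_def)
  have "a * b \<le> a\<^sup>2 + b\<^sup>2" for a b :: real
  proof -
    have "0 \<le> (a - b / 2)\<^sup>2 + 3 / 4 * b\<^sup>2" by simp
    then show ?thesis by (simp add: power2_eq_square field_simps)
  qed
  then show "AE x in lborel. x \<in> A \<longrightarrow> norm (f x * g x) \<le> norm ((cmod (f x))\<^sup>2 + (cmod (g x))\<^sup>2)"
    by (auto simp: norm_mult)
qed

lemma L2_norm_nonneg [simp]: "0 \<le> L2_norm A f"
  by (auto simp: L2_norm_def set_lebesgue_integral_def intro!: integral_nonneg)

lemma L2_norm_power2: "(L2_norm A f)\<^sup>2 = (LINT x:A|lborel. (cmod (f x))\<^sup>2)"
  by (auto simp: L2_norm_def set_lebesgue_integral_def intro!: integral_nonneg)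

text \<open>Taken over from the inequality for nonnegative extended reals; integrability of the
  three integrands is what allows each integral to be read back as a real number.\<close>

lemma integral_Cauchy_Schwarz:
  fixes a b :: "'a \<Rightarrow> real"
  assumes [measurable]: "a \<in> borel_measurable M" "b \<in> borel_measurable M"
    and "\<And>x. 0 \<le> a x" "\<And>x. 0 \<le> b x"
    and "integrable M (\<lambda>x. (a x)\<^sup>2)" "integrable M (\<lambda>x. (b x)\<^sup>2)" "integrable M (\<lambda>x. a x * b x)"
  shows "(\<integral>x. a x * b x \<partial>M)\<^sup>2 \<le> (\<integral>x. (a x)\<^sup>2 \<partial>M) * (\<integral>x. (b x)\<^sup>2 \<partial>M)"
proof -
  have "(\<integral>\<^sup>+x. ennreal (a x) * ennreal (b x) \<partial>M)\<^sup>2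
     \<le> (\<integral>\<^sup>+x. (ennreal (a x))\<^sup>2 \<partial>M) * (\<integral>\<^sup>+x. (ennreal (b x))\<^sup>2 \<partial>M)"
    by (rule Cauchy_Schwarz_nn_integral) auto
  also have "(\<integral>\<^sup>+x. ennreal (a x) * ennreal (b x) \<partial>M) = ennreal (\<integral>x. a x * b x \<partial>M)"
    using assms by (subst nn_integral_eq_integral[symmetric]) (auto simp: ennreal_mult)
  also have "(\<integral>\<^sup>+x. (ennreal (a x))\<^sup>2 \<partial>M) = ennreal (\<integral>x. (a x)\<^sup>2 \<partial>M)"
    using assms by (subst nn_integral_eq_integral[symmetric]) (auto simp: ennreal_power)
  also have "(\<integral>\<^sup>+x. (ennreal (b x))\<^sup>2 \<partial>M) = ennreal (\<integral>x. (b x)\<^sup>2 \<partial>M)"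
    using assms by (subst nn_integral_eq_integral[symmetric]) (auto simp: ennreal_power)
  finally show ?thesis
    using assms by (simp add: ennreal_power integral_nonneg flip: ennreal_mult)
qed

text \<open>The pairing carries no conjugate, so the real inequality is applied to the moduli. A
  Hermitian pairing is covered by conjugating the second factor, which leaves its norm
  unchanged.\<close>

lemma L2_Cauchy_Schwarz:
  assumes "square_integrable A f" and "square_integrable A g"
  shows "cmod (LINT x:A|lborel. f x * g x) \<le> L2_norm A f * L2_norm A g"
proof -
  let ?f = "\<lambda>x. cmod (indicator A x *\<^sub>R f x)" and ?g = "\<lambda>x. cmod (indicator A x *\<^sub>R g x)"
  note [measurable] = assms[THEN square_integrable_measurable]
  have eq: "(\<lambda>x. (?f x)\<^sup>2) = (\<lambda>x. indicator A x *\<^sub>R (cmod (f x))\<^sup>2)"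
    "(\<lambda>x. (?g x)\<^sup>2) = (\<lambda>x. indicator A x *\<^sub>R (cmod (g x))\<^sup>2)"
    "(\<lambda>x. norm (indicator A x *\<^sub>R (f x * g x))) = (\<lambda>x. ?f x * ?g x)"
    by (auto simp: indicator_def norm_mult)
  have fg: "integrable lborel (\<lambda>x. ?f x * ?g x)"
    using square_integrable_set_mult[OF assms, unfolded set_integrable_def, THEN integrable_norm]
    unfolding eq(3) .
  have "integrable lborel (\<lambda>x. (?f x)\<^sup>2)" "integrable lborel (\<lambda>x. (?g x)\<^sup>2)"
    using assms unfolding eq square_integrable_def set_integrable_def by auto
  moreover have "?f \<in> borel_measurable lborel" "?g \<in> borel_measurable lborel"
    by measurable
  ultimately have "(\<integral>x. ?f x * ?g x \<partial>lborel)\<^sup>2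
      \<le> (\<integral>x. (?f x)\<^sup>2 \<partial>lborel) * (\<integral>x. (?g x)\<^sup>2 \<partial>lborel)"
    using fg by (intro integral_Cauchy_Schwarz) auto
  also have "\<dots> = (L2_norm A f * L2_norm A g)\<^sup>2"
    unfolding power_mult_distrib L2_norm_power2 set_lebesgue_integral_def eq ..
  finally have "(\<integral>x. ?f x * ?g x \<partial>lborel) \<le> L2_norm A f * L2_norm A g"
    by (rule power2_le_imp_le) simp
  moreover have "cmod (LINT x:A|lborel. f x * g x) \<le> (\<integral>x. ?f x * ?g x \<partial>lborel)"
    unfolding set_lebesgue_integral_def eq(3)[symmetric] by (rule integral_norm_bound)
  ultimately show ?thesis by simp
qed

text \<open>\<open>C\<close> can be negative only if \<open>A\<close> is empty, which is why the
  second conclusion alone asks for its sign.\<close>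

lemma square_integrable_bounded_mult:
  assumes "set_borel_measurable lborel A g" and "\<And>x. x \<in> A \<Longrightarrow> cmod (g x) \<le> C"
    and f: "square_integrable A f"
  shows "square_integrable A (\<lambda>x. g x * f x)"
    and "0 \<le> C \<Longrightarrow> L2_norm A (\<lambda>x. g x * f x) \<le> C * L2_norm A f"
proof -
  have le: "(cmod (g x * f x))\<^sup>2 \<le> C\<^sup>2 * (cmod (f x))\<^sup>2" if "x \<in> A" for x
    using assms(2)[OF that] by (simp add: norm_mult power_mult_distrib mult_right_mono power_mono)
  have int: "set_integrable lborel A (\<lambda>x. C\<^sup>2 * (cmod (f x))\<^sup>2)"
    using f by (simp add: square_integrable_def)
  show sq: "square_integrable A (\<lambda>x. g x * f x)"
  proof (rule square_integrableI[OF _ int le])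
    note [measurable] = f[THEN square_integrable_measurable]
    have [measurable]: "(\<lambda>x. indicator A x *\<^sub>R g x) \<in> borel_measurable borel"
      using assms(1) by (simp add: set_borel_measurable_def)
    have "(\<lambda>x. (indicator A x *\<^sub>R g x) * (indicator A x *\<^sub>R f x)) \<in> borel_measurable borel"
      by measurable
    also have "(\<lambda>x. (indicator A x *\<^sub>R g x) * (indicator A x *\<^sub>R f x))
        = (\<lambda>x. indicator A x *\<^sub>R (g x * f x))"
      by (auto simp: indicator_def)
    finally show "(\<lambda>x. indicator A x *\<^sub>R (g x * f x)) \<in> borel_measurable borel" .
  qed
  assume "0 \<le> C"
  have "(L2_norm A (\<lambda>x. g x * f x))\<^sup>2 \<le> (C * L2_norm A f)\<^sup>2"
    unfolding power_mult_distrib L2_norm_power2 set_integral_mult_right[symmetric]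
    by (rule set_integral_mono[OF _ int le]) (use sq in \<open>auto simp: square_integrable_def\<close>)
  then show "L2_norm A (\<lambda>x. g x * f x) \<le> C * L2_norm A f"
    by (rule power2_le_imp_le) (simp add: \<open>0 \<le> C\<close>)
qed

lemma square_integrable_cmult:
  assumes "square_integrable A f"
  shows "square_integrable A (\<lambda>x. c * f x)"
proof (rule square_integrableI)
  note [measurable] = assms[THEN square_integrable_measurable]
  have "(\<lambda>x. c * (indicator A x *\<^sub>R f x)) \<in> borel_measurable borel" by measurable
  then show "(\<lambda>x. indicator A x *\<^sub>R (c * f x)) \<in> borel_measurable borel" by simp
  show "set_integrable lborel A (\<lambda>x. (cmod c)\<^sup>2 * (cmod (f x))\<^sup>2)"
    using assms by (simp add: square_integrable_def)
qed (simp add: norm_mult power_mult_distrib)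

lemma square_integrable_cnj:
  assumes "square_integrable A f"
  shows "square_integrable A (\<lambda>x. cnj (f x))"
proof (rule square_integrableI)
  note [measurable] = assms[THEN square_integrable_measurable]
  have "(\<lambda>x. cnj (indicator A x *\<^sub>R f x)) \<in> borel_measurable borel"
    by (rule measurable_compose[OF _ borel_measurable_continuous_onI]) (auto intro!: continuous_intros)
  then show "(\<lambda>x. indicator A x *\<^sub>R cnj (f x)) \<in> borel_measurable borel" by simp
  show "set_integrable lborel A (\<lambda>x. (cmod (f x))\<^sup>2)"
    using assms by (simp add: square_integrable_def)
qed simp

lemma square_integrable_add:
  assumes "square_integrable A f" and "square_integrable A g"
  shows "square_integrable A (\<lambda>x. f x + g x)"
proof (rule square_integrableI)
  note [measurable] = assms[THEN square_integrable_measurable]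
  have "(\<lambda>x. indicator A x *\<^sub>R f x + indicator A x *\<^sub>R g x) \<in> borel_measurable borel" by measurable
  then show "(\<lambda>x. indicator A x *\<^sub>R (f x + g x)) \<in> borel_measurable borel"
    by (simp add: scaleR_add_right)
  show "set_integrable lborel A (\<lambda>x. 2 * (cmod (f x))\<^sup>2 + 2 * (cmod (g x))\<^sup>2)"
    using assms by (auto simp: square_integrable_def)
  fix x
  have "(cmod (f x + g x))\<^sup>2 \<le> (cmod (f x) + cmod (g x))\<^sup>2"
    by (intro power_mono norm_triangle_ineq) auto
  also have "\<dots> \<le> 2 * (cmod (f x))\<^sup>2 + 2 * (cmod (g x))\<^sup>2"
    using sum_squares_bound[of "cmod (f x)" "cmod (g x)"] by (simp add: power2_sum)
  finally show "(cmod (f x + g x))\<^sup>2 \<le> 2 * (cmod (f x))\<^sup>2 + 2 * (cmod (g x))\<^sup>2" .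
qed

lemma square_integrable_diff:
  assumes "square_integrable A f" and "square_integrable A g"
  shows "square_integrable A (\<lambda>x. f x - g x)"
  using square_integrable_add[OF assms(1) square_integrable_cmult[OF assms(2), of "-1"]] by simp

lemma square_integrable_sum:
  assumes "\<And>i. i \<in> J \<Longrightarrow> square_integrable A (f i)"
  shows "square_integrable A (\<lambda>x. \<Sum>i\<in>J. f i x)"
  using assms
proof (induction J rule: infinite_finite_induct)
  case (insert x F)
  then show ?case by (simp add: square_integrable_add)
qed (simp_all add: square_integrable_def set_borel_measurable_def set_integrable_def)

text \<open>Expanding |f + g|^2 leaves two cross terms, pairings with one conjugated factor, and
  Cauchy-Schwarz bounds each of them by the product of the norms.\<close>

lemma L2_norm_triangle:
  assumes "square_integrable A f" and "square_integrable A g"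
  shows "L2_norm A (\<lambda>x. f x + g x) \<le> L2_norm A f + L2_norm A g"
proof (rule power2_le_imp_le)
  have eq: "of_real ((cmod (f x + g x))\<^sup>2) =
    of_real ((cmod (f x))\<^sup>2) + of_real ((cmod (g x))\<^sup>2) + f x * cnj (g x) + cnj (f x) * g x" for x
    unfolding complex_norm_square by (simp add: algebra_simps)
  note si = assms assms[THEN square_integrable_cnj]
  have 1: "set_integrable lborel A (\<lambda>x. complex_of_real ((cmod (u x))\<^sup>2))" if "square_integrable A u" for u
    using square_integrable_set_mult[OF that square_integrable_cnj[OF that]]
    by (simp only: complex_norm_square)
  have "complex_of_real ((L2_norm A (\<lambda>x. f x + g x))\<^sup>2)
    = of_real ((L2_norm A f)\<^sup>2) + of_real ((L2_norm A g)\<^sup>2)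
      + (LINT x:A|lborel. f x * cnj (g x)) + (LINT x:A|lborel. cnj (f x) * g x)"
    unfolding L2_norm_power2 set_integral_complex_of_real[symmetric] eq
    using 1[OF assms(1)] 1[OF assms(2)] square_integrable_set_mult[OF si(1,4)]
      square_integrable_set_mult[OF si(3,2)]
    by simp
  then have "(L2_norm A (\<lambda>x. f x + g x))\<^sup>2 = Re (of_real ((L2_norm A f)\<^sup>2) + of_real ((L2_norm A g)\<^sup>2)
      + (LINT x:A|lborel. f x * cnj (g x)) + (LINT x:A|lborel. cnj (f x) * g x))"
    by (metis Re_complex_of_real)
  also have "\<dots> \<le> (L2_norm A f)\<^sup>2 + (L2_norm A g)\<^sup>2 + cmod (LINT x:A|lborel. f x * cnj (g x))
      + cmod (LINT x:A|lborel. cnj (f x) * g x)"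
    using complex_Re_le_cmod[of "LINT x:A|lborel. f x * cnj (g x)"]
      complex_Re_le_cmod[of "LINT x:A|lborel. cnj (f x) * g x"] by simp
  also have "\<dots> \<le> (L2_norm A f)\<^sup>2 + (L2_norm A g)\<^sup>2 + L2_norm A f * L2_norm A g + L2_norm A f * L2_norm A g"
    using L2_Cauchy_Schwarz[OF si(1,4)] L2_Cauchy_Schwarz[OF si(3,2)] by (simp add: L2_norm_def)
  also have "\<dots> = (L2_norm A f + L2_norm A g)\<^sup>2"
    by (simp add: power2_sum)
  finally show "(L2_norm A (\<lambda>x. f x + g x))\<^sup>2 \<le> (L2_norm A f + L2_norm A g)\<^sup>2" .
qed (intro add_nonneg_nonneg L2_norm_nonneg)

lemma L2_norm_minus_commute: "L2_norm A (\<lambda>x. f x - g x) = L2_norm A (\<lambda>x. g x - f x)"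
  unfolding L2_norm_def by (subst norm_minus_commute) (rule refl)

lemma L2_norm_diff_ineq:
  assumes "square_integrable A f" and "square_integrable A g"
  shows "\<bar>L2_norm A f - L2_norm A g\<bar> \<le> L2_norm A (\<lambda>x. f x - g x)"
  using L2_norm_triangle[OF square_integrable_diff[OF assms] assms(2)]
    L2_norm_triangle[OF square_integrable_diff[OF assms(2,1)] assms(1)] L2_norm_minus_commute[of A f g]
  by (simp only: abs_le_iff diff_add_cancel) linarith

text \<open>Strong convergence implies weak convergence: Cauchy-Schwarz bounds the difference of the
  pairings.\<close>

lemma L2_tendsto_integral:
  assumes "L2_tendsto A u g Fl" and g: "square_integrable A g" and h: "square_integrable A h"
  shows "((\<lambda>i. LINT x:A|lborel. u i x * h x) \<longlongrightarrow> (LINT x:A|lborel. g x * h x)) Fl"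
proof -
  have ev: "\<forall>\<^sub>F i in Fl. square_integrable A (\<lambda>x. u i x - g x)"
    and lim: "((\<lambda>i. L2_norm A (\<lambda>x. u i x - g x)) \<longlongrightarrow> 0) Fl"
    using assms(1) by (auto simp: L2_tendsto_def)
  have "((\<lambda>i. (LINT x:A|lborel. u i x * h x) - (LINT x:A|lborel. g x * h x)) \<longlongrightarrow> 0) Fl"
  proof (rule Lim_null_comparison)
    show "\<forall>\<^sub>F i in Fl. norm ((LINT x:A|lborel. u i x * h x) - (LINT x:A|lborel. g x * h x))
      \<le> L2_norm A (\<lambda>x. u i x - g x) * L2_norm A h"
      using ev
    proof eventually_elim
      case (elim i)
      \<comment> \<open>Convergence provides square integrability of \<open>u i - g\<close> only;
        adding \<open>g\<close> back gives it for \<open>u i\<close>.\<close>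
      have "set_integrable lborel A (\<lambda>x. u i x * h x)"
        using square_integrable_set_mult[OF square_integrable_add[OF elim g] h] by simp
      then have "(LINT x:A|lborel. u i x * h x) - (LINT x:A|lborel. g x * h x)
          = (LINT x:A|lborel. (u i x - g x) * h x)"
        using square_integrable_set_mult[OF g h]
        by (simp add: left_diff_distrib)
      then show ?case using L2_Cauchy_Schwarz[OF elim h] by simp
    qed
    show "((\<lambda>i. L2_norm A (\<lambda>x. u i x - g x) * L2_norm A h) \<longlongrightarrow> 0) Fl"
      using tendsto_mult_left_zero[OF lim] .
  qed
  then show ?thesis by (rule LIM_zero_cancel)
qed

lemma L2_continuous_on_norm:
  assumes "L2_continuous_on I A u"
  shows "continuous_on I (\<lambda>t. L2_norm A (u t))"
  unfolding continuous_on_def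
proof
  fix t assume t: "t \<in> I"
  have lim: "((\<lambda>s. L2_norm A (\<lambda>x. u s x - u t x)) \<longlongrightarrow> 0) (at t within I)"
    and sq: "\<And>s. s \<in> I \<Longrightarrow> square_integrable A (u s)"
    using assms t by (auto simp: L2_continuous_on_def L2_tendsto_def)
  have "((\<lambda>s. L2_norm A (u s) - L2_norm A (u t)) \<longlongrightarrow> 0) (at t within I)"
  proof (rule Lim_null_comparison[OF _ lim])
    show "\<forall>\<^sub>F s in at t within I. norm (L2_norm A (u s) - L2_norm A (u t)) \<le> L2_norm A (\<lambda>x. u s x - u t x)"
      unfolding eventually_at_filter real_norm_def
      using L2_norm_diff_ineq[OF sq sq[OF t]] by (auto intro!: always_eventually)
  qed
  then show "((\<lambda>t. L2_norm A (u t)) \<longlongrightarrow> L2_norm A (u t)) (at t within I)"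
    by (simp add: LIM_zero_cancel)
qed

lemma L2_continuous_on_integral:
  assumes "L2_continuous_on I A u" and "square_integrable A h"
  shows "continuous_on I (\<lambda>t. LINT x:A|lborel. u t x * h x)"
  unfolding continuous_on_def
  using assms L2_tendsto_integral[OF _ _ assms(2)] by (auto simp: L2_continuous_on_def)

subsection \<open>The Fourier transform\<close>

lemma norm_integral_le:
  fixes f :: "'a \<Rightarrow> 'b::{banach, second_countable_topology}"
  assumes "integrable M g" and "\<And>x. norm (f x) \<le> g x"
  shows "norm (\<integral>x. f x \<partial>M) \<le> (\<integral>x. g x \<partial>M)"
proof -
  have "norm (\<integral>x. f x \<partial>M) \<le> (\<integral>x. norm (f x) \<partial>M)"
    by (rule integral_norm_bound)
  also have "\<dots> \<le> (\<integral>x. g x \<partial>M)"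
    using assms norm_ge_zero order_trans by (intro integral_mono') blast+
  finally show ?thesis .
qed

text \<open>A bounded kernel leaves the integrand dominated on the plane by a constant times the
  product of the two integrable moduli. The kernels in view are exponentials, which are bounded but
  have no decay of their own.\<close>

lemma Fubini_kernel:
  fixes a b :: "real \<Rightarrow> complex" and c :: "real \<Rightarrow> real \<Rightarrow> complex"
  assumes a: "integrable lborel a" and b: "integrable lborel b"
    and c: "case_prod c \<in> borel_measurable borel" and C: "\<And>x y. cmod (c x y) \<le> C"
  shows "(\<integral>x. a x * (\<integral>y. b y * c x y \<partial>lborel) \<partial>lborel) = (\<integral>y. b y * (\<integral>x. a x * c x y \<partial>lborel) \<partial>lborel)"
proof -
  have [measurable]: "a \<in> borel_measurable borel" "b \<in> borel_measurable borel"
    using a b by auto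
  have [measurable]: "(\<lambda>p. c (fst p) (snd p)) \<in> borel_measurable (borel \<Otimes>\<^sub>M borel)"
    using c by (simp add: case_prod_beta' borel_prod)
  have C0: "0 \<le> C" using C[of 0 0] norm_ge_zero order_trans by blast
  have le: "norm (a x * b y * c x y) \<le> norm (of_real C * (a x * of_real (norm (b y))))" for x y
    using mult_left_mono[OF C[of x y], of "norm (a x * b y)"] C0 by (simp add: norm_mult mult_ac)
  have "integrable (lborel \<Otimes>\<^sub>M lborel) (\<lambda>p. a (fst p) * norm (b (snd p)))"
  proof (rule lborel_pair.Fubini_integrable)
    show "integrable lborel (\<lambda>x. LBINT y. norm (a (fst (x, y)) * complex_of_real (norm (b (snd (x, y))))))"
      using a b by (simp add: norm_mult)
  qed (use b in auto)
  then have "integrable (lborel \<Otimes>\<^sub>M lborel) (\<lambda>p. a (fst p) * b (snd p) * c (fst p) (snd p))"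
    by (rule Bochner_Integration.integrable_bound[OF integrable_mult_right[of "of_real C"]])
       (use le in auto)
  then have "(\<integral>y. (\<integral>x. a x * b y * c x y \<partial>lborel) \<partial>lborel) = (\<integral>x. (\<integral>y. a x * b y * c x y \<partial>lborel) \<partial>lborel)"
    by (intro lborel_pair.Fubini_integral) (simp add: case_prod_beta')
  moreover have "(\<integral>y. a x * b y * c x y \<partial>lborel) = a x * (\<integral>y. b y * c x y \<partial>lborel)" for x
    by (simp add: mult.assoc)
  moreover have "(\<integral>x. a x * b y * c x y \<partial>lborel) = b y * (\<integral>x. a x * c x y \<partial>lborel)" for y
    by (subst integral_mult_right_zero[symmetric]) (simp only: mult_ac)
  ultimately show ?thesis by simp
qed

section \<open>Transforms of bounded functions with compact support\<close>

text \<open>This class is closed under multiplication by powers of k, hence under differentiation of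
  the transform, and it contains the indicators of bounded Borel sets, which suffice to detect that
  a function of k vanishes almost everywhere.\<close>

definition bounded_compact_support :: "(real \<Rightarrow> complex) \<Rightarrow> bool" where
  "bounded_compact_support h \<longleftrightarrow>
     h \<in> borel_measurable borel \<and> (\<exists>M. \<forall>k. cmod (h k) \<le> M) \<and> (\<exists>R. \<forall>k. R < \<bar>k\<bar> \<longrightarrow> h k = 0)"

text \<open>Same kernel and same lack of a normalising factor as in \<open>is_fourier\<close>; for
  an integrable function the integral converges absolutely and no limit in the mean is
  involved.\<close>

definition fourier_integral :: "(real \<Rightarrow> complex) \<Rightarrow> real \<Rightarrow> complex" where
  "fourier_integral h x = (\<integral>k. h k * cis (- (k * x)) \<partial>lborel)"

lemma bounded_compact_support_power_mult:
  assumes "bounded_compact_support h"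
  shows "bounded_compact_support (\<lambda>k. c * of_real (k ^ n) * h k)"
proof -
  obtain M R where [measurable]: "h \<in> borel_measurable borel"
    and M: "\<And>k. cmod (h k) \<le> M" and R: "\<And>k. R < \<bar>k\<bar> \<Longrightarrow> h k = 0"
    using assms by (auto simp: bounded_compact_support_def)
  have "0 \<le> M" using M[of 0] norm_ge_zero order_trans by blast
  have "cmod (c * of_real (k ^ n) * h k) \<le> cmod c * \<bar>R\<bar> ^ n * M" for k
  proof (cases "R < \<bar>k\<bar>")
    case False
    then have "\<bar>k\<bar> ^ n \<le> \<bar>R\<bar> ^ n" by (intro power_mono) auto
    then show ?thesis
      unfolding norm_mult norm_of_real power_abs using M \<open>0 \<le> M\<close> by (intro mult_mono) auto
  qed (use R \<open>0 \<le> M\<close> in simp)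
  moreover have "(\<lambda>k. c * of_real (k ^ n) * h k) \<in> borel_measurable borel" by measurable
  ultimately show ?thesis
    using R unfolding bounded_compact_support_def by (metis mult_zero_right)
qed

lemma bounded_compact_support_integrable:
  assumes "bounded_compact_support h"
  shows "integrable lborel h"
proof -
  obtain M R where h: "h \<in> borel_measurable borel"
    and M: "\<And>k. cmod (h k) \<le> M" and R: "\<And>k. R < \<bar>k\<bar> \<Longrightarrow> h k = 0"
    using assms by (auto simp: bounded_compact_support_def)
  have "0 \<le> M" using M[of 0] norm_ge_zero order_trans by blast
  show ?thesis
  proof (rule Bochner_Integration.integrable_bound)
    show "integrable lborel (\<lambda>k. M * indicator {-\<bar>R\<bar>..\<bar>R\<bar>} k)" by simp
    show "AE k in lborel. norm (h k) \<le> norm (M * indicator {-\<bar>R\<bar>..\<bar>R\<bar>} k)"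
    proof (intro AE_I2)
      fix k show "norm (h k) \<le> norm (M * indicator {-\<bar>R\<bar>..\<bar>R\<bar>} k)"
        using M[of k] R[of k] \<open>0 \<le> M\<close> by (cases "R < \<bar>k\<bar>") (auto simp: indicator_def)
    qed
  qed (use h in simp)
qed

lemma continuous_on_cis_mult [continuous_intros]:
  "continuous_on S f \<Longrightarrow> continuous_on S (\<lambda>x. cis (f x))"
  unfolding cis_conv_exp by (intro continuous_intros)

lemma borel_measurable_cis [measurable]: "cis \<in> borel_measurable borel"
  by (intro borel_measurable_continuous_onI continuous_intros)

lemma integrable_mult_cis:
  assumes "integrable lborel (h :: real \<Rightarrow> complex)"
  shows "integrable lborel (\<lambda>k. h k * cis (c * k))"
proof (rule Bochner_Integration.integrable_bound[OF assms])
  have [measurable]: "h \<in> borel_measurable borel" using assms by auto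
  show "(\<lambda>k. h k * cis (c * k)) \<in> borel_measurable lborel" by measurable
qed (simp add: norm_mult)

lemma cis_Taylor: "cmod (cis t - 1 - \<i> * of_real t) \<le> t\<^sup>2 / 2"
  using iexp_approx1[of t 1] by (simp add: cis_conv_exp diff_diff_eq power2_eq_square)

text \<open>The second-order Taylor remainder of the exponential bounds the error of the linear
  approximation by (y - x)^2 / 2 times the integral of k^2 |h|, which is finite because the support
  is bounded.\<close>

lemma fourier_integral_has_vector_derivative:
  assumes h: "bounded_compact_support h"
  shows "(fourier_integral h has_vector_derivative fourier_integral (\<lambda>k. - \<i> * of_real k * h k) x) (at x)"
  unfolding has_vector_derivative_def
proof (rule has_derivativeI_sandwich[where e=1])
  let ?h1 = "\<lambda>k. - \<i> * of_real k * h k"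
  define C where "C = (\<integral>k. cmod (of_real (k\<^sup>2) * h k) \<partial>lborel)"
  have int: "integrable lborel h" "integrable lborel ?h1" "integrable lborel (\<lambda>k. of_real (k\<^sup>2) * h k)"
    using bounded_compact_support_integrable[OF h]
      bounded_compact_support_integrable[OF bounded_compact_support_power_mult[OF h, of "-\<i>" 1]]
      bounded_compact_support_integrable[OF bounded_compact_support_power_mult[OF h, of 1 2]]
    by (simp_all only: power_one_right mult_1)
  have int_cis: "integrable lborel (\<lambda>k. g k * cis (- (k * y)))" if "integrable lborel g" for g y
    using integrable_mult_cis[OF that, of "-y"] by (simp add: mult.commute)
  show "bounded_linear (\<lambda>y. y *\<^sub>R fourier_integral ?h1 x)"
    by (rule bounded_linear_scaleR_left)
  fix y :: real assume "y \<noteq> x"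
  have eq: "fourier_integral h y - fourier_integral h x - (y - x) *\<^sub>R fourier_integral ?h1 x
     = (\<integral>k. h k * cis (- (k * x)) * (cis (- (k * (y - x))) - 1 - \<i> * of_real (- (k * (y - x)))) \<partial>lborel)"
  proof -
    have "h k * cis (- (k * x)) * (cis (- (k * (y - x))) - 1 - \<i> * of_real (- (k * (y - x))))
      = h k * cis (- (k * y)) - h k * cis (- (k * x)) - (y - x) *\<^sub>R (?h1 k * cis (- (k * x)))" for k
    proof -
      have "cis (- (k * y)) = cis (- (k * x)) * cis (- (k * (y - x)))"
        by (simp add: cis_mult algebra_simps)
      then show ?thesis by (simp add: scaleR_conv_of_real algebra_simps)
    qed
    then show ?thesis
      unfolding fourier_integral_def using int int_cis by simp
  qed
  have le: "norm (h k * cis (- (k * x)) * (cis (- (k * (y - x))) - 1 - \<i> * of_real (- (k * (y - x)))))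
      \<le> ((y - x)\<^sup>2 / 2) * cmod (of_real (k\<^sup>2) * h k)" for k
    using mult_left_mono[OF cis_Taylor[of "- (k * (y - x))"] norm_ge_zero[of "h k"]]
    by (simp add: norm_mult power_mult_distrib mult_ac norm_power del: of_real_mult of_real_minus of_real_diff)
  have "cmod (fourier_integral h y - fourier_integral h x - (y - x) *\<^sub>R fourier_integral ?h1 x)
    \<le> (\<integral>k. ((y - x)\<^sup>2 / 2) * cmod (of_real (k\<^sup>2) * h k) \<partial>lborel)"
    unfolding eq
  proof (rule Bochner_Integration.integral_norm_bound_integral)
    show "integrable lborel (\<lambda>k. h k * cis (- (k * x)) * (cis (- (k * (y - x))) - 1 - \<i> * of_real (- (k * (y - x)))))"
    proof (rule Bochner_Integration.integrable_bound)
      show "integrable lborel (\<lambda>k. ((y - x)\<^sup>2 / 2) * cmod (of_real (k\<^sup>2) * h k))"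
        using int(3) by simp
      have [measurable]: "h \<in> borel_measurable borel" using int by auto
      show "(\<lambda>k. h k * cis (- (k * x)) * (cis (- (k * (y - x))) - 1 - \<i> * of_real (- (k * (y - x)))))
        \<in> borel_measurable lborel" by measurable
    qed (use le in \<open>simp add: abs_mult\<close>)
  qed (use int le in simp_all)
  also have "\<dots> = ((y - x)\<^sup>2 / 2) * C"
    by (simp add: C_def)
  finally show "norm (fourier_integral h y - fourier_integral h x - (y - x) *\<^sub>R fourier_integral ?h1 x) / norm (y - x)
      \<le> \<bar>y - x\<bar> * (C / 2)"
    using \<open>y \<noteq> x\<close> by (simp add: divide_le_eq power2_eq_square mult_ac flip: abs_mult)
next
  have "((\<lambda>y. \<bar>y - x\<bar> * (C / 2)) \<longlongrightarrow> \<bar>x - x\<bar> * (C / 2)) (at x)" for C :: real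
    by (intro tendsto_intros)
  then show "((\<lambda>y. \<bar>y - x\<bar> * ((\<integral>k. cmod (of_real (k\<^sup>2) * h k) \<partial>lborel) / 2)) \<longlongrightarrow> 0) (at x)"
    by simp
qed simp


section \<open>Gaussian regularisation and square integrability of the transform\<close>

text \<open>The characteristic function of the standard normal law, dilated: a Gaussian of width s
  is transformed into one of width 1/s.\<close>

lemma gaussian_fourier:
  assumes "s > 0"
  shows "integrable lborel (\<lambda>x. exp (- (x / s)\<^sup>2 / 2))"
    and "(\<integral>x. of_real (exp (- (x / s)\<^sup>2 / 2)) * cis (t * x) \<partial>lborel)
      = of_real (s * sqrt (2 * pi) * exp (- (t * s)\<^sup>2 / 2))"
proof -
  have eq: "exp (- (x / s)\<^sup>2 / 2) = sqrt (2 * pi) * std_normal_density (0 + (1 / s) * x)" for x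
    by (simp add: std_normal_density_def)
  show "integrable lborel (\<lambda>x. exp (- (x / s)\<^sup>2 / 2))"
    unfolding eq using assms
    by (intro integrable_mult_right lborel_integrable_real_affine) auto
  have "(\<integral>x. std_normal_density x *\<^sub>R iexp (u * x) \<partial>lborel) = of_real (exp (- u\<^sup>2 / 2))" for u
    using fun_cong[OF char_std_normal_distribution, of u] unfolding char_def
    by (subst (asm) integral_density) auto
  then have *: "(\<integral>x. of_real (exp (- x\<^sup>2 / 2)) * cis (u * x) \<partial>lborel) = of_real (sqrt (2 * pi) * exp (- u\<^sup>2 / 2))" for u
  proof -
    have "of_real (exp (- x\<^sup>2 / 2)) * cis (u * x) = of_real (sqrt (2 * pi)) * (std_normal_density x *\<^sub>R iexp (u * x))" for x
      by (simp add: std_normal_density_def scaleR_conv_of_real cis_conv_exp)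
    then show ?thesis
      using \<open>(\<integral>x. std_normal_density x *\<^sub>R iexp (u * x) \<partial>lborel) = of_real (exp (- u\<^sup>2 / 2))\<close>
      by (simp only: integral_mult_right_zero of_real_mult)
  qed
  have "(\<integral>x. of_real (exp (- (x / s)\<^sup>2 / 2)) * cis (t * x) \<partial>lborel)
    = \<bar>s\<bar> *\<^sub>R (\<integral>x. of_real (exp (- ((0 + s * x) / s)\<^sup>2 / 2)) * cis (t * (0 + s * x)) \<partial>lborel)"
    by (rule lborel_integral_real_affine) (use assms in simp)
  also have "\<dots> = of_real (s * sqrt (2 * pi) * exp (- (t * s)\<^sup>2 / 2))"
    using assms *[of "t * s"] by (simp add: scaleR_conv_of_real mult.assoc)
  finally show "(\<integral>x. of_real (exp (- (x / s)\<^sup>2 / 2)) * cis (t * x) \<partial>lborel)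
      = of_real (s * sqrt (2 * pi) * exp (- (t * s)\<^sup>2 / 2))" .
qed

text \<open>The integrand is 2 pi times the normal density of mean k and deviation 1/s, so its mass
  does not depend on s.\<close>

lemma gaussian_integral:
  assumes "s > 0"
  shows "integrable lborel (\<lambda>x. s * sqrt (2 * pi) * exp (- ((x - k) * s)\<^sup>2 / 2))"
    and "(\<integral>x. s * sqrt (2 * pi) * exp (- ((x - k) * s)\<^sup>2 / 2) \<partial>lborel) = 2 * pi"
proof -
  have *: "s * sqrt (2 * pi) * exp (- ((x - k) * s)\<^sup>2 / 2) = 2 * pi * normal_density k (1 / s) x" for x
  proof -
    have sq: "2 * pi / sqrt (2 * pi) = sqrt (2 * pi)"
      by (simp add: real_div_sqrt)
    have "sqrt (2 * pi * (1 / s)\<^sup>2) = sqrt (2 * pi) / s"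
      using assms by (simp add: real_sqrt_mult real_sqrt_divide power_divide)
    moreover have "- (x - k)\<^sup>2 / (2 * (1 / s)\<^sup>2) = - ((x - k) * s)\<^sup>2 / 2"
      by (simp add: power_mult_distrib power_divide)
    ultimately have "normal_density k (1 / s) x = (s / sqrt (2 * pi)) * exp (- ((x - k) * s)\<^sup>2 / 2)"
      unfolding normal_density_def by (simp only: divide_divide_eq_right mult_1)
    then have "2 * pi * normal_density k (1 / s) x
      = s * (2 * pi / sqrt (2 * pi)) * exp (- ((x - k) * s)\<^sup>2 / 2)"
      by (simp only: times_divide_eq_left times_divide_eq_right mult_ac)
    then show ?thesis unfolding sq by (rule sym)
  qed
  show "integrable lborel (\<lambda>x. s * sqrt (2 * pi) * exp (- ((x - k) * s)\<^sup>2 / 2))"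
    unfolding * using assms by (intro integrable_mult_right integrable_normal_density) simp
  show "(\<integral>x. s * sqrt (2 * pi) * exp (- ((x - k) * s)\<^sup>2 / 2) \<partial>lborel) = 2 * pi"
    unfolding * using assms by (simp add: integral_normal_density)
qed

lemma fourier_integral_continuous:
  assumes "bounded_compact_support h"
  shows "continuous_on UNIV (fourier_integral h)"
  using fourier_integral_has_vector_derivative[OF assms]
  by (auto intro!: continuous_at_imp_continuous_on has_vector_derivative_continuous)

lemma fourier_integral_bound: "cmod (fourier_integral h x) \<le> (\<integral>k. cmod (h k) \<partial>lborel)"
  unfolding fourier_integral_def
  using integral_norm_bound[of lborel "\<lambda>k. h k * cis (- (k * x))"] by (simp add: norm_mult)

text \<open>A substitute for Plancherel. Writing |F|^2 as a double integral over frequencies and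
  exchanging integrals replaces the Gaussian weight by its transform, a kernel of mass 2 pi for
  every s. The bound is therefore uniform in s.\<close>

lemma fourier_integral_gaussian_bound:
  assumes h: "bounded_compact_support h" and M: "\<And>k. cmod (h k) \<le> M" and "s > 0"
  shows "integrable lborel (\<lambda>x. exp (- (x / s)\<^sup>2 / 2) * (cmod (fourier_integral h x))\<^sup>2)"
    and "(\<integral>x. exp (- (x / s)\<^sup>2 / 2) * (cmod (fourier_integral h x))\<^sup>2 \<partial>lborel)
      \<le> 2 * pi * M * (\<integral>k. cmod (h k) \<partial>lborel)"
proof -
  let ?F = "fourier_integral h" and ?L = "\<integral>k. cmod (h k) \<partial>lborel"
  define w where "w x = complex_of_real (exp (- (x / s)\<^sup>2 / 2))" for x
  note int = bounded_compact_support_integrable[OF h]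
  have "0 \<le> M" using M[of 0] norm_ge_zero order_trans by blast
  have [measurable]: "h \<in> borel_measurable borel" using int by auto
  have [measurable]: "?F \<in> borel_measurable borel"
    by (rule borel_measurable_continuous_onI) (rule fourier_integral_continuous[OF h])
  have w: "integrable lborel w"
    unfolding w_def using gaussian_fourier(1)[OF \<open>s > 0\<close>] by simp
  then have [measurable]: "w \<in> borel_measurable borel" by auto
  have int1: "integrable lborel (\<lambda>x. w x * g x)"
    if "g \<in> borel_measurable borel" "\<And>x. cmod (g x) \<le> C" for g C
  proof (rule Bochner_Integration.integrable_bound)
    show "integrable lborel (\<lambda>x. of_real C * w x)" using w by simp
    have "0 \<le> C" using that(2)[of 0] norm_ge_zero order_trans by blast
    then show "AE x in lborel. norm (w x * g x) \<le> norm (of_real C * w x)"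
      using that(2) by (auto simp: norm_mult mult.commute[of "norm (w _)"] intro!: AE_I2 mult_right_mono)
  qed (use that(1) in measurable)
  have cnj_F: "cnj (?F x) = (\<integral>l. cnj (h l) * cis (l * x) \<partial>lborel)" for x
  proof -
    have "(\<integral>l. cnj (h l) * cis (l * x) \<partial>lborel) = (\<integral>l. cnj (h l * cis (- (l * x))) \<partial>lborel)"
      by (simp only: complex_cnj_mult cis_cnj minus_minus)
    then show ?thesis unfolding fourier_integral_def by (simp only: Bochner_Integration.integral_cnj)
  qed
  have wF: "integrable lborel (\<lambda>x. w x * cnj (?F x))"
  proof (rule int1)
    show "(\<lambda>x. cnj (?F x)) \<in> borel_measurable borel"
      by (intro borel_measurable_continuous_onI continuous_intros fourier_integral_continuous[OF h])
  qed (use fourier_integral_bound[of h] in simp)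
  have "complex_integrable lborel (\<lambda>x. w x * of_real ((cmod (?F x))\<^sup>2))"
  proof (rule int1)
    show "cmod (of_real ((cmod (?F x))\<^sup>2)) \<le> ?L\<^sup>2" for x
      using fourier_integral_bound[of h x] by (simp add: power_mono norm_power)
  qed measurable
  then have "complex_integrable lborel (\<lambda>x. of_real (exp (- (x / s)\<^sup>2 / 2) * (cmod (?F x))\<^sup>2))"
    by (simp add: w_def)
  then show "integrable lborel (\<lambda>x. exp (- (x / s)\<^sup>2 / 2) * (cmod (?F x))\<^sup>2)"
    by (simp only: complex_of_real_integrable_eq)
  have meas: "(\<lambda>(x, k). cis (- (k * x))) \<in> borel_measurable borel"
     "(\<lambda>(x, k). cis (k * x)) \<in> borel_measurable borel"
    by (auto simp: case_prod_beta' intro!: borel_measurable_continuous_onI continuous_intros)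
  \<comment> \<open>The weight turns the product of transforms into a convolution: the conjugate of
    \<open>h\<close> is averaged around k with the transformed Gaussian.\<close>
  have inner: "(\<integral>x. w x * cnj (?F x) * cis (- (k * x)) \<partial>lborel)
     = (\<integral>l. cnj (h l) * of_real (s * sqrt (2 * pi) * exp (- ((l - k) * s)\<^sup>2 / 2)) \<partial>lborel)" for k
  proof -
    have "(\<integral>x. w x * cnj (?F x) * cis (- (k * x)) \<partial>lborel)
       = (\<integral>x. w x * cis (- (k * x)) * (\<integral>l. cnj (h l) * cis (l * x) \<partial>lborel) \<partial>lborel)"
      unfolding cnj_F by (simp add: mult_ac)
    also have "\<dots> = (\<integral>l. cnj (h l) * (\<integral>x. w x * cis (- (k * x)) * cis (l * x) \<partial>lborel) \<partial>lborel)"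
      by (rule Fubini_kernel[OF _ _ meas(2), of _ _ 1])
         (use int int1[of "\<lambda>x. cis (- (k * x))" 1] in simp_all)
    also have "(\<lambda>l. \<integral>x. w x * cis (- (k * x)) * cis (l * x) \<partial>lborel)
       = (\<lambda>l. of_real (s * sqrt (2 * pi) * exp (- ((l - k) * s)\<^sup>2 / 2)))"
      unfolding gaussian_fourier(2)[OF \<open>s > 0\<close>, symmetric]
      by (simp add: w_def cis_mult mult.assoc left_diff_distrib)
    finally show ?thesis .
  qed
  have inner_le: "cmod (\<integral>x. w x * cnj (?F x) * cis (- (k * x)) \<partial>lborel) \<le> M * (2 * pi)" for k
  proof -
    have "cmod (\<integral>x. w x * cnj (?F x) * cis (- (k * x)) \<partial>lborel)
      \<le> (\<integral>l. M * (s * sqrt (2 * pi) * exp (- ((l - k) * s)\<^sup>2 / 2)) \<partial>lborel)"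
      unfolding inner
    proof (rule norm_integral_le)
      show "integrable lborel (\<lambda>l. M * (s * sqrt (2 * pi) * exp (- ((l - k) * s)\<^sup>2 / 2)))"
        using gaussian_integral(1)[OF \<open>s > 0\<close>] by simp
    qed (use \<open>s > 0\<close> M in \<open>auto simp: norm_mult intro!: mult_right_mono\<close>)
    then show ?thesis using gaussian_integral(2)[OF \<open>s > 0\<close>] by simp
  qed
  have "complex_of_real (\<integral>x. exp (- (x / s)\<^sup>2 / 2) * (cmod (?F x))\<^sup>2 \<partial>lborel)
     = (\<integral>x. w x * cnj (?F x) * (\<integral>k. h k * cis (- (k * x)) \<partial>lborel) \<partial>lborel)"
    unfolding fourier_integral_def[symmetric] integral_complex_of_real[symmetric]
    by (simp only: w_def of_real_mult complex_norm_square mult_ac)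
  also have "\<dots> = (\<integral>k. h k * (\<integral>x. w x * cnj (?F x) * cis (- (k * x)) \<partial>lborel) \<partial>lborel)"
    by (rule Fubini_kernel[OF wF int meas(1), of 1]) simp
  finally have eq: "complex_of_real (\<integral>x. exp (- (x / s)\<^sup>2 / 2) * (cmod (?F x))\<^sup>2 \<partial>lborel)
    = (\<integral>k. h k * (\<integral>x. w x * cnj (?F x) * cis (- (k * x)) \<partial>lborel) \<partial>lborel)" .
  have "\<bar>\<integral>x. exp (- (x / s)\<^sup>2 / 2) * (cmod (?F x))\<^sup>2 \<partial>lborel\<bar>
    = cmod (\<integral>k. h k * (\<integral>x. w x * cnj (?F x) * cis (- (k * x)) \<partial>lborel) \<partial>lborel)"
    unfolding eq[symmetric] by (rule norm_of_real[symmetric])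
  also have "\<dots> \<le> (\<integral>k. cmod (h k) * (M * (2 * pi)) \<partial>lborel)"
    by (rule norm_integral_le)
       (use int inner_le \<open>0 \<le> M\<close> in \<open>auto simp: norm_mult intro!: mult_left_mono\<close>)
  finally show "(\<integral>x. exp (- (x / s)\<^sup>2 / 2) * (cmod (?F x))\<^sup>2 \<partial>lborel) \<le> 2 * pi * M * ?L"
    by (simp add: mult_ac)
qed

text \<open>The weights of width n + 1 increase to 1 while the weighted integrals stay below one
  constant, so monotone convergence applies.\<close>

lemma square_integrable_fourier_integral:
  assumes h: "bounded_compact_support h"
  shows "square_integrable UNIV (fourier_integral h)"
proof -
  let ?F = "fourier_integral h"
  define u where "u n x = exp (- (x / (real (Suc n)))\<^sup>2 / 2) * (cmod (?F x))\<^sup>2" for n x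
  obtain M where M: "\<And>k. cmod (h k) \<le> M"
    using h by (auto simp: bounded_compact_support_def)
  define C where "C = 2 * pi * M * (\<integral>k. cmod (h k) \<partial>lborel)"
  have u: "integrable lborel (u n)" "integral\<^sup>L lborel (u n) \<le> C" for n
    using fourier_integral_gaussian_bound[OF h M, of "real (Suc n)"] unfolding u_def C_def by simp_all
  have mono: "u m x \<le> u n x" if "m \<le> n" for m n x
  proof -
    have "\<bar>x / real (Suc n)\<bar> \<le> \<bar>x / real (Suc m)\<bar>"
      using that by (simp add: abs_divide divide_left_mono)
    then have "(x / real (Suc n))\<^sup>2 \<le> (x / real (Suc m))\<^sup>2"
      by (rule abs_le_square_iff[THEN iffD1])
    then show ?thesis unfolding u_def by (intro mult_right_mono) auto
  qed
  have "incseq (\<lambda>n. integral\<^sup>L lborel (u n))"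
    by (intro incseq_SucI integral_mono u mono) simp
  then obtain L where L: "(\<lambda>n. integral\<^sup>L lborel (u n)) \<longlonglongrightarrow> L"
    by (rule incseq_convergent[where B=C]) (use u in auto)
  have [measurable]: "?F \<in> borel_measurable borel"
    by (rule borel_measurable_continuous_onI) (rule fourier_integral_continuous[OF h])
  have "integrable lborel (\<lambda>x. (cmod (?F x))\<^sup>2)"
  proof (rule integrable_monotone_convergence[OF u(1) _ _ L])
    show "AE x in lborel. mono (\<lambda>n. u n x)"
      using mono by (auto simp: mono_def)
    have "(\<lambda>n. u n x) \<longlonglongrightarrow> exp (- 0\<^sup>2 / 2) * (cmod (?F x))\<^sup>2" for x
      unfolding u_def
      by (intro tendsto_intros LIMSEQ_Suc[OF lim_const_over_n])  simp
    then show "AE x in lborel. (\<lambda>n. u n x) \<longlonglongrightarrow> (cmod (?F x))\<^sup>2" by simp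
  qed measurable
  then show ?thesis
    by (simp add: square_integrable_def set_borel_measurable_def set_integrable_def)
qed

text \<open>Since the Fourier transform is defined as a limit in the mean, this only needs Fubini's theorem
  for the truncated integrals.\<close>

lemma is_fourier_multiplication_formula:
  assumes "is_fourier g G" and h: "bounded_compact_support h"
  shows "(\<integral>k. G k * h k \<partial>lborel) = (\<integral>x. g x * fourier_integral h x \<partial>lborel)"
proof -
  let ?F = "fourier_integral h"
  have g: "square_integrable UNIV g" and G: "square_integrable UNIV G"
    and lim: "L2_tendsto UNIV (\<lambda>R k. LINT x:{-R..R}|lborel. g x * cis (- (k * x))) G at_top"
    using assms(1) by (auto simp: is_fourier_def)
  have [measurable]: "h \<in> borel_measurable borel" "g \<in> borel_measurable borel"
    using bounded_compact_support_integrable[OF h] g[THEN square_integrable_measurable] by auto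
  have [measurable]: "?F \<in> borel_measurable borel"
    by (rule borel_measurable_continuous_onI) (rule fourier_integral_continuous[OF h])
  have "set_integrable lborel UNIV (\<lambda>k. (cmod (h k))\<^sup>2)"
  proof -
    obtain M where M: "\<And>k. cmod (h k) \<le> M"
      using h by (auto simp: bounded_compact_support_def)
    have "integrable lborel (\<lambda>k. (cmod (h k))\<^sup>2)"
    proof (rule Bochner_Integration.integrable_bound)
      show "integrable lborel (\<lambda>k. of_real M * h k)"
        using bounded_compact_support_integrable[OF h] by simp
      show "AE x in lborel. norm ((cmod (h x))\<^sup>2) \<le> norm (complex_of_real M * h x)"
        using M by (auto simp: norm_mult power2_eq_square intro!: mult_right_mono order_trans[OF M])
    qed measurable
    then show ?thesis by (simp add: set_integrable_def)
  qed
  then have hsq: "square_integrable UNIV h"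
    by (simp add: square_integrable_def set_borel_measurable_def)
  have trunc: "(LINT k:UNIV|lborel. (LINT x:{-R..R}|lborel. g x * cis (- (k * x))) * h k)
      = (LINT x:{-R..R}|lborel. g x * ?F x)" for R
  proof -
    have "square_integrable UNIV (\<lambda>x. indicator {-R..R} x)"
    proof -
      have "(\<lambda>x. (cmod (indicator {-R..R} x))\<^sup>2) = indicat_real {-R..R}"
        by (auto simp: indicator_def)
      then show ?thesis
        unfolding square_integrable_def set_borel_measurable_def set_integrable_def
        by (simp del: norm_of_real add: integrable_indicator_iff) (simp add: indicator_def emeasure_lborel_Icc_eq)
    qed
    then have int: "integrable lborel (\<lambda>x. indicator {-R..R} x * g x)"
      using square_integrable_set_mult[OF _ g] by (simp add: set_integrable_def)
    have "(\<lambda>(x, k). cis (- (k * x))) \<in> borel_measurable borel"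
      by (auto simp: case_prod_beta' intro!: borel_measurable_continuous_onI continuous_intros)
    from Fubini_kernel[OF int bounded_compact_support_integrable[OF h] this, of 1]
    show ?thesis
      by (simp add: set_lebesgue_integral_def fourier_integral_def scaleR_conv_of_real mult_ac of_real_indicator)
  qed
  have "((\<lambda>R. LINT k:UNIV|lborel. (LINT x:{-R..R}|lborel. g x * cis (- (k * x))) * h k)
     \<longlongrightarrow> (LINT k:UNIV|lborel. G k * h k)) at_top"
    by (rule L2_tendsto_integral[OF lim G hsq])
  then have lim1: "((\<lambda>R. LINT x:{-R..R}|lborel. g x * ?F x) \<longlongrightarrow> (\<integral>k. G k * h k \<partial>lborel)) at_top"
    unfolding trunc by (simp add: set_lebesgue_integral_def)
  have gF: "integrable lborel (\<lambda>x. g x * ?F x)"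
    using square_integrable_set_mult[OF g square_integrable_fourier_integral[OF h]]
    by (simp add: set_integrable_def)
  \<comment> \<open>On the side of x the truncation is removed by dominated convergence: both
    \<open>g\<close> and \<open>?F\<close> are square integrable, so their product is
    integrable.\<close>
  have "((\<lambda>R. LINT x:{-R..R}|lborel. g x * ?F x) \<longlongrightarrow> (\<integral>x. g x * ?F x \<partial>lborel)) at_top"
    unfolding set_lebesgue_integral_def
  proof (rule integral_dominated_convergence_at_top)
    show "integrable lborel (\<lambda>x. norm (g x * ?F x))" using gF by simp
    show "AE x in lborel. ((\<lambda>R. indicat_real {-R..R} x *\<^sub>R (g x * ?F x)) \<longlongrightarrow> g x * ?F x) at_top"
    proof (intro AE_I2 tendsto_eventually)
      fix x :: real
      show "\<forall>\<^sub>F R in at_top. indicat_real {-R..R} x *\<^sub>R (g x * ?F x) = g x * ?F x"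
        using eventually_ge_at_top[of "\<bar>x\<bar>"] by eventually_elim (auto simp: indicator_def)
    qed
  qed (auto simp: indicator_def)
  with lim1 show ?thesis by (rule tendsto_unique[rotated]) simp
qed

subsection \<open>Completeness of the Dirichlet sine system\<close>

text \<open>The Dirichlet eigenfunctions of -d^2/dy^2 on [-1, 1], with eigenvalues ((n + 1) pi /
  2)^2. The shift by \<open>Suc\<close> makes index 0 the ground state; as the interval has length
  2, the functions already have norm 1.\<close>

definition sine_mode :: "nat \<Rightarrow> real \<Rightarrow> real" where
  "sine_mode n y = sin (real (Suc n) * (pi * (y + 1) / 2))"

definition sine_coeff :: "nat \<Rightarrow> (real \<Rightarrow> complex) \<Rightarrow> complex" where
  "sine_coeff n g = (LINT y:{-1..1}|lborel. g y * of_real (sine_mode n y))"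

lemma continuous_on_sine_mode [continuous_intros]:
  fixes f :: "'a::t2_space \<Rightarrow> real"
  shows "continuous_on S f \<Longrightarrow> continuous_on S (\<lambda>x. sine_mode n (f x))"
  unfolding sine_mode_def by (intro continuous_intros) auto

lemma borel_measurable_sine_mode [measurable]: "sine_mode n \<in> borel_measurable borel"
  by (intro borel_measurable_continuous_onI continuous_intros)

lemma abs_sine_mode_le: "\<bar>sine_mode n y\<bar> \<le> 1"
  by (simp add: sine_mode_def)

lemma sine_mode_boundary: "sine_mode n (-1) = 0" "sine_mode n 1 = 0"
  using sin_npi[of "Suc n"] by (simp_all add: sine_mode_def)

lemma square_integrable_bounded:
  assumes "A \<in> sets borel" "emeasure lborel A < \<infinity>" "f \<in> borel_measurable borel"
    and "\<And>x. x \<in> A \<Longrightarrow> cmod (f x) \<le> C"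
  shows "square_integrable A f"
proof (rule square_integrableI)
  have [measurable]: "A \<in> sets borel" "f \<in> borel_measurable borel" by fact+
  show "(\<lambda>x. indicator A x *\<^sub>R f x) \<in> borel_measurable borel" by measurable
  show "set_integrable lborel A (\<lambda>x. C\<^sup>2)"
    unfolding set_integrable_def using assms by (intro integrable_scaleR_left integrable_real_indicator) auto
qed (use assms in \<open>simp add: power_mono\<close>)

lemma square_integrable_continuous_on:
  assumes "continuous_on {-1..1::real} f"
  shows "square_integrable {-1..1} f"
proof (rule square_integrableI)
  show "(\<lambda>x. indicator {-1..1} x *\<^sub>R f x) \<in> borel_measurable borel"
    using assms by (intro borel_measurable_continuous_on_indicator) auto
  show "set_integrable lborel {-1..1} (\<lambda>x. (cmod (f x))\<^sup>2)"
    unfolding set_integrable_def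
    by (rule borel_integrable_compact) (auto intro!: continuous_intros assms)
qed simp

lemma square_integrable_sine_mode: "square_integrable {-1..1} (\<lambda>y. of_real (sine_mode n y))"
  by (intro square_integrable_continuous_on continuous_intros)

text \<open>The angle pi (y + 1) / 2 runs over [0, pi], and the primitive, a multiple of the sine of
  j times this angle, vanishes at both ends.\<close>

lemma cos_mode_integral:
  fixes j :: int
  shows "(LINT y:{-1..1}|lborel. cos (of_int j * (pi * (y + 1) / 2))) = (if j = 0 then 2 else 0)"
proof (cases "j = 0")
  case False
  define F where "F y = 2 / (of_int j * pi) * sin (of_int j * (pi * (y + 1) / 2))" for y
  have "(F has_vector_derivative cos (of_int j * (pi * (y + 1) / 2))) (at y within {-1..1})" for y
    unfolding F_def has_real_derivative_iff_has_vector_derivative[symmetric]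
    by (rule derivative_eq_intros refl | use False in simp)+
  then have "(LINT y:{-1..1}|lborel. cos (of_int j * (pi * (y + 1) / 2))) = F 1 - F (-1)"
    unfolding set_lebesgue_integral_def
    by (intro integral_FTC_Icc continuous_intros) auto
  also have "\<dots> = 0"
    using sin_integer_2pi by (simp add: F_def sin_times_pi_eq_0)
  finally show ?thesis using False by simp
qed (simp add: set_lebesgue_integral_def)

text \<open>The product-to-sum formula leaves cosines of integer multiples of the angle. The
  multiple m + n + 2 is never 0, and m - n is 0 exactly on the diagonal.\<close>

lemma sine_mode_orthonormal:
  "(LINT y:{-1..1}|lborel. sine_mode m y * sine_mode n y) = (if m = n then 1 else 0)"
proof -
  have int: "set_integrable lborel {-1..1} (\<lambda>y. cos (of_int j * (pi * (y + 1) / 2)))" for j :: int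
    unfolding set_integrable_def by (intro borel_integrable_compact continuous_intros) auto
  have "sine_mode m y * sine_mode n y = (cos (of_int (int m - int n) * (pi * (y + 1) / 2))
      - cos (of_int (int m + int n + 2) * (pi * (y + 1) / 2))) / 2" for y
  proof -
    define \<theta> where "\<theta> = pi * (y + 1) / 2"
    have "of_int (int m - int n) * \<theta> = real (Suc m) * \<theta> - real (Suc n) * \<theta>"
      "of_int (int m + int n + 2) * \<theta> = real (Suc m) * \<theta> + real (Suc n) * \<theta>"
      by (simp_all add: algebra_simps)
    then show ?thesis
      unfolding sine_mode_def \<theta>_def[symmetric] by (simp only: cos_add cos_diff) simp
  qed
  then have "(LINT y:{-1..1}|lborel. sine_mode m y * sine_mode n y)
      = ((LINT y:{-1..1}|lborel. cos (of_int (int m - int n) * (pi * (y + 1) / 2)))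
        - (LINT y:{-1..1}|lborel. cos (of_int (int m + int n + 2) * (pi * (y + 1) / 2)))) / 2"
    by (simp only: set_integral_divide_zero set_integral_diff(2)[OF int int])
  then show ?thesis
    unfolding cos_mode_integral by (cases "m = n") auto
qed

lemma sine_coeff_sine_mode: "sine_coeff n (\<lambda>y. of_real (sine_mode m y)) = (if m = n then 1 else 0)"
  unfolding sine_coeff_def of_real_mult[symmetric] set_integral_complex_of_real sine_mode_orthonormal
  by simp

text \<open>By orthonormality a subtracted mode changes its own coefficient only; this is what lets
  the one-mode identity for the norm be iterated.\<close>

lemma sine_coeff_diff_sum:
  assumes "square_integrable {-1..1} g"
  shows "sine_coeff n (\<lambda>y. g y - (\<Sum>m<N. a m * of_real (sine_mode m y)))
    = sine_coeff n g - (if n < N then a n else 0)"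
proof (induction N)
  case (Suc N)
  define h where "h y = g y - (\<Sum>m<N. a m * of_real (sine_mode m y))" for y
  note si = square_integrable_sine_mode
  have h: "square_integrable {-1..1} h"
    unfolding h_def
    by (intro square_integrable_diff assms square_integrable_sum square_integrable_cmult si)
  have "(h y - a N * of_real (sine_mode N y)) * of_real (sine_mode n y)
    = h y * of_real (sine_mode n y) - a N * (of_real (sine_mode N y) * of_real (sine_mode n y))" for y
    by (simp add: left_diff_distrib mult.assoc)
  then have "sine_coeff n (\<lambda>y. h y - a N * of_real (sine_mode N y))
    = sine_coeff n h - a N * sine_coeff n (\<lambda>y. of_real (sine_mode N y))"
    unfolding sine_coeff_def
    using square_integrable_set_mult[OF h si] square_integrable_set_mult[OF si si]
    by (simp only: set_integral_diff(2) set_integrable_mult_right set_integral_mult_right)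
  then show ?case
    using Suc[folded h_def] by (simp add: h_def diff_diff_eq sine_coeff_sine_mode less_Suc_eq)
qed (simp add: sine_coeff_def)

text \<open>The mode has norm 1, so expanding the square adds |a|^2 - 2 Re (conj(a) c), where c is
  the sine coefficient; completing the square gives |c - a|^2 - |c|^2.\<close>

lemma L2_norm_diff_sine_mode:
  assumes u: "square_integrable {-1..1} u"
  shows "(L2_norm {-1..1} (\<lambda>y. u y - a * of_real (sine_mode n y)))\<^sup>2
    = (L2_norm {-1..1} u)\<^sup>2 + ((cmod (sine_coeff n u - a))\<^sup>2 - (cmod (sine_coeff n u))\<^sup>2)"
proof -
  note si = square_integrable_sine_mode[of n]
  have eq: "(cmod (u y - a * of_real (sine_mode n y)))\<^sup>2
    = (cmod (u y))\<^sup>2 - 2 * Re (cnj a * (u y * of_real (sine_mode n y)))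
      + (cmod a)\<^sup>2 * (sine_mode n y * sine_mode n y)" for y
    unfolding cmod_power2 by (simp add: power2_eq_square algebra_simps)
  have Re_int: "set_integrable lborel {-1..1} (\<lambda>y. Re (f y))"
    "(LINT y:{-1..1}|lborel. Re (f y)) = Re (LINT y:{-1..1}|lborel. f y)"
    if "set_integrable lborel {-1..1} f" for f :: "real \<Rightarrow> complex"
  proof -
    have eq: "indicat_real {-1..1} y *\<^sub>R Re (f y) = Re (indicat_real {-1..1} y *\<^sub>R f y)" for y
      by simp
    show "set_integrable lborel {-1..1} (\<lambda>y. Re (f y))"
      "(LINT y:{-1..1}|lborel. Re (f y)) = Re (LINT y:{-1..1}|lborel. f y)"
      using that unfolding set_integrable_def set_lebesgue_integral_def eq
      by (rule integrable_Re, rule integral_Re)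
  qed
  have int: "set_integrable lborel {-1..1} (\<lambda>y. (cmod (u y))\<^sup>2)"
    "set_integrable lborel {-1..1} (\<lambda>y. cnj a * (u y * of_real (sine_mode n y)))"
    "set_integrable lborel {-1..1} (\<lambda>y. sine_mode n y * sine_mode n y)"
  proof -
    show "set_integrable lborel {-1..1} (\<lambda>y. (cmod (u y))\<^sup>2)"
      using u by (simp add: square_integrable_def)
    show "set_integrable lborel {-1..1} (\<lambda>y. cnj a * (u y * of_real (sine_mode n y)))"
      by (intro set_integrable_mult_right square_integrable_set_mult[OF u si])
    show "set_integrable lborel {-1..1} (\<lambda>y. sine_mode n y * sine_mode n y)"
      unfolding set_integrable_def by (intro borel_integrable_compact continuous_intros) auto
  qed
  have "(L2_norm {-1..1} (\<lambda>y. u y - a * of_real (sine_mode n y)))\<^sup>2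
    = (L2_norm {-1..1} u)\<^sup>2 - 2 * Re (cnj a * sine_coeff n u) + (cmod a)\<^sup>2"
  proof -
    have lin: "(LINT y:{-1..1}|lborel. p y - 2 * q y + c * r y)
      = (LINT y:{-1..1}|lborel. p y) - 2 * (LINT y:{-1..1}|lborel. q y) + c * (LINT y:{-1..1}|lborel. r y)"
      if "set_integrable lborel {-1..1} p" "set_integrable lborel {-1..1} q" "set_integrable lborel {-1..1} r"
      for p q r :: "real \<Rightarrow> real" and c
      using that by simp
    show ?thesis
      unfolding L2_norm_power2 eq lin[OF int(1) Re_int(1)[OF int(2)] int(3)] Re_int(2)[OF int(2)]
      by (simp only: sine_mode_orthonormal sine_coeff_def set_integral_mult_right) simp
  qed
  moreover have "- 2 * Re (cnj a * sine_coeff n u) + (cmod a)\<^sup>2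
     = (cmod (sine_coeff n u - a))\<^sup>2 - (cmod (sine_coeff n u))\<^sup>2"
    unfolding cmod_power2 by (simp add: power2_eq_square algebra_simps)
  ultimately show ?thesis by linarith
qed

text \<open>The coefficients \<open>a\<close> are arbitrary. Choosing the sine coefficients gives
  the Pythagorean identity, and comparing with any other choice shows that the partial sum is the
  best approximation.\<close>

lemma L2_norm_diff_sine_sum:
  assumes g: "square_integrable {-1..1} g"
  shows "(L2_norm {-1..1} (\<lambda>y. g y - (\<Sum>n<N. a n * of_real (sine_mode n y))))\<^sup>2
    = (L2_norm {-1..1} g)\<^sup>2 + (\<Sum>n<N. (cmod (sine_coeff n g - a n))\<^sup>2 - (cmod (sine_coeff n g))\<^sup>2)"
proof (induction N)
  case (Suc N)
  let ?h = "\<lambda>y. g y - (\<Sum>m<N. a m * of_real (sine_mode m y))"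
  have "square_integrable {-1..1} ?h"
    by (intro square_integrable_diff g square_integrable_sum square_integrable_cmult square_integrable_sine_mode)
  from L2_norm_diff_sine_mode[OF this, of "a N" N] show ?case
    using Suc by (simp add: diff_diff_eq sine_coeff_diff_sum[OF g])
qed simp

section \<open>Density of the span of the sines in L2\<close>

definition sine_span :: "(real \<Rightarrow> complex) set" where
  "sine_span = {u. \<exists>N a. u = (\<lambda>y. \<Sum>n<N. a n * of_real (sine_mode n y))}"

lemma sine_span_add:
  assumes "u \<in> sine_span" "v \<in> sine_span"
  shows "(\<lambda>y. u y + v y) \<in> sine_span"
proof -
  obtain N a M b where u: "u = (\<lambda>y. \<Sum>n<N. a n * of_real (sine_mode n y))"
    and v: "v = (\<lambda>y. \<Sum>n<M. b n * of_real (sine_mode n y))"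
    using assms by (auto simp: sine_span_def)
  have pad: "(\<Sum>n<K. c n * of_real (sine_mode n y)) = (\<Sum>n<max N M. (if n < K then c n else 0) * of_real (sine_mode n y))"
    if "K \<le> max N M" for K c y
    using that by (intro sum.mono_neutral_cong_left) auto
  have "(\<lambda>y. u y + v y) = (\<lambda>y. \<Sum>n<max N M. ((if n < N then a n else 0) + (if n < M then b n else 0)) * of_real (sine_mode n y))"
    unfolding u v by (subst (1 2) pad) (auto simp: sum.distrib distrib_right)
  then show ?thesis unfolding sine_span_def by (intro CollectI exI)
qed

lemma sine_span_cmult:
  assumes "u \<in> sine_span"
  shows "(\<lambda>y. c * u y) \<in> sine_span"
proof -
  obtain N a where u: "u = (\<lambda>y. \<Sum>n<N. a n * of_real (sine_mode n y))"
    using assms by (auto simp: sine_span_def)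
  have "(\<lambda>y. c * u y) = (\<lambda>y. \<Sum>n<N. (c * a n) * of_real (sine_mode n y))"
    by (simp add: u sum_distrib_left mult.assoc)
  then show ?thesis unfolding sine_span_def by (intro CollectI exI)
qed

lemma sine_span_sum:
  assumes "\<And>i. i \<in> J \<Longrightarrow> u i \<in> sine_span"
  shows "(\<lambda>y. \<Sum>i\<in>J. u i y) \<in> sine_span"
  using assms
proof (induction J rule: infinite_finite_induct)
  case (insert i J)
  then show ?case by (simp add: sine_span_add)
qed (auto simp: sine_span_def intro!: exI[of _ 0])

lemma sine_mode_in_span: "(\<lambda>y. of_real (sine_mode n y)) \<in> sine_span"
  unfolding sine_span_def
  by (intro CollectI exI[of _ "Suc n"] exI[of _ "\<lambda>m. of_bool (m = n)"]) (simp add: of_bool_def)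

text \<open>Twice cos(theta) sin(j theta) is sin((j + 1) theta) + sin((j - 1) theta), and for the
  lowest mode the second term is sin 0. So the span is a module over the polynomials in
  cos(theta).\<close>

lemma sine_span_cos_mult:
  assumes "u \<in> sine_span"
  shows "(\<lambda>y. of_real (cos (pi * (y + 1) / 2)) * u y) \<in> sine_span"
proof -
  obtain N a where u: "u = (\<lambda>y. \<Sum>n<N. a n * of_real (sine_mode n y))"
    using assms by (auto simp: sine_span_def)
  have "(\<lambda>y. complex_of_real (cos (pi * (y + 1) / 2)) * of_real (sine_mode n y)) \<in> sine_span" for n
  proof (cases n)
    case 0
    have "cos (pi * (y + 1) / 2) * sine_mode n y = 1 / 2 * sine_mode 1 y" for y
      using sin_double[of "pi * (y + 1) / 2"] by (simp add: 0 sine_mode_def)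
    then show ?thesis
      using sine_span_cmult[OF sine_mode_in_span[of 1], of "of_real (1 / 2)"]
      by (simp only: of_real_mult[symmetric])
  next
    case (Suc m)
    have "cos (pi * (y + 1) / 2) * sine_mode n y = 1 / 2 * sine_mode (Suc n) y + 1 / 2 * sine_mode m y" for y
    proof -
      define \<theta> where "\<theta> = pi * (y + 1) / 2"
      have "real (Suc (Suc n)) * \<theta> = real (Suc n) * \<theta> + \<theta>" "real (Suc m) * \<theta> = real (Suc n) * \<theta> - \<theta>"
        using Suc by (simp_all add: algebra_simps)
      moreover have "cos \<theta> * sin \<beta> = 1 / 2 * sin (\<beta> + \<theta>) + 1 / 2 * sin (\<beta> - \<theta>)" for \<beta>
        by (simp add: sin_add sin_diff field_simps)
      ultimately show ?thesis
        unfolding sine_mode_def \<theta>_def[symmetric] by (simp only:)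
    qed
    then show ?thesis
      using sine_span_add[OF sine_span_cmult[OF sine_mode_in_span[of "Suc n"], of "of_real (1 / 2)"]
         sine_span_cmult[OF sine_mode_in_span[of m], of "of_real (1 / 2)"]]
      by (simp only: of_real_mult[symmetric] of_real_add[symmetric])
  qed
  then have "(\<lambda>y. \<Sum>n<N. a n * (of_real (cos (pi * (y + 1) / 2)) * of_real (sine_mode n y))) \<in> sine_span"
    by (intro sine_span_sum sine_span_cmult) simp
  also have "(\<lambda>y. \<Sum>n<N. a n * (complex_of_real (cos (pi * (y + 1) / 2)) * of_real (sine_mode n y)))
    = (\<lambda>y. of_real (cos (pi * (y + 1) / 2)) * u y)"
    unfolding u sum_distrib_left by (simp only: mult_ac)
  finally show ?thesis .
qed

lemma sine_span_polynomial_cos: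
  "(\<lambda>y. complex_of_real (\<Sum>i\<le>d. q i * cos (pi * (y + 1) / 2) ^ i) * of_real (sine_mode n y)) \<in> sine_span"
proof -
  have "(\<lambda>y. complex_of_real (cos (pi * (y + 1) / 2)) ^ i * of_real (sine_mode n y)) \<in> sine_span" for i
  proof (induction i)
    case (Suc i)
    from sine_span_cos_mult[OF this] show ?case by (simp add: mult.assoc)
  qed (simp add: sine_mode_in_span)
  then have "(\<lambda>y. \<Sum>i\<le>d. of_real (q i) * (complex_of_real (cos (pi * (y + 1) / 2)) ^ i * of_real (sine_mode n y)))
     \<in> sine_span"
    by (intro sine_span_sum sine_span_cmult)
  then show ?thesis by (simp add: sum_distrib_right mult.assoc)
qed

text \<open>In the variable c = cos(pi (y + 1) / 2) the function is continuous on [-1, 1], and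
  Weierstrass approximates it by polynomials in c. Multiplication by the lowest mode brings these
  into the span.\<close>

lemma sine_span_dense_continuous:
  fixes \<phi> :: "real \<Rightarrow> complex"
  assumes "continuous_on UNIV \<phi>" and "e > 0"
  obtains u where "u \<in> sine_span"
    and "\<And>y. y \<in> {-1..1} \<Longrightarrow> cmod (of_real (sine_mode 0 y) * \<phi> y - u y) \<le> e"
proof -
  let ?\<theta> = "\<lambda>y::real. pi * (y + 1) / 2"
  have approx: "\<exists>P. (\<lambda>y. complex_of_real (P (cos (?\<theta> y))) * of_real (sine_mode 0 y)) \<in> sine_span
      \<and> (\<forall>y\<in>{-1..1}. \<bar>\<psi> y - P (cos (?\<theta> y))\<bar> < e / 2)"
    if \<psi>: "continuous_on UNIV \<psi>" for \<psi> :: "real \<Rightarrow> real"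
  proof -
    \<comment> \<open>y = 2 arccos(c) / pi - 1 inverts the substitution, because the angle stays in
      [0, pi] for y in [-1, 1].\<close>
    have cont: "continuous_on {-1..1} (\<lambda>c. \<psi> (2 * arccos c / pi - 1))"
      by (intro continuous_on_compose2[OF \<psi>] continuous_intros) auto
    obtain P where P: "real_polynomial_function P"
      "\<And>c. c \<in> {-1..1} \<Longrightarrow> \<bar>\<psi> (2 * arccos c / pi - 1) - P c\<bar> < e / 2"
      by (rule Stone_Weierstrass_real_polynomial_function[OF compact_Icc cont, of "e / 2"])
         (use \<open>e > 0\<close> in auto)
    obtain q d where q: "P = (\<lambda>x. \<Sum>i\<le>d. q i * x ^ i)"
      using P(1) by (auto simp: real_polynomial_function_iff_sum)
    have "\<bar>\<psi> y - P (cos (?\<theta> y))\<bar> < e / 2" if "y \<in> {-1..1}" for y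
    proof -
      have "0 \<le> ?\<theta> y" "?\<theta> y \<le> pi"
        using that mult_left_mono[of "y + 1" 2 pi] by auto
      then have "arccos (cos (?\<theta> y)) = ?\<theta> y" by (rule arccos_cos)
      then have "2 * arccos (cos (?\<theta> y)) / pi - 1 = y"
        by (simp only:) simp
      then show ?thesis using P(2)[of "cos (?\<theta> y)"] by simp
    qed
    moreover have "(\<lambda>y. complex_of_real (P (cos (?\<theta> y))) * of_real (sine_mode 0 y)) \<in> sine_span"
      unfolding q by (rule sine_span_polynomial_cos)
    ultimately show ?thesis by blast
  qed
  obtain P where P: "(\<lambda>y. complex_of_real (P (cos (?\<theta> y))) * of_real (sine_mode 0 y)) \<in> sine_span"
      "\<And>y. y\<in>{-1..1} \<Longrightarrow> \<bar>Re (\<phi> y) - P (cos (?\<theta> y))\<bar> < e / 2"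
    using approx[of "\<lambda>y. Re (\<phi> y)"] assms(1) continuous_on_Re by blast
  obtain Q where Q: "(\<lambda>y. complex_of_real (Q (cos (?\<theta> y))) * of_real (sine_mode 0 y)) \<in> sine_span"
      "\<And>y. y\<in>{-1..1} \<Longrightarrow> \<bar>Im (\<phi> y) - Q (cos (?\<theta> y))\<bar> < e / 2"
    using approx[of "\<lambda>y. Im (\<phi> y)"] assms(1) continuous_on_Im by blast
  show thesis
  proof (rule that[OF sine_span_add[OF P(1) sine_span_cmult[OF Q(1), of \<i>]]])
    fix y :: real assume y: "y \<in> {-1..1}"
    define p q where "p = P (cos (?\<theta> y))" and "q = Q (cos (?\<theta> y))"
    have "cmod (\<phi> y - Complex p q) \<le> \<bar>Re (\<phi> y - Complex p q)\<bar> + \<bar>Im (\<phi> y - Complex p q)\<bar>"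
      by (rule cmod_le)
    also have "\<dots> \<le> e" using P(2)[OF y] Q(2)[OF y] by (simp add: p_def q_def)
    finally have "cmod (\<phi> y - Complex p q) \<le> e" .
    then have "\<bar>sine_mode 0 y\<bar> * cmod (\<phi> y - Complex p q) \<le> 1 * e"
      by (intro mult_mono abs_sine_mode_le) auto
    also have "\<bar>sine_mode 0 y\<bar> * cmod (\<phi> y - Complex p q) = cmod (of_real (sine_mode 0 y) * \<phi> y
      - (complex_of_real p * of_real (sine_mode 0 y) + \<i> * (complex_of_real q * of_real (sine_mode 0 y))))"
      unfolding norm_of_real[symmetric, where 'a=complex] norm_mult[symmetric]
      by (simp add: Complex_eq algebra_simps)
    finally show "cmod (of_real (sine_mode 0 y) * \<phi> y
      - (complex_of_real (P (cos (?\<theta> y))) * of_real (sine_mode 0 y)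
        + \<i> * (complex_of_real (Q (cos (?\<theta> y))) * of_real (sine_mode 0 y)))) \<le> e"
      by (simp add: p_def q_def)
  qed
qed


lemma L2_norm_tendsto_0:
  fixes u :: "nat \<Rightarrow> 'a::euclidean_space \<Rightarrow> complex"
  assumes meas: "\<And>n. set_borel_measurable lborel A (u n)"
    and lim: "AE x in lborel. x \<in> A \<longrightarrow> (\<lambda>n. u n x) \<longlonglongrightarrow> 0"
    and w: "set_integrable lborel A w" and le: "\<And>n x. x \<in> A \<Longrightarrow> (cmod (u n x))\<^sup>2 \<le> w x"
  shows "(\<lambda>n. L2_norm A (u n)) \<longlonglongrightarrow> 0"
proof -
  have eq: "indicat_real A x *\<^sub>R (cmod (u n x))\<^sup>2 = (cmod (indicator A x *\<^sub>R u n x))\<^sup>2" for n x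
    by (simp add: indicator_def)
  have "(\<lambda>n. LINT x:A|lborel. (cmod (u n x))\<^sup>2) \<longlonglongrightarrow> (\<integral>x. 0 \<partial>(lborel :: 'a measure))"
    unfolding set_lebesgue_integral_def
  proof (rule integral_dominated_convergence)
    show "integrable lborel (\<lambda>x. indicator A x *\<^sub>R w x)"
      using w by (simp add: set_integrable_def)
    show "(\<lambda>x. indicat_real A x *\<^sub>R (cmod (u n x))\<^sup>2) \<in> borel_measurable lborel" for n
      unfolding eq using meas[of n] unfolding set_borel_measurable_def by measurable
    show "AE x in lborel. (\<lambda>n. indicat_real A x *\<^sub>R (cmod (u n x))\<^sup>2) \<longlonglongrightarrow> 0"
      using lim
    proof eventually_elim
      case (elim x)
      show ?case
      proof (cases "x \<in> A")
        case True
        then have "(\<lambda>n. (cmod (u n x))\<^sup>2) \<longlonglongrightarrow> (cmod 0)\<^sup>2"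
          using elim by (intro tendsto_intros) auto
        then show ?thesis using True by simp
      qed simp
    qed
    show "AE x in lborel. norm (indicat_real A x *\<^sub>R (cmod (u n x))\<^sup>2) \<le> indicator A x *\<^sub>R w x" for n
      using le by (intro AE_I2) (simp add: indicator_def)
  qed simp
  then have "(\<lambda>n. sqrt (LINT x:A|lborel. (cmod (u n x))\<^sup>2)) \<longlonglongrightarrow> sqrt 0"
    by (intro tendsto_real_sqrt) simp
  then show ?thesis by (simp add: L2_norm_def)
qed

lemma sine_span_square_integrable:
  "u \<in> sine_span \<Longrightarrow> square_integrable {-1..1} u"
  unfolding sine_span_def
  by (auto intro!: square_integrable_sum square_integrable_cmult square_integrable_sine_mode)

text \<open>A Borel function is an almost everywhere limit of continuous ones. Cutting these back to
  the bound \<open>M\<close> provides a constant majorant, and dominated convergence reduces the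
  claim to continuous factors.\<close>

lemma sine_span_dense_bounded:
  fixes q :: "real \<Rightarrow> complex"
  assumes q[measurable]: "q \<in> borel_measurable borel" and M: "\<And>y. cmod (q y) \<le> M" "M > 0" and "e > 0"
  obtains u where "u \<in> sine_span"
    and "L2_norm {-1..1} (\<lambda>y. of_real (sine_mode 0 y) * q y - u y) < e"
proof -
  let ?I = "{-1..1::real}"
  \<comment> \<open>Unfolding this notion of measurability yields the continuous functions that
    converge to \<open>q\<close> off a negligible set.\<close>
  have "q measurable_on UNIV"
    by (intro lebesgue_measurable_imp_measurable_on) (auto intro: measurable_completion)
  then obtain N g where N: "negligible N" and g: "\<And>n. continuous_on UNIV (g n)"
    and lim: "\<And>x. x \<notin> N \<Longrightarrow> (\<lambda>n. g n x) \<longlonglongrightarrow> q x"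
    unfolding measurable_on_def by auto
  \<comment> \<open>The radial retraction onto the disc of radius \<open>M\<close>, which fixes the
    values of \<open>q\<close>. The maximum keeps the denominator positive and the map
    continuous.\<close>
  define clip where "clip z = of_real (M / max M (cmod z)) * z" for z
  have clip_cont: "continuous_on UNIV clip"
    unfolding clip_def using M(2) by (intro continuous_intros) auto
  have clip_le: "cmod (clip z) \<le> M" for z
  proof -
    have "M * cmod z \<le> M * max M (cmod z)" using M(2) by (intro mult_left_mono) auto
    moreover have "0 < max M (cmod z)" using M(2) by simp
    ultimately show ?thesis using M(2) unfolding clip_def norm_mult norm_of_real
      by (simp add: divide_le_eq abs_divide)
  qed
  have clip_id: "clip z = z" if "cmod z \<le> M" for z
    using M(2) that by (simp add: clip_def max_def)
  define v where "v n y = of_real (sine_mode 0 y) * q y - of_real (sine_mode 0 y) * clip (g n y)" for n y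
  have g_cont: "continuous_on UNIV (\<lambda>y. clip (g n y))" for n
    using continuous_on_compose2[OF clip_cont g] by auto
  have [measurable]: "(\<lambda>y. clip (g n y)) \<in> borel_measurable borel" for n
    by (intro borel_measurable_continuous_onI g_cont)
  have v_le: "cmod (v n y) \<le> 2 * M" for n y
  proof -
    have "cmod (v n y) = \<bar>sine_mode 0 y\<bar> * cmod (q y - clip (g n y))"
      unfolding v_def right_diff_distrib[symmetric] norm_mult by simp
    also have "\<dots> \<le> 1 * (M + M)"
      by (intro mult_mono abs_sine_mode_le order_trans[OF norm_triangle_ineq4] add_mono M(1) clip_le) auto
    finally show ?thesis by simp
  qed
  have [measurable]: "v n \<in> borel_measurable borel" for n
    unfolding v_def by measurable
  have "(\<lambda>n. L2_norm ?I (v n)) \<longlonglongrightarrow> 0"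
  proof (rule L2_norm_tendsto_0)
    show "set_borel_measurable lborel ?I (v n)" for n
      unfolding set_borel_measurable_def by measurable
    show "set_integrable lborel ?I (\<lambda>y. (2 * M)\<^sup>2)"
      by (simp add: set_integrable_def)
    show "(cmod (v n y))\<^sup>2 \<le> (2 * M)\<^sup>2" for n y
      using v_le by (intro power_mono) auto
    have "N \<in> null_sets lebesgue" using N by (simp add: negligible_iff_null_sets)
    then have "AE y in lebesgue. y \<notin> N" by (rule AE_not_in)
    then have "AE y in lborel. y \<notin> N" by (simp add: AE_completion_iff)
    then show "AE y in lborel. y \<in> ?I \<longrightarrow> (\<lambda>n. v n y) \<longlonglongrightarrow> 0"
    proof eventually_elim
      case (elim y)
      have "(\<lambda>n. clip (g n y)) \<longlonglongrightarrow> clip (q y)"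
        using clip_cont lim[OF elim] by (rule continuous_on_tendsto_compose) auto
      then have "(\<lambda>n. v n y) \<longlonglongrightarrow> of_real (sine_mode 0 y) * q y - of_real (sine_mode 0 y) * clip (q y)"
        unfolding v_def by (intro tendsto_intros)
      then show ?case by (simp add: clip_id M)
    qed
  qed
  then have "\<forall>\<^sub>F n in sequentially. L2_norm ?I (v n) < e / 2"
    using \<open>e > 0\<close> by (intro order_tendstoD(2)) auto
  then obtain n where n: "L2_norm ?I (v n) < e / 2"
    by (auto simp: eventually_sequentially)
  obtain u where u: "u \<in> sine_span"
    and le: "\<And>y. y \<in> ?I \<Longrightarrow> cmod (of_real (sine_mode 0 y) * clip (g n y) - u y) \<le> e / 4"
    using sine_span_dense_continuous[OF g_cont, of "e / 4" n] \<open>e > 0\<close> by auto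
  let ?r = "\<lambda>y. of_real (sine_mode 0 y) * clip (g n y) - u y"
  have r: "square_integrable ?I ?r"
    by (intro square_integrable_diff square_integrable_continuous_on continuous_intros sine_span_square_integrable u
        continuous_on_subset[OF g_cont]) auto
  \<comment> \<open>The interval has length 2, so the uniform error e/4 contributes at most e^2/8 to
    the squared norm, less than (e/2)^2.\<close>
  have "(L2_norm ?I ?r)\<^sup>2 \<le> (LINT y:?I|lborel. (e / 4)\<^sup>2)"
    unfolding L2_norm_power2 using r le
    by (intro set_integral_mono power_mono) (auto simp: square_integrable_def set_integrable_def)
  also have "\<dots> \<le> (e / 2)\<^sup>2"
    by (simp add: set_lebesgue_integral_def power_divide)
  finally have "L2_norm ?I ?r \<le> e / 2"
    by (rule power2_le_imp_le) (use \<open>e > 0\<close> in simp)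
  moreover have "square_integrable ?I (v n)"
    using v_le by (intro square_integrable_bounded) auto
  then have "L2_norm ?I (\<lambda>y. v n y + ?r y) \<le> L2_norm ?I (v n) + L2_norm ?I ?r"
    using r by (rule L2_norm_triangle)
  ultimately have "L2_norm ?I (\<lambda>y. of_real (sine_mode 0 y) * q y - u y) < e"
    using n by (simp add: v_def)
  with u show thesis by (rule that)
qed

text \<open>Dividing by the first mode reduces the density of the sines to that of the polynomials in
  the cosine.\<close>

lemma sine_span_dense:
  assumes g: "square_integrable {-1..1} g" and "e > 0"
  obtains u where "u \<in> sine_span" and "L2_norm {-1..1} (\<lambda>y. g y - u y) < e"
proof -
  let ?I = "{-1..1::real}"
  define b where "b y = complex_of_real (sine_mode 0 y)" for y
  \<comment> \<open>At the end points \<open>b\<close> vanishes and the quotient takes the default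
    value 0; these two points form a null set.\<close>
  define q where "q y = (indicator ?I y *\<^sub>R g y) / b y" for y
  have [measurable]: "(\<lambda>y. indicator ?I y *\<^sub>R g y) \<in> borel_measurable borel"
    using g by (rule square_integrable_measurable)
  have [measurable]: "b \<in> borel_measurable borel"
    unfolding b_def by measurable
  have [measurable]: "q \<in> borel_measurable borel"
    unfolding q_def by measurable
  \<comment> \<open>Truncation makes the quotient bounded. Where it is active the error is
    \<open>g\<close> itself, and at the other interior points it is 0, so |g|^2 dominates the
    squared error.\<close>
  define p where "p n y = (if cmod (q y) \<le> real (Suc n) then q y else 0)" for n y
  have [measurable]: "p n \<in> borel_measurable borel" for n
    unfolding p_def by measurable
  have bq: "b y * q y = g y" if "y \<in> {-1<..<1}" for y
  proof -
    have "0 < pi * (y + 1) / 2" "pi * (y + 1) / 2 < pi"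
      using that mult_pos_pos[of pi "y + 1"] mult_strict_left_mono[of "y + 1" 2 pi] by auto
    then have "sin (pi * (y + 1) / 2) > 0" by (rule sin_gt_zero)
    then have "b y \<noteq> 0" by (simp add: b_def sine_mode_def)
    then show ?thesis using that by (simp add: q_def)
  qed
  have AE_int: "AE y in lborel. y \<in> ?I \<longrightarrow> y \<in> {-1<..<1}"
    using AE_lborel_singleton[of "-1::real"] AE_lborel_singleton[of "1::real"]
    by eventually_elim auto
  have "(\<lambda>n. L2_norm ?I (\<lambda>y. g y - b y * p n y)) \<longlonglongrightarrow> 0"
  proof (rule L2_norm_tendsto_0)
    show "set_borel_measurable lborel ?I (\<lambda>y. g y - b y * p n y)" for n
    proof -
      have "(\<lambda>y. indicator ?I y *\<^sub>R g y - indicator ?I y *\<^sub>R (b y * p n y)) \<in> borel_measurable borel"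
        by measurable
      then show ?thesis by (simp add: set_borel_measurable_def scaleR_diff_right)
    qed
    show "set_integrable lborel ?I (\<lambda>y. (cmod (g y))\<^sup>2)"
      using g by (simp add: square_integrable_def)
    show "AE y in lborel. y \<in> ?I \<longrightarrow> (\<lambda>n. g y - b y * p n y) \<longlonglongrightarrow> 0"
      using AE_int
    proof eventually_elim
      case (elim y)
      have "\<forall>\<^sub>F n in sequentially. p n y = q y"
        using eventually_ge_at_top[of "nat \<lceil>cmod (q y)\<rceil>"]
        by eventually_elim (auto simp: p_def; linarith)
      then have "y \<in> ?I \<Longrightarrow> \<forall>\<^sub>F n in sequentially. g y - b y * p n y = 0"
        by eventually_elim (use elim bq in auto)
      then show ?case by (auto intro: tendsto_eventually)
    qed
    show "(cmod (g y - b y * p n y))\<^sup>2 \<le> (cmod (g y))\<^sup>2" if "y \<in> ?I" for n y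
      using that bq[of y] by (cases "b y = 0") (auto simp: p_def q_def)
  qed
  then have "\<forall>\<^sub>F n in sequentially. L2_norm ?I (\<lambda>y. g y - b y * p n y) < e / 2"
    using \<open>e > 0\<close> by (intro order_tendstoD(2)) auto
  then obtain n where n: "L2_norm ?I (\<lambda>y. g y - b y * p n y) < e / 2"
    by (auto simp: eventually_sequentially)
  have p_le: "cmod (p n y) \<le> real (Suc n)" for y
    by (simp add: p_def)
  obtain u where u: "u \<in> sine_span" and le: "L2_norm ?I (\<lambda>y. b y * p n y - u y) < e / 2"
    using sine_span_dense_bounded[of "p n" "real (Suc n)" "e / 2"] p_le \<open>e > 0\<close>
    unfolding b_def by auto
  have bp: "square_integrable ?I (\<lambda>y. b y * p n y)"
  proof (rule square_integrable_bounded)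
    show "cmod (b y * p n y) \<le> 1 * real (Suc n)" for y
      unfolding norm_mult by (intro mult_mono p_le) (auto simp: b_def abs_sine_mode_le)
  qed auto
  have "L2_norm ?I (\<lambda>y. (g y - b y * p n y) + (b y * p n y - u y))
    \<le> L2_norm ?I (\<lambda>y. g y - b y * p n y) + L2_norm ?I (\<lambda>y. b y * p n y - u y)"
    by (intro L2_norm_triangle square_integrable_diff g bp sine_span_square_integrable u)
  then have "L2_norm ?I (\<lambda>y. g y - u y) < e"
    using n le by simp
  with u show thesis by (rule that)
qed

section \<open>Bessel's inequality and Parseval's identity\<close>

definition sine_partial_sum :: "nat \<Rightarrow> (real \<Rightarrow> complex) \<Rightarrow> real \<Rightarrow> complex" where
  "sine_partial_sum N g y = (\<Sum>n<N. sine_coeff n g * of_real (sine_mode n y))"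

lemma square_integrable_sine_partial_sum: "square_integrable {-1..1} (sine_partial_sum N g)"
  unfolding sine_partial_sum_def
  by (intro square_integrable_sum square_integrable_cmult square_integrable_sine_mode)

lemma sine_Pythagoras:
  assumes "square_integrable {-1..1} g"
  shows "(L2_norm {-1..1} (\<lambda>y. g y - sine_partial_sum N g y))\<^sup>2
    = (L2_norm {-1..1} g)\<^sup>2 - (\<Sum>n<N. (cmod (sine_coeff n g))\<^sup>2)"
  unfolding sine_partial_sum_def L2_norm_diff_sine_sum[OF assms] by (simp add: sum_negf)

text \<open>Partial sums are best approximations and their error does not increase with the number
  of modes, so one good element of the span controls all later partial sums.\<close>

lemma sine_partial_sum_tendsto:
  assumes g: "square_integrable {-1..1} g"
  shows "(\<lambda>N. L2_norm {-1..1} (\<lambda>y. g y - sine_partial_sum N g y)) \<longlonglongrightarrow> 0"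
proof (rule LIMSEQ_I)
  fix e :: real assume "e > 0"
  let ?I = "{-1..1::real}"
  obtain N a where le: "L2_norm ?I (\<lambda>y. g y - (\<Sum>n<N. a n * of_real (sine_mode n y))) < e"
    using sine_span_dense[OF g \<open>e > 0\<close>] unfolding sine_span_def by blast
  have "norm (L2_norm ?I (\<lambda>y. g y - sine_partial_sum M g y) - 0) < e" if "N \<le> M" for M
  proof -
    have "(L2_norm ?I (\<lambda>y. g y - sine_partial_sum M g y))\<^sup>2
        \<le> (L2_norm ?I g)\<^sup>2 - (\<Sum>n<N. (cmod (sine_coeff n g))\<^sup>2)"
      unfolding sine_Pythagoras[OF g] using that by (intro diff_left_mono sum_mono2) auto
    also have "\<dots> \<le> (L2_norm ?I (\<lambda>y. g y - (\<Sum>n<N. a n * of_real (sine_mode n y))))\<^sup>2"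
      unfolding L2_norm_diff_sine_sum[OF g] by (simp add: sum_subtractf sum_nonneg)
    finally have "L2_norm ?I (\<lambda>y. g y - sine_partial_sum M g y)
      \<le> L2_norm ?I (\<lambda>y. g y - (\<Sum>n<N. a n * of_real (sine_mode n y)))"
      by (rule power2_le_imp_le) simp
    then show ?thesis using le by simp
  qed
  then show "\<exists>N. \<forall>M\<ge>N. norm (L2_norm ?I (\<lambda>y. g y - sine_partial_sum M g y) - 0) < e"
    by blast
qed

lemma sine_Bessel:
  assumes "square_integrable {-1..1} g"
  shows "(\<Sum>n<N. (cmod (sine_coeff n g))\<^sup>2) \<le> (L2_norm {-1..1} g)\<^sup>2"
  using sine_Pythagoras[OF assms, of N] zero_le_power2[of "L2_norm {-1..1} (\<lambda>y. g y - sine_partial_sum N g y)"]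
  by linarith

lemma sine_Parseval:
  assumes g: "square_integrable {-1..1} g"
  shows "(\<lambda>N. \<Sum>n<N. (cmod (sine_coeff n g))\<^sup>2) \<longlonglongrightarrow> (L2_norm {-1..1} g)\<^sup>2"
proof -
  have "(\<lambda>N. (L2_norm {-1..1} g)\<^sup>2 - (L2_norm {-1..1} (\<lambda>y. g y - sine_partial_sum N g y))\<^sup>2)
    \<longlonglongrightarrow> (L2_norm {-1..1} g)\<^sup>2 - 0\<^sup>2"
    by (intro tendsto_intros sine_partial_sum_tendsto g)
  then show ?thesis by (simp add: sine_Pythagoras[OF g])
qed

subsection \<open>Energy decay of a single Fourier mode\<close>

lemma L2_continuous_on_bounded:
  assumes "compact S" and "L2_continuous_on S A u"
  obtains U where "U \<ge> 0" and "\<And>s. s \<in> S \<Longrightarrow> L2_norm A (u s) \<le> U"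
proof -
  have "bounded ((\<lambda>t. L2_norm A (u t)) ` S)"
    using assms L2_continuous_on_norm compact_continuous_image compact_imp_bounded by blast
  then obtain U where "\<And>s. s \<in> S \<Longrightarrow> \<bar>L2_norm A (u s)\<bar> \<le> U"
    by (auto simp: bounded_iff)
  then show thesis
    using that[of "\<bar>U\<bar>"] by (metis abs_ge_self abs_ge_zero order_trans)
qed

lemma continuous_bounded_on_rectangle:
  fixes V :: "real \<Rightarrow> real \<Rightarrow> real"
  assumes "compact S" and "continuous_on (S \<times> {a..b}) (\<lambda>(t, y). V t y)"
  obtains M where "M \<ge> 0" and "\<And>s y. s \<in> S \<Longrightarrow> y \<in> {a..b} \<Longrightarrow> \<bar>V s y\<bar> \<le> M"
proof -
  have "bounded ((\<lambda>(t, y). V t y) ` (S \<times> {a..b}))"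
    using assms by (intro compact_imp_bounded compact_continuous_image compact_Times) auto
  then obtain M where M: "\<And>p. p \<in> S \<times> {a..b} \<Longrightarrow> \<bar>(\<lambda>(t, y). V t y) p\<bar> \<le> M"
    by (auto simp: bounded_iff)
  have "\<bar>V s y\<bar> \<le> max M 0" if "s \<in> S" "y \<in> {a..b}" for s y
    using M[of "(s, y)"] that by simp
  then show thesis by (intro that[of "max M 0"]) auto
qed

lemma set_borel_measurable_continuous_slice:
  fixes v :: "real \<Rightarrow> real \<Rightarrow> real"
  assumes "continuous_on (S \<times> {a..b}) (\<lambda>(t, y). v t y)" and "t \<in> S"
  shows "set_borel_measurable lborel {a..b} (\<lambda>y. complex_of_real (v t y))"
proof -
  have "continuous_on {a..b} (\<lambda>y. (\<lambda>(t, y). v t y) (t, y))"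
    by (rule continuous_on_compose2[OF assms(1)]) (use assms(2) in \<open>auto intro!: continuous_intros\<close>)
  then show ?thesis
    unfolding set_borel_measurable_def
    by (auto intro!: borel_measurable_continuous_on_indicator continuous_intros)
qed

text \<open>The increment splits into v_s (u_s - u_t) + (v_s - v_t) u_t. Boundedness of v handles
  the first term, uniform continuity of v on the compact rectangle the second.\<close>

lemma L2_continuous_on_mult:
  fixes v :: "real \<Rightarrow> real \<Rightarrow> real"
  assumes v: "continuous_on (S \<times> {a..b}) (\<lambda>(t, y). v t y)" and "compact S"
    and u: "L2_continuous_on S {a..b} u"
  shows "L2_continuous_on S {a..b} (\<lambda>t y. of_real (v t y) * u t y)"
  unfolding L2_continuous_on_def
proof (intro ballI conjI)
  let ?A = "{a..b}"
  have comp: "compact (S \<times> ?A)" by (intro compact_Times assms) simp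
  obtain M where M: "M \<ge> 0" "\<And>t y. t \<in> S \<Longrightarrow> y \<in> ?A \<Longrightarrow> \<bar>v t y\<bar> \<le> M"
    using continuous_bounded_on_rectangle[OF assms(2) v] by blast
  have meas: "set_borel_measurable lborel ?A (\<lambda>y. complex_of_real (v t y))" if "t \<in> S" for t
    using v that by (rule set_borel_measurable_continuous_slice)
  have u_sq: "square_integrable ?A (u t)" if "t \<in> S" for t
    using u that by (simp add: L2_continuous_on_def)
  show sq: "square_integrable ?A (\<lambda>y. of_real (v t y) * u t y)" if "t \<in> S" for t
    by (rule square_integrable_bounded_mult(1)[where C="M"]) (use that meas u_sq M in auto)
  fix t assume t: "t \<in> S"
  have u_lim: "((\<lambda>s. L2_norm ?A (\<lambda>y. u s y - u t y)) \<longlongrightarrow> 0) (at t within S)"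
    using u t by (auto simp: L2_continuous_on_def L2_tendsto_def)
  show "L2_tendsto ?A (\<lambda>t y. of_real (v t y) * u t y) (\<lambda>y. of_real (v t y) * u t y) (at t within S)"
    unfolding L2_tendsto_def
  proof
    show "\<forall>\<^sub>F i in at t within S. square_integrable ?A (\<lambda>x. of_real (v i x) * u i x - of_real (v t x) * u t x)"
      unfolding eventually_at_filter using sq t by (auto intro!: always_eventually square_integrable_diff)
    show "((\<lambda>s. L2_norm ?A (\<lambda>y. of_real (v s y) * u s y - of_real (v t y) * u t y)) \<longlongrightarrow> 0) (at t within S)"
    proof (rule tendstoI)
      fix e :: real assume "e > 0"
      define N where "N = L2_norm ?A (u t)"
      \<comment> \<open>The added 1 keeps the denominator positive when \<open>u t\<close> has norm
        0, and d * N still stays below e/2.\<close>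
      define d where "d = e / (2 * (N + 1))"
      have "N \<ge> 0" by (simp add: N_def)
      then have "d > 0" using \<open>e > 0\<close> by (simp add: d_def)
      have "uniformly_continuous_on (S \<times> ?A) (\<lambda>(t, y). v t y)"
        using v comp by (rule compact_uniformly_continuous)
      then obtain r where "r > 0" and r: "\<And>p q. p \<in> S \<times> ?A \<Longrightarrow> q \<in> S \<times> ?A \<Longrightarrow> dist q p < r
          \<Longrightarrow> dist ((\<lambda>(t, y). v t y) q) ((\<lambda>(t, y). v t y) p) < d"
        using \<open>d > 0\<close> unfolding uniformly_continuous_on_def by metis
      have r': "\<bar>v s y - v t y\<bar> \<le> d" if "s \<in> S" "dist s t < r" "y \<in> ?A" for s y
        using r[of "(t, y)" "(s, y)"] that t by (simp add: dist_Pair_Pair dist_real_def)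
      have "((\<lambda>s. M * L2_norm ?A (\<lambda>y. u s y - u t y)) \<longlongrightarrow> M * 0) (at t within S)"
        by (intro tendsto_intros u_lim)
      then have "\<forall>\<^sub>F s in at t within S. M * L2_norm ?A (\<lambda>y. u s y - u t y) < e / 2"
        by (rule order_tendstoD(2)) (use \<open>e > 0\<close> in simp)
      moreover have "\<forall>\<^sub>F s in at t within S. s \<in> S \<and> dist s t < r"
        using \<open>r > 0\<close> by (auto simp: eventually_at)
      ultimately show "\<forall>\<^sub>F s in at t within S.
          dist (L2_norm ?A (\<lambda>y. of_real (v s y) * u s y - of_real (v t y) * u t y)) 0 < e"
      proof eventually_elim
        case (elim s)
        have du: "square_integrable ?A (\<lambda>y. u s y - u t y)"
          using elim t by (intro square_integrable_diff u_sq) auto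
        have 1: "square_integrable ?A (\<lambda>y. of_real (v s y) * (u s y - u t y))"
          "L2_norm ?A (\<lambda>y. of_real (v s y) * (u s y - u t y)) \<le> M * L2_norm ?A (\<lambda>y. u s y - u t y)"
          using square_integrable_bounded_mult[OF meas _ du, of s "M"] M elim by auto
        have dv: "set_borel_measurable lborel ?A (\<lambda>y. complex_of_real (v s y - v t y))"
          using meas[of s] meas[OF t] elim unfolding set_borel_measurable_def
          by (simp add: scaleR_diff_right)
        have d: "cmod (complex_of_real (v s y - v t y)) \<le> d" if "y \<in> ?A" for y
          unfolding norm_of_real using r' elim that by blast
        have 2: "square_integrable ?A (\<lambda>y. of_real (v s y - v t y) * u t y)"
          "L2_norm ?A (\<lambda>y. of_real (v s y - v t y) * u t y) \<le> d * N"
          unfolding N_def using \<open>d > 0\<close>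
          by (intro square_integrable_bounded_mult[OF dv d u_sq[OF t]]; simp)+
        have "L2_norm ?A (\<lambda>y. of_real (v s y) * u s y - of_real (v t y) * u t y)
          = L2_norm ?A (\<lambda>y. of_real (v s y) * (u s y - u t y) + of_real (v s y - v t y) * u t y)"
          by (simp add: algebra_simps)
        also have "\<dots> \<le> M * L2_norm ?A (\<lambda>y. u s y - u t y) + d * N"
          using L2_norm_triangle[OF 1(1) 2(1)] 1(2) 2(2) by linarith
        also have "d * N \<le> e / 2"
          using \<open>N \<ge> 0\<close> \<open>e > 0\<close> by (simp add: d_def field_simps)
        finally show ?case using elim by simp
      qed
    qed
  qed
qed

lemma continuous_on_sine_coeff:
  assumes "L2_continuous_on S {-1..1} u"
  shows "continuous_on S (\<lambda>t. sine_coeff n (u t))"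
  unfolding sine_coeff_def
  by (rule L2_continuous_on_integral[OF assms square_integrable_sine_mode])

text \<open>Turns products of coefficients into one pairing over the interval, in which the partial
  sum of \<open>f\<close> can be compared with \<open>f\<close> itself.\<close>

lemma sum_sine_coeff_cnj:
  assumes "square_integrable {-1..1} g"
  shows "(\<Sum>n<N. sine_coeff n g * cnj (sine_coeff n f))
    = (LINT y:{-1..1}|lborel. g y * cnj (sine_partial_sum N f y))"
proof -
  have "(LINT y:{-1..1}|lborel. \<Sum>n\<in>J. cnj (sine_coeff n f) * (g y * of_real (sine_mode n y)))
     = (\<Sum>n\<in>J. cnj (sine_coeff n f) * sine_coeff n g)" if "finite J" for J
    using that
  proof (induction J)
    case (insert n J)
    have int: "set_integrable lborel {-1..1} (\<lambda>y. cnj (sine_coeff n f) * (g y * of_real (sine_mode n y)))" for n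
      by (intro set_integrable_mult_right square_integrable_set_mult assms square_integrable_sine_mode)
    then have "set_integrable lborel {-1..1} (\<lambda>y. \<Sum>n\<in>J. cnj (sine_coeff n f) * (g y * of_real (sine_mode n y)))"
      unfolding set_integrable_def scaleR_sum_right by (intro Bochner_Integration.integrable_sum)
    from set_integral_add(2)[OF int[of n] this] show ?case
      using insert by (simp add: sine_coeff_def)
  qed simp
  from this[of "{..<N}"] show ?thesis
    unfolding sine_partial_sum_def by (simp add: sum_distrib_left mult_ac)
qed

text \<open>The transport term drops out of the energy balance of the Galerkin truncation only in the limit,
  where \<open>\<langle>v u, u\<rangle>\<close> is real.\<close>

lemma transport_term_bound:
  assumes f: "square_integrable {-1..1} f" and v: "set_borel_measurable lborel {-1..1} (\<lambda>y. complex_of_real (v y))"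
    and M: "\<And>y. y \<in> {-1..1} \<Longrightarrow> \<bar>v y\<bar> \<le> M" "0 \<le> M"
  shows "\<bar>\<Sum>n<N. inner (sine_coeff n f) (\<i> * of_real k * sine_coeff n (\<lambda>y. of_real (v y) * f y))\<bar>
    \<le> \<bar>k\<bar> * (M * L2_norm {-1..1} f) * L2_norm {-1..1} (\<lambda>y. f y - sine_partial_sum N f y)"
proof -
  let ?I = "{-1..1::real}" and ?g = "\<lambda>y. of_real (v y) * f y"
  have g: "square_integrable ?I ?g" "L2_norm ?I ?g \<le> M * L2_norm ?I f"
    using square_integrable_bounded_mult[OF v _ f, of M] M by auto
  have inner: "inner a b = Re (b * cnj a)" for a b :: complex
    by (simp add: inner_complex_def mult.commute)
  have cr: "square_integrable ?I (\<lambda>y. cnj (f y - sine_partial_sum N f y))"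
    by (intro square_integrable_cnj square_integrable_diff f square_integrable_sine_partial_sum)
  have e1: "(LINT y:?I|lborel. ?g y * cnj (sine_partial_sum N f y))
    = (LINT y:?I|lborel. ?g y * cnj (f y)) - (LINT y:?I|lborel. ?g y * cnj (f y - sine_partial_sum N f y))"
    using square_integrable_set_mult[OF g(1) square_integrable_cnj[OF f]] square_integrable_set_mult[OF g(1) cr]
    by (subst set_integral_diff(2)[symmetric]) (auto simp: algebra_simps)
  \<comment> \<open>Since \<open>v\<close> is real, so is this pairing; multiplied by i k it has
    real part 0, and only the pairing with the projection error survives.\<close>
  have e2: "(LINT y:?I|lborel. ?g y * cnj (f y)) = of_real (LINT y:?I|lborel. v y * (cmod (f y))\<^sup>2)"
    by (simp only: mult.assoc complex_norm_square[symmetric] of_real_mult[symmetric] set_integral_complex_of_real)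
  have eq: "(\<Sum>n<N. inner (sine_coeff n f) (\<i> * of_real k * sine_coeff n ?g))
    = Re (\<i> * of_real k * (of_real (LINT y:?I|lborel. v y * (cmod (f y))\<^sup>2)
       - (LINT y:?I|lborel. ?g y * cnj (f y - sine_partial_sum N f y))))"
  proof -
    have "(\<Sum>n<N. inner (sine_coeff n f) (\<i> * of_real k * sine_coeff n ?g))
      = Re (\<i> * of_real k * (\<Sum>n<N. sine_coeff n ?g * cnj (sine_coeff n f)))"
      by (simp only: inner Re_sum sum_distrib_left mult.assoc)
    then show ?thesis
      by (simp only: sum_sine_coeff_cnj[OF g(1)] e1 e2)
  qed
  have "\<bar>\<Sum>n<N. inner (sine_coeff n f) (\<i> * of_real k * sine_coeff n ?g)\<bar>
     = \<bar>Re (\<i> * of_real k * (LINT y:?I|lborel. ?g y * cnj (f y - sine_partial_sum N f y)))\<bar>"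
    unfolding eq by (simp add: algebra_simps)
  also have "\<dots> \<le> \<bar>k\<bar> * cmod (LINT y:?I|lborel. ?g y * cnj (f y - sine_partial_sum N f y))"
    using abs_Re_le_cmod[of "\<i> * of_real k * (LINT y:?I|lborel. ?g y * cnj (f y - sine_partial_sum N f y))"]
    by (simp add: norm_mult)
  also have "\<dots> \<le> \<bar>k\<bar> * (L2_norm ?I ?g * L2_norm ?I (\<lambda>y. cnj (f y - sine_partial_sum N f y)))"
    by (intro mult_left_mono L2_Cauchy_Schwarz g cr) simp
  also have "\<dots> \<le> \<bar>k\<bar> * ((M * L2_norm ?I f) * L2_norm ?I (\<lambda>y. cnj (f y - sine_partial_sum N f y)))"
    by (intro mult_left_mono mult_right_mono g(2)) auto
  also have "L2_norm ?I (\<lambda>y. cnj (f y - sine_partial_sum N f y)) = L2_norm ?I (\<lambda>y. f y - sine_partial_sum N f y)"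
    unfolding L2_norm_def by (simp only: complex_mod_cnj)
  finally show ?thesis by (simp add: mult.assoc)
qed

lemma has_vector_derivative_set_integral:
  fixes g :: "real \<Rightarrow> complex"
  assumes "continuous_on {a..b} g" and "t \<in> {a..b}"
  shows "((\<lambda>t. LINT s:{a..t}|lborel. g s) has_vector_derivative g t) (at t within {a..b})"
proof (rule has_vector_derivative_transform[OF assms(2) _ integral_has_vector_derivative[OF assms]])
  fix x assume "x \<in> {a..b}"
  then have "continuous_on {a..x} g" using assms(1) by (rule_tac continuous_on_subset) auto
  then have "set_integrable lborel {a..x} g"
    unfolding set_integrable_def by (intro borel_integrable_compact) auto
  then show "(LINT s:{a..x}|lborel. g s) = integral {a..x} g"
    by (rule set_borel_integral_eq_integral(2))
qed

text \<open>Gronwall's argument for the truncated energy: after multiplication by exp(2 \<nu> s) its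
  derivative is at most -2 exp(2 \<nu> s) times the transport term. The inequality is integrated
  before N tends to infinity, so the transport term has to vanish only pointwise in s under a
  uniform bound, and the derivative of the full energy never appears.\<close>

lemma energy_decay:
  fixes u :: "real \<Rightarrow> real \<Rightarrow> complex" and v :: "real \<Rightarrow> real \<Rightarrow> real" and k :: real and \<mu> :: "nat \<Rightarrow> real"
  assumes u: "L2_continuous_on {0..T} {-1..1} u"
    and v: "continuous_on ({0..T} \<times> {-1..1}) (\<lambda>(t, y). v t y)"
    and ode: "\<And>n t. t \<in> {0..T} \<Longrightarrow> sine_coeff n (u t) = sine_coeff n (u 0)
      - (LINT s:{0..t}|lborel. \<i> * of_real k * sine_coeff n (\<lambda>y. of_real (v s y) * u s y)
          + of_real (\<mu> n) * sine_coeff n (u s))"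
    and \<mu>: "\<And>n. \<nu> \<le> \<mu> n" and t: "t \<in> {0..T}"
  shows "L2_norm {-1..1} (u t) \<le> exp (- \<nu> * t) * L2_norm {-1..1} (u 0)"
proof -
  let ?I = "{-1..1::real}"
  define c d where "c n s = sine_coeff n (u s)" and "d n s = sine_coeff n (\<lambda>y. of_real (v s y) * u s y)" for n s
  define c' where "c' n s = - (\<i> * of_real k * d n s + of_real (\<mu> n) * c n s)" for n s
  have c_cont: "continuous_on {0..T} (c n)" and d_cont: "continuous_on {0..T} (d n)" for n
    unfolding c_def d_def
    by (intro continuous_on_sine_coeff u L2_continuous_on_mult v compact_Icc)+
  have c'_cont: "continuous_on {0..T} (c' n)" for n
    unfolding c'_def by (intro continuous_intros c_cont d_cont)
  have c_deriv: "(c n has_vector_derivative c' n s) (at s within {0..T})" if "s \<in> {0..T}" for n s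
  proof -
    have "continuous_on {0..T} (\<lambda>s. \<i> * of_real k * d n s + of_real (\<mu> n) * c n s)"
      by (intro continuous_intros c_cont d_cont)
    from has_vector_derivative_diff[OF has_vector_derivative_const has_vector_derivative_set_integral[OF this that]]
    have "((\<lambda>t. c n 0 - (LINT s:{0..t}|lborel. \<i> * of_real k * d n s + of_real (\<mu> n) * c n s))
        has_vector_derivative c' n s) (at s within {0..T})"
      by (simp add: c'_def)
    then show ?thesis
      by (rule has_vector_derivative_transform[OF that, rotated]) (unfold c_def d_def, rule ode)
  qed
  obtain U where U: "U \<ge> 0" "\<And>s. s \<in> {0..T} \<Longrightarrow> L2_norm ?I (u s) \<le> U"
    using L2_continuous_on_bounded[OF compact_Icc u] by blast
  obtain M where M: "M \<ge> 0" "\<And>s y. s \<in> {0..T} \<Longrightarrow> y \<in> ?I \<Longrightarrow> \<bar>v s y\<bar> \<le> M"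
    using continuous_bounded_on_rectangle[OF compact_Icc v] by blast
  have u_sq: "square_integrable ?I (u s)" if "s \<in> {0..T}" for s
    using u that by (simp add: L2_continuous_on_def)
  define W where "W N s = (\<Sum>n<N. inner (c n s) (\<i> * of_real k * d n s))" for N s
  define r where "r N s = L2_norm ?I (\<lambda>y. u s y - sine_partial_sum N (u s) y)" for N s
  have W_le: "\<bar>W N s\<bar> \<le> \<bar>k\<bar> * (M * L2_norm ?I (u s)) * r N s" if s: "s \<in> {0..T}" for N s
    unfolding W_def r_def c_def d_def
    by (rule transport_term_bound[OF u_sq[OF s] set_borel_measurable_continuous_slice[OF v s] M(2)[OF s] M(1)])
  have r_le: "r N s \<le> L2_norm ?I (u s)" if "s \<in> {0..T}" for N s
    unfolding r_def
    by (rule power2_le_imp_le) (simp_all add: sine_Pythagoras[OF u_sq[OF that]] sum_nonneg)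
  \<comment> \<open>Independent of N and s, this is the majorant for the passage to the limit under
    the time integral.\<close>
  have W_bound: "\<bar>W N s\<bar> \<le> \<bar>k\<bar> * (M * U) * U" if "s \<in> {0..T}" for N s
    using M(1) U by (intro order_trans[OF W_le[OF that]] mult_mono mult_left_mono U(2)[OF that] order_trans[OF r_le[OF that]])
      (auto simp: that r_def)
  have W_lim: "(\<lambda>N. W N s) \<longlonglongrightarrow> 0" if "s \<in> {0..T}" for s
  proof (rule Lim_null_comparison)
    show "\<forall>\<^sub>F N in sequentially. norm (W N s) \<le> \<bar>k\<bar> * (M * L2_norm ?I (u s)) * r N s"
      using W_le[OF that] by simp
    show "(\<lambda>N. \<bar>k\<bar> * (M * L2_norm ?I (u s)) * r N s) \<longlonglongrightarrow> 0"
      unfolding r_def by (intro tendsto_mult_right_zero sine_partial_sum_tendsto u_sq that)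
  qed
  have W_cont: "continuous_on {0..T} (W N)" for N
    unfolding W_def by (intro continuous_intros c_cont d_cont)
  define E where "E N s = (\<Sum>n<N. (cmod (c n s))\<^sup>2)" for N s
  have E_lim: "(\<lambda>N. E N s) \<longlonglongrightarrow> (L2_norm ?I (u s))\<^sup>2" if "s \<in> {0..T}" for s
    unfolding E_def c_def by (rule sine_Parseval[OF u_sq[OF that]])
  have sub: "{0..t} \<subseteq> {0..T}" using t by auto
  have ineq: "exp (2 * \<nu> * t) * E N t - E N 0 \<le> (LINT s:{0..t}|lborel. - 2 * exp (2 * \<nu> * s) * W N s)" for N
  proof -
    define G where "G s = exp (2 * \<nu> * s) * E N s" for s
    define G' where "G' s = exp (2 * \<nu> * s) * (\<Sum>n<N. inner (c n s) (c' n s) + inner (c' n s) (c n s))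
       + (exp (2 * \<nu> * s) * (2 * \<nu>)) * E N s" for s
    have G_deriv: "(G has_vector_derivative G' s) (at s within {0..t})" if "s \<in> {0..t}" for s
    proof -
      have "(c n has_vector_derivative c' n s) (at s within {0..t})" for n
        using c_deriv that sub by (blast intro: has_vector_derivative_within_subset)
      then have "(E N has_vector_derivative (\<Sum>n<N. inner (c n s) (c' n s) + inner (c' n s) (c n s))) (at s within {0..t})"
        unfolding E_def power2_norm_eq_inner
        by (intro has_vector_derivative_sum bounded_bilinear.has_vector_derivative[OF bounded_bilinear_inner])
      moreover have "((\<lambda>s. exp (2 * \<nu> * s)) has_vector_derivative exp (2 * \<nu> * s) * (2 * \<nu>)) (at s within {0..t})"
        unfolding has_real_derivative_iff_has_vector_derivative[symmetric]
        by (auto intro!: derivative_eq_intros)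
      ultimately show ?thesis
        unfolding G_def G'_def by (intro has_vector_derivative_mult)
    qed
    have E_cont: "continuous_on {0..T} (E N)"
      unfolding E_def by (intro continuous_intros c_cont)
    have G'_cont: "continuous_on {0..t} G'"
      unfolding G'_def
      by (intro continuous_on_subset[OF _ sub] continuous_intros c_cont c'_cont E_cont)
    have "exp (2 * \<nu> * t) * E N t - E N 0 = G t - G 0"
      by (simp add: G_def)
    also have "\<dots> = (LINT s:{0..t}|lborel. G' s)"
      unfolding set_lebesgue_integral_def using t
      by (intro integral_FTC_Icc[symmetric] G_deriv G'_cont) auto
    also have "\<dots> \<le> (LINT s:{0..t}|lborel. - 2 * exp (2 * \<nu> * s) * W N s)"
    proof (rule set_integral_mono)
      show "set_integrable lborel {0..t} G'"
        unfolding set_integrable_def by (intro borel_integrable_compact G'_cont compact_Icc)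
      show "set_integrable lborel {0..t} (\<lambda>s. - 2 * exp (2 * \<nu> * s) * W N s)"
        unfolding set_integrable_def
        by (intro borel_integrable_compact continuous_intros compact_Icc continuous_on_subset[OF W_cont sub])
      fix s assume "s \<in> {0..t}"
      \<comment> \<open>The real inner product is symmetric, so the two terms of the product rule
        agree; the resulting factor 2 matches the exponent 2 \<nu> s.\<close>
      have "(\<Sum>n<N. inner (c n s) (c' n s) + inner (c' n s) (c n s)) = - 2 * W N s - 2 * (\<Sum>n<N. \<mu> n * (cmod (c n s))\<^sup>2)"
      proof -
        have "inner (c n s) (c' n s) + inner (c' n s) (c n s)
          = - 2 * inner (c n s) (\<i> * of_real k * d n s) - 2 * (\<mu> n * (cmod (c n s))\<^sup>2)" for n
        proof -
          have "inner (c n s) (of_real (\<mu> n) * c n s) = \<mu> n * (cmod (c n s))\<^sup>2"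
            by (simp add: power2_norm_eq_inner flip: scaleR_conv_of_real)
          then have "inner (c n s) (c' n s)
              = - inner (c n s) (\<i> * of_real k * d n s) - \<mu> n * (cmod (c n s))\<^sup>2"
            unfolding c'_def inner_minus_right inner_add_right by simp
          then show ?thesis unfolding inner_commute[of "c' n s" "c n s"] by simp
        qed
        then show ?thesis
          by (simp add: W_def sum_subtractf sum_distrib_left sum_negf)
      qed
      moreover have "\<nu> * E N s \<le> (\<Sum>n<N. \<mu> n * (cmod (c n s))\<^sup>2)"
        unfolding E_def sum_distrib_left by (intro sum_mono mult_right_mono \<mu>) simp
      ultimately have "(\<Sum>n<N. inner (c n s) (c' n s) + inner (c' n s) (c n s)) + 2 * \<nu> * E N s \<le> - 2 * W N s"
        by simp
      then have "exp (2 * \<nu> * s) * ((\<Sum>n<N. inner (c n s) (c' n s) + inner (c' n s) (c n s)) + 2 * \<nu> * E N s)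
         \<le> exp (2 * \<nu> * s) * (- 2 * W N s)"
        by (rule mult_left_mono) simp
      then show "G' s \<le> - 2 * exp (2 * \<nu> * s) * W N s"
        by (simp add: G'_def algebra_simps)
    qed
    finally show ?thesis .
  qed
  have "(\<lambda>N. LINT s:{0..t}|lborel. - 2 * exp (2 * \<nu> * s) * W N s) \<longlonglongrightarrow> (\<integral>s. 0 \<partial>(lborel :: real measure))"
    unfolding set_lebesgue_integral_def
  proof (rule integral_dominated_convergence)
    show "integrable lborel (\<lambda>s. indicator {0..t} s *\<^sub>R (2 * exp (2 * \<nu> * s) * (\<bar>k\<bar> * (M * U) * U)))"
      by (intro borel_integrable_compact compact_Icc continuous_intros)
    show "(\<lambda>s. indicator {0..t} s *\<^sub>R (- 2 * exp (2 * \<nu> * s) * W N s)) \<in> borel_measurable lborel" for N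
    proof -
      have "continuous_on {0..t} (\<lambda>s. - 2 * exp (2 * \<nu> * s) * W N s)"
        by (intro continuous_intros continuous_on_subset[OF W_cont sub])
      then have "(\<lambda>s. indicator {0..t} s *\<^sub>R (- 2 * exp (2 * \<nu> * s) * W N s)) \<in> borel_measurable borel"
        by (intro borel_measurable_continuous_on_indicator) auto
      then show ?thesis by simp
    qed
    show "AE s in lborel. (\<lambda>N. indicator {0..t} s *\<^sub>R (- 2 * exp (2 * \<nu> * s) * W N s)) \<longlonglongrightarrow> 0"
    proof (intro AE_I2)
      fix s :: real
      show "(\<lambda>N. indicator {0..t} s *\<^sub>R (- 2 * exp (2 * \<nu> * s) * W N s)) \<longlonglongrightarrow> 0"
        using tendsto_mult_right_zero[OF W_lim, of s "- 2 * exp (2 * \<nu> * s)"] sub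
        by (cases "s \<in> {0..t}") auto
    qed
    show "AE s in lborel. norm (indicator {0..t} s *\<^sub>R (- 2 * exp (2 * \<nu> * s) * W N s))
      \<le> indicator {0..t} s *\<^sub>R (2 * exp (2 * \<nu> * s) * (\<bar>k\<bar> * (M * U) * U))" for N
    proof (intro AE_I2)
      fix s
      show "norm (indicator {0..t} s *\<^sub>R (- 2 * exp (2 * \<nu> * s) * W N s))
        \<le> indicator {0..t} s *\<^sub>R (2 * exp (2 * \<nu> * s) * (\<bar>k\<bar> * (M * U) * U))"
      proof (cases "s \<in> {0..t}")
        case True
        then have "\<bar>W N s\<bar> \<le> \<bar>k\<bar> * (M * U) * U" using W_bound sub by blast
        then have "2 * exp (2 * \<nu> * s) * \<bar>W N s\<bar> \<le> 2 * exp (2 * \<nu> * s) * (\<bar>k\<bar> * (M * U) * U)"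
          by (rule mult_left_mono) simp
        then show ?thesis using True by (simp add: abs_mult)
      qed simp
    qed
  qed simp
  moreover have "(\<lambda>N. exp (2 * \<nu> * t) * E N t - E N 0)
      \<longlonglongrightarrow> exp (2 * \<nu> * t) * (L2_norm ?I (u t))\<^sup>2 - (L2_norm ?I (u 0))\<^sup>2"
    using t by (intro tendsto_intros E_lim) auto
  ultimately have "exp (2 * \<nu> * t) * (L2_norm ?I (u t))\<^sup>2 - (L2_norm ?I (u 0))\<^sup>2 \<le> 0"
    using ineq by (intro LIMSEQ_le) auto
  then have "(exp (\<nu> * t) * L2_norm ?I (u t))\<^sup>2 \<le> (L2_norm ?I (u 0))\<^sup>2"
    by (simp add: power_mult_distrib power2_eq_square[of "exp _"] mult.assoc flip: exp_add mult_2)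
  then have "exp (\<nu> * t) * L2_norm ?I (u t) \<le> L2_norm ?I (u 0)"
    by (rule power2_le_imp_le) simp
  then have "exp (- \<nu> * t) * (exp (\<nu> * t) * L2_norm ?I (u t)) \<le> exp (- \<nu> * t) * L2_norm ?I (u 0)"
    by (rule mult_left_mono) simp
  then show ?thesis by (simp add: mult.assoc[symmetric] flip: exp_add)
qed

subsection \<open>Integration by parts for functions with zero trace\<close>

lemma lborel_Fubini:
  fixes f :: "'a::euclidean_space \<times> 'b::euclidean_space \<Rightarrow> 'c::{banach, second_countable_topology}"
  assumes "integrable lborel f"
  shows "(\<integral>x. (\<integral>y. f (x, y) \<partial>lborel) \<partial>lborel) = integral\<^sup>L lborel f"
    and "(\<integral>y. (\<integral>x. f (x, y) \<partial>lborel) \<partial>lborel) = integral\<^sup>L lborel f"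
    and "integrable lborel (\<lambda>x. \<integral>y. f (x, y) \<partial>lborel)"
    and "AE x in lborel. integrable lborel (\<lambda>y. f (x, y))"
proof -
  have f: "integrable (lborel \<Otimes>\<^sub>M lborel) f" using assms by (simp add: lborel_prod)
  show "(\<integral>x. (\<integral>y. f (x, y) \<partial>lborel) \<partial>lborel) = integral\<^sup>L lborel f"
    using lborel_pair.integral_fst'[OF f] by (simp add: lborel_prod)
  show "(\<integral>y. (\<integral>x. f (x, y) \<partial>lborel) \<partial>lborel) = integral\<^sup>L lborel f"
    using lborel_pair.integral_snd[of "\<lambda>x y. f (x, y)"] f by (simp add: lborel_prod case_prod_beta')
  show "integrable lborel (\<lambda>x. \<integral>y. f (x, y) \<partial>lborel)"
    by (rule lborel_pair.integrable_fst'[OF f])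
  show "AE x in lborel. integrable lborel (\<lambda>y. f (x, y))"
    by (rule lborel_pair.AE_integrable_fst'[OF f])
qed

lemma integrable_tensor:
  fixes f :: "'a::euclidean_space \<Rightarrow> real" and g :: "'b::euclidean_space \<Rightarrow> real"
  assumes "integrable lborel f" and "integrable lborel g"
  shows "integrable lborel (\<lambda>p. f (fst p) * g (snd p))"
proof -
  have [measurable]: "f \<in> borel_measurable borel" "g \<in> borel_measurable borel"
    using assms by auto
  have "integrable (lborel \<Otimes>\<^sub>M lborel) (\<lambda>p. f (fst p) * g (snd p))"
    by (rule lborel_pair.Fubini_integrable) (use assms in \<open>simp_all add: abs_mult\<close>)
  then show ?thesis by (simp add: lborel_prod)
qed

lemma strip_borel [measurable]: "strip \<in> sets borel"
  unfolding strip_def by (intro borel_open open_Times) auto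

lemma indicator_strip: "indicator strip p = indicator {-1<..<1::real} (snd p)"
  by (auto simp: strip_def indicator_def mem_Times_iff)

lemma borel_measurable_fst_comp [measurable (raw)]:
  fixes f :: "'a::euclidean_space \<Rightarrow> 'c::topological_space"
  shows "f \<in> borel_measurable borel \<Longrightarrow> (\<lambda>p::'a \<times> 'b::euclidean_space. f (fst p)) \<in> borel_measurable borel"
  by (rule measurable_compose[OF borel_measurable_continuous_onI]) (auto intro: continuous_intros)

lemma borel_measurable_snd_comp [measurable (raw)]:
  fixes f :: "'b::euclidean_space \<Rightarrow> 'c::topological_space"
  shows "f \<in> borel_measurable borel \<Longrightarrow> (\<lambda>p::'a::euclidean_space \<times> 'b. f (snd p)) \<in> borel_measurable borel"
  by (rule measurable_compose[OF borel_measurable_continuous_onI]) (auto intro: continuous_intros)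

lemma square_integrable_tensor:
  assumes a: "square_integrable UNIV a" and c: "c \<in> borel_measurable borel" and C: "\<And>y. cmod (c y) \<le> C"
  shows "square_integrable strip (\<lambda>p. a (fst p) * c (snd p))"
proof (rule square_integrableI)
  have [measurable]: "a \<in> borel_measurable borel" "c \<in> borel_measurable borel"
    using a[THEN square_integrable_measurable] c by auto
  show "(\<lambda>p. indicator strip p *\<^sub>R (a (fst p) * c (snd p))) \<in> borel_measurable borel"
    by measurable
  have "integrable lborel (\<lambda>p. (C\<^sup>2 * (cmod (a (fst p)))\<^sup>2) * indicat_real {-1<..<1} (snd p :: real))"
    using a by (intro integrable_tensor) (auto simp: square_integrable_def set_integrable_def)
  then show "set_integrable lborel strip (\<lambda>p. C\<^sup>2 * (cmod (a (fst p)))\<^sup>2)"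
    by (simp add: set_integrable_def indicator_strip mult.commute)
  show "(cmod (a (fst p) * c (snd p)))\<^sup>2 \<le> C\<^sup>2 * (cmod (a (fst p)))\<^sup>2" for p
    unfolding norm_mult power_mult_distrib mult.commute[of "C\<^sup>2"]
    by (intro mult_left_mono power_mono C) auto
qed

lemma strip_integral_snd:
  fixes f :: "real \<times> real \<Rightarrow> complex"
  assumes "set_integrable lborel strip f"
  shows "(LINT p:strip|lborel. f p) = (LINT y:{-1<..<1}|lborel. (\<integral>x. f (x, y) \<partial>lborel))"
  using lborel_Fubini(2)[of "\<lambda>p. indicator strip p *\<^sub>R f p"] assms
  unfolding set_integrable_def set_lebesgue_integral_def
  by (simp add: indicator_strip)

lemma strip_integral_fst:
  fixes f :: "real \<times> real \<Rightarrow> complex"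
  assumes "set_integrable lborel strip f"
  shows "(LINT p:strip|lborel. f p) = (\<integral>x. (LINT y:{-1<..<1}|lborel. f (x, y)) \<partial>lborel)"
  using lborel_Fubini(1)[of "\<lambda>p. indicator strip p *\<^sub>R f p"] assms
  unfolding set_integrable_def set_lebesgue_integral_def
  by (simp add: indicator_strip)

lemma set_integral_open_closed:
  fixes f :: "real \<Rightarrow> 'a::{banach, second_countable_topology}"
  shows "(LINT y:{a<..<b}|lborel. f y) = (LINT y:{a..b}|lborel. f y)"
  by (rule set_integral_discrete_difference[where X="{a, b}"]) auto

text \<open>The function itself vanishes already at |x| = R, as needed for boundary terms there. Its
  derivative is treated on the open set |x| > R, where the function is locally 0.\<close>

lemma C1_compact_vanish:
  assumes "C1_compact U \<phi> \<phi>x \<phi>y"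
  obtains R where "R > 0" and "\<And>x y. R \<le> \<bar>x\<bar> \<Longrightarrow> \<phi> (x, y) = 0" and "\<And>x y. R < \<bar>x\<bar> \<Longrightarrow> \<phi>x (x, y) = 0"
proof -
  obtain K where "compact K" and K: "\<And>p. p \<notin> K \<Longrightarrow> \<phi> p = 0"
    using assms unfolding C1_compact_def by auto
  then obtain R where "R > 0" and R: "\<And>p. p \<in> K \<Longrightarrow> norm p < R"
    using compact_imp_bounded bounded_pos_less by metis
  have zero: "\<phi> (x, y) = 0" if "R \<le> \<bar>x\<bar>" for x y
  proof (rule K)
    have "\<bar>x\<bar> \<le> norm (x, y)" using norm_fst_le[of x y] by simp
    then show "(x, y) \<notin> K" using R that by fastforce
  qed
  have "\<phi>x (x, y) = 0" if "R < \<bar>x\<bar>" for x y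
  proof -
    have "((\<lambda>z. \<phi> (z, y)) has_vector_derivative \<phi>x (x, y)) (at x)"
      using assms unfolding C1_compact_def by blast
    moreover have "((\<lambda>z. 0) has_vector_derivative 0) (at x)" by simp
    then have "((\<lambda>z. \<phi> (z, y)) has_vector_derivative 0) (at x)"
    proof (rule has_vector_derivative_transform_within_open)
      show "open {z::real. R < \<bar>z\<bar>}" by (intro open_Collect_less continuous_intros)
    qed (use that zero in auto)
    ultimately show ?thesis by (rule vector_derivative_unique_at)
  qed
  with \<open>R > 0\<close> zero show thesis by (rule that)
qed

lemma C1_compact_ibp_x:
  assumes \<phi>: "C1_compact U \<phi> \<phi>x \<phi>y"
    and a: "\<And>x. (a has_vector_derivative a1 x) (at x)" and a1: "continuous_on UNIV a1"
  shows "(\<integral>x. \<phi>x (x, y) * a x + \<phi> (x, y) * a1 x \<partial>lborel) = 0"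
proof -
  obtain R where R: "R > 0" "\<And>x y. R \<le> \<bar>x\<bar> \<Longrightarrow> \<phi> (x, y) = 0" "\<And>x y. R < \<bar>x\<bar> \<Longrightarrow> \<phi>x (x, y) = 0"
    using C1_compact_vanish[OF \<phi>] by blast
  have d: "((\<lambda>z. \<phi> (z, y)) has_vector_derivative \<phi>x (x, y)) (at x)" for x
    using \<phi> unfolding C1_compact_def by blast
  have "continuous_on UNIV \<phi>x" using \<phi> unfolding C1_compact_def by blast
  then have cx: "continuous_on S (\<lambda>x. \<phi>x (x, y))" for S
    by (rule continuous_on_compose2) (auto intro: continuous_intros)
  have c: "continuous_on S (\<lambda>x. \<phi> (x, y))" "continuous_on S a" for S
    using d a by (auto intro!: continuous_at_imp_continuous_on has_vector_derivative_continuous)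
  have "(\<integral>x. \<phi>x (x, y) * a x + \<phi> (x, y) * a1 x \<partial>lborel)
    = (\<integral>x. indicator {-R..R} x *\<^sub>R (\<phi> (x, y) * a1 x + \<phi>x (x, y) * a x) \<partial>lborel)"
    using R by (intro Bochner_Integration.integral_cong) (auto simp: indicator_def)
  also have "\<dots> = \<phi> (R, y) * a R - \<phi> (-R, y) * a (-R)"
  proof (rule integral_FTC_Icc)
    show "((\<lambda>x. \<phi> (x, y) * a x) has_vector_derivative (\<phi> (x, y) * a1 x + \<phi>x (x, y) * a x)) (at x within {-R..R})" for x
      by (rule has_vector_derivative_at_within[OF has_vector_derivative_mult[OF d a]])
    show "continuous_on {-R..R} (\<lambda>x. \<phi> (x, y) * a1 x + \<phi>x (x, y) * a x)"
      using continuous_on_subset[OF a1 subset_UNIV] by (intro continuous_on_add continuous_on_mult c cx)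
  qed (use R in simp)
  also have "\<dots> = 0" using R by simp
  finally show ?thesis .
qed

text \<open>The approximating functions are continuously differentiable across the lines y = -1 and
  y = 1 and need not vanish there, hence the boundary terms. Adding the end points to the interval
  changes only a null set.\<close>

lemma C1_compact_ibp_y:
  assumes \<phi>: "C1_compact U \<phi> \<phi>x \<phi>y"
    and b: "\<And>y. (b has_vector_derivative b1 y) (at y)" and b1: "continuous_on UNIV b1"
  shows "(LINT y:{-1<..<1}|lborel. \<phi>y (x, y) * b y + \<phi> (x, y) * b1 y)
    = \<phi> (x, 1) * b 1 - \<phi> (x, -1) * b (-1)"
proof -
  have d: "((\<lambda>z. \<phi> (x, z)) has_vector_derivative \<phi>y (x, y)) (at y)" for y
    using \<phi> unfolding C1_compact_def by blast
  have "continuous_on UNIV \<phi>y" using \<phi> unfolding C1_compact_def by blast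
  then have cy: "continuous_on S (\<lambda>y. \<phi>y (x, y))" for S
    by (rule continuous_on_compose2) (auto intro: continuous_intros)
  have c: "continuous_on S (\<lambda>y. \<phi> (x, y))" "continuous_on S b" for S
    using d b by (auto intro!: continuous_at_imp_continuous_on has_vector_derivative_continuous)
  have "(LINT y:{-1<..<1}|lborel. \<phi>y (x, y) * b y + \<phi> (x, y) * b1 y)
    = (\<integral>y. indicator {-1..1} y *\<^sub>R (\<phi> (x, y) * b1 y + \<phi>y (x, y) * b y) \<partial>lborel)"
    by (simp only: set_integral_open_closed) (simp add: set_lebesgue_integral_def add.commute)
  also have "\<dots> = \<phi> (x, 1) * b 1 - \<phi> (x, -1) * b (-1)"
  proof (rule integral_FTC_Icc)
    show "((\<lambda>y. \<phi> (x, y) * b y) has_vector_derivative (\<phi> (x, y) * b1 y + \<phi>y (x, y) * b y)) (at y within {-1..1})" for y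
      by (rule has_vector_derivative_at_within[OF has_vector_derivative_mult[OF d b]])
    show "continuous_on {-1..1} (\<lambda>y. \<phi> (x, y) * b1 y + \<phi>y (x, y) * b y)"
      using continuous_on_subset[OF b1 subset_UNIV] by (intro continuous_on_add continuous_on_mult c cy)
  qed simp
  finally show ?thesis .
qed

lemma L2_tendsto_square_integrable:
  assumes "L2_tendsto A \<phi> u Fl" and "square_integrable A u"
  shows "\<forall>\<^sub>F n in Fl. square_integrable A (\<phi> n)"
proof -
  have "\<forall>\<^sub>F n in Fl. square_integrable A (\<lambda>x. \<phi> n x - u x)"
    using assms(1) by (simp add: L2_tendsto_def)
  then show ?thesis
    by eventually_elim (use square_integrable_add[OF _ assms(2)] in fastforce)
qed

abbreviation strip_pairing ::
  "(real \<times> real \<Rightarrow> complex) \<Rightarrow> (real \<Rightarrow> complex) \<Rightarrow> (real \<Rightarrow> complex) \<Rightarrow> complex" where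
  "strip_pairing u a b \<equiv> (LINT p:strip|lborel. u p * (a (fst p) * b (snd p)))"

text \<open>The identity holds for the approximating functions and passes to the limit. Integration
  runs parallel to the boundary lines, so no boundary term arises, whatever the trace. The factor
  \<open>c\<close> is merely bounded and Borel so that it can absorb the velocity profile restricted
  to [-1, 1].\<close>

lemma has_trace_ibp_x:
  assumes tr: "has_trace u ux uy g" and u: "square_integrable strip u" and ux: "square_integrable strip ux"
    and a: "\<And>x. (a has_vector_derivative a1 x) (at x)" "continuous_on UNIV a1"
      "square_integrable UNIV a" "square_integrable UNIV a1"
    and c: "c \<in> borel_measurable borel" "\<And>y. cmod (c y) \<le> C"
  shows "strip_pairing ux a c = - strip_pairing u a1 c"
proof -
  obtain \<phi> \<phi>x \<phi>y where \<phi>: "\<And>n::nat. C1_compact UNIV (\<phi> n) (\<phi>x n) (\<phi>y n)"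
    and lim: "L2_tendsto strip \<phi> u sequentially" "L2_tendsto strip \<phi>x ux sequentially"
    using tr unfolding has_trace_def by blast
  note t = square_integrable_tensor[OF a(3) c] square_integrable_tensor[OF a(4) c]
  have "\<forall>\<^sub>F n in sequentially. strip_pairing (\<phi>x n) a c
      + strip_pairing (\<phi> n) a1 c = 0"
    using L2_tendsto_square_integrable[OF lim(1) u] L2_tendsto_square_integrable[OF lim(2) ux]
  proof eventually_elim
    case (elim n)
    note i = square_integrable_set_mult[OF elim(2) t(1)] square_integrable_set_mult[OF elim(1) t(2)]
    have eq: "\<phi>x n (x, y) * (a x * c y) + \<phi> n (x, y) * (a1 x * c y)
        = c y * (\<phi>x n (x, y) * a x + \<phi> n (x, y) * a1 x)" for x y
      by (simp add: algebra_simps)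
    have "strip_pairing (\<phi>x n) a c + strip_pairing (\<phi> n) a1 c
      = (LINT p:strip|lborel. \<phi>x n p * (a (fst p) * c (snd p)) + \<phi> n p * (a1 (fst p) * c (snd p)))"
      using i by simp
    also have "\<dots> = 0"
      using set_integral_add(1)[OF i]
      by (subst strip_integral_snd) (simp_all add: eq C1_compact_ibp_x[OF \<phi> a(1,2)])
    finally show ?case .
  qed
  then have "(\<lambda>n. strip_pairing (\<phi>x n) a c
      + strip_pairing (\<phi> n) a1 c) \<longlonglongrightarrow> 0"
    by (rule tendsto_eventually)
  moreover have "(\<lambda>n. strip_pairing (\<phi>x n) a c
      + strip_pairing (\<phi> n) a1 c) \<longlonglongrightarrow>
      strip_pairing ux a c + strip_pairing u a1 c"
    by (intro tendsto_add L2_tendsto_integral lim u ux t)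
  ultimately have "0 = strip_pairing ux a c + strip_pairing u a1 c"
    by (rule LIMSEQ_unique)
  then show ?thesis by (simp add: eq_neg_iff_add_eq_0)
qed

text \<open>The boundary terms of the approximating functions vanish in the limit because the trace is zero.\<close>

lemma has_trace_ibp_y:
  assumes tr: "has_trace u ux uy (\<lambda>_ _. 0)" and u: "square_integrable strip u" and uy: "square_integrable strip uy"
    and a: "square_integrable UNIV a"
    and b: "\<And>y. (b has_vector_derivative b1 y) (at y)" "continuous_on UNIV b1"
      "\<And>y. cmod (b y) \<le> B" "\<And>y. cmod (b1 y) \<le> B1"
  shows "strip_pairing uy a b = - strip_pairing u a b1"
proof -
  obtain \<phi> \<phi>x \<phi>y where \<phi>: "\<And>n::nat. C1_compact UNIV (\<phi> n) (\<phi>x n) (\<phi>y n)"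
    and lim: "L2_tendsto strip \<phi> u sequentially" "L2_tendsto strip \<phi>y uy sequentially"
    and bd: "\<And>z. z \<in> {-1, 1} \<Longrightarrow> L2_tendsto UNIV (\<lambda>n x. \<phi> n (x, z)) (\<lambda>_. 0) sequentially"
    using tr unfolding has_trace_def by blast
  have b_cont: "continuous_on UNIV b"
    using b(1) by (auto intro!: continuous_at_imp_continuous_on has_vector_derivative_continuous)
  have t: "square_integrable strip (\<lambda>p. a (fst p) * b (snd p))" "square_integrable strip (\<lambda>p. a (fst p) * b1 (snd p))"
    using b b_cont by (intro square_integrable_tensor[OF a] borel_measurable_continuous_onI; blast)+
  have sq0: "square_integrable UNIV (\<lambda>_::real. 0)"
    by (simp add: square_integrable_def set_borel_measurable_def set_integrable_def)
  have bd_int: "(\<lambda>n. \<integral>x. \<phi> n (x, z) * a x \<partial>lborel) \<longlonglongrightarrow> 0" if "z \<in> {-1, 1}" for z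
    using L2_tendsto_integral[OF bd[OF that] sq0 a] by (simp add: set_lebesgue_integral_def)
  have "\<forall>\<^sub>F n in sequentially. strip_pairing (\<phi>y n) a b
      + strip_pairing (\<phi> n) a b1
      = (\<integral>x. \<phi> n (x, 1) * a x \<partial>lborel) * b 1 - (\<integral>x. \<phi> n (x, -1) * a x \<partial>lborel) * b (-1)"
    using L2_tendsto_square_integrable[OF lim(1) u] L2_tendsto_square_integrable[OF lim(2) uy]
      L2_tendsto_square_integrable[OF bd sq0, of 1, simplified] L2_tendsto_square_integrable[OF bd sq0, of "-1", simplified]
  proof eventually_elim
    case (elim n)
    note i = square_integrable_set_mult[OF elim(2) t(1)] square_integrable_set_mult[OF elim(1) t(2)]
    have ib: "integrable lborel (\<lambda>x. \<phi> n (x, 1) * a x)" "integrable lborel (\<lambda>x. \<phi> n (x, -1) * a x)"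
      using square_integrable_set_mult[OF elim(3) a] square_integrable_set_mult[OF elim(4) a]
      by (simp_all add: set_integrable_def)
    have eq: "\<phi>y n (x, y) * (a x * b y) + \<phi> n (x, y) * (a x * b1 y)
        = a x * (\<phi>y n (x, y) * b y + \<phi> n (x, y) * b1 y)" for x y
      by (simp add: algebra_simps)
    have "strip_pairing (\<phi>y n) a b + strip_pairing (\<phi> n) a b1
      = (LINT p:strip|lborel. \<phi>y n p * (a (fst p) * b (snd p)) + \<phi> n p * (a (fst p) * b1 (snd p)))"
      using i by simp
    also have "\<dots> = (\<integral>x. a x * (\<phi> n (x, 1) * b 1 - \<phi> n (x, -1) * b (-1)) \<partial>lborel)"
      using set_integral_add(1)[OF i]
      by (subst strip_integral_fst) (simp_all add: eq C1_compact_ibp_y[OF \<phi> b(1,2)])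
    also have "\<dots> = (\<integral>x. \<phi> n (x, 1) * a x * b 1 - \<phi> n (x, -1) * a x * b (-1) \<partial>lborel)"
      by (simp add: algebra_simps)
    also have "\<dots> = (\<integral>x. \<phi> n (x, 1) * a x \<partial>lborel) * b 1 - (\<integral>x. \<phi> n (x, -1) * a x \<partial>lborel) * b (-1)"
      using ib by simp
    finally show ?case .
  qed
  moreover have "(\<lambda>n. (\<integral>x. \<phi> n (x, 1) * a x \<partial>lborel) * b 1 - (\<integral>x. \<phi> n (x, -1) * a x \<partial>lborel) * b (-1))
     \<longlonglongrightarrow> 0 * b 1 - 0 * b (-1)"
    by (intro tendsto_intros bd_int) auto
  ultimately have "(\<lambda>n. strip_pairing (\<phi>y n) a b
      + strip_pairing (\<phi> n) a b1) \<longlonglongrightarrow> 0"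
    by (simp add: tendsto_cong)
  moreover have "(\<lambda>n. strip_pairing (\<phi>y n) a b
      + strip_pairing (\<phi> n) a b1) \<longlonglongrightarrow>
      strip_pairing uy a b + strip_pairing u a b1"
    by (intro tendsto_add L2_tendsto_integral lim u uy t)
  ultimately have "0 = strip_pairing uy a b + strip_pairing u a b1"
    by (rule LIMSEQ_unique)
  then show ?thesis by (simp add: eq_neg_iff_add_eq_0)
qed

subsection \<open>Cutoffs and separated test functions\<close>

text \<open>The quadratic B-spline transition from \<open>0\<close> on \<open>(-\<infinity>, 0]\<close> to \<open>1\<close> on \<open>[1, \<infinity>)\<close>, and its derivative,
  a tent function.\<close>

definition smoothstep :: "real \<Rightarrow> real" where
  "smoothstep s = (s\<^sup>2 + s * \<bar>s\<bar>) - 2 * ((s - 1/2)\<^sup>2 + (s - 1/2) * \<bar>s - 1/2\<bar>) + ((s - 1)\<^sup>2 + (s - 1) * \<bar>s - 1\<bar>)"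

definition smoothstep' :: "real \<Rightarrow> real" where
  "smoothstep' s = 2 * (s + \<bar>s\<bar>) - 4 * ((s - 1/2) + \<bar>s - 1/2\<bar>) + 2 * ((s - 1) + \<bar>s - 1\<bar>)"

text \<open>At 0 the difference quotient is |h|; elsewhere the function agrees with s^2 or -s^2 on
  an open half line.\<close>

lemma DERIV_mult_abs: "((\<lambda>s. s * \<bar>s\<bar>) has_real_derivative 2 * \<bar>s\<bar>) (at s)"
proof (cases "s = 0")
  case True
  have "((\<lambda>h. \<bar>h::real\<bar>) \<longlongrightarrow> 0) (at 0)" by (intro tendsto_rabs_zero tendsto_ident_at)
  then have "((\<lambda>h::real. (h * \<bar>h\<bar>) / h) \<longlongrightarrow> 0) (at 0)"
    by (rule Lim_transform_eventually) (auto simp: eventually_at_filter)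
  then show ?thesis by (simp add: True DERIV_def)
next
  case False
  have pos: "((\<lambda>s. s * s) has_real_derivative 2 * s) (at s)"
    by (auto intro!: derivative_eq_intros)
  show ?thesis
  proof (cases "s > 0")
    case True
    then show ?thesis
      using has_field_derivative_transform_within_open[OF pos, of "{0<..}" "\<lambda>s. s * \<bar>s\<bar>"] by simp
  next
    case neg: False
    have "((\<lambda>s. - (s * s)) has_real_derivative - (2 * s)) (at s)"
      by (rule DERIV_minus[OF pos])
    then show ?thesis
      using has_field_derivative_transform_within_open[of "\<lambda>s. - (s * s)" "- (2 * s)" s "{..<0}" "\<lambda>s. s * \<bar>s\<bar>"] False neg
      by simp
  qed
qed

lemma DERIV_smoothstep [derivative_intros]:
  assumes "(g has_real_derivative g') (at x)"
  shows "((\<lambda>x. smoothstep (g x)) has_real_derivative smoothstep' (g x) * g') (at x)"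
proof (rule DERIV_chain2[OF _ assms])
  \<comment> \<open>Each block of the spline is twice the square of the positive part of s - c,
    hence continuously differentiable.\<close>
  have *: "((\<lambda>s. (s - c)\<^sup>2 + (s - c) * \<bar>s - c\<bar>) has_real_derivative 2 * ((s - c) + \<bar>s - c\<bar>)) (at s)" for c s :: real
  proof -
    have "((\<lambda>s. (s - c) * \<bar>s - c\<bar>) has_real_derivative 2 * \<bar>s - c\<bar> * (1 - 0)) (at s)"
      by (rule DERIV_chain2[OF DERIV_mult_abs]) (intro derivative_intros)
    moreover have "((\<lambda>s. (s - c)\<^sup>2) has_real_derivative 2 * (s - c)) (at s)"
      by (auto intro!: derivative_eq_intros)
    ultimately show ?thesis
      using DERIV_add[of "\<lambda>s. (s - c)\<^sup>2" "2 * (s - c)" s UNIV "\<lambda>s. (s - c) * \<bar>s - c\<bar>" "2 * \<bar>s - c\<bar>"]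
      by (simp add: distrib_left)
  qed
  show "(smoothstep has_real_derivative smoothstep' (g x)) (at (g x))"
    unfolding smoothstep_def[abs_def] smoothstep'_def
    using DERIV_add[OF DERIV_diff[OF *[of 0 "g x"] DERIV_cmult[OF *[of "1/2" "g x"], of 2]] *[of 1 "g x"]]
    by simp
qed

lemma continuous_on_smoothstep' [continuous_intros]:
  fixes g :: "'a::topological_space \<Rightarrow> real"
  shows "continuous_on S g \<Longrightarrow> continuous_on S (\<lambda>x. smoothstep' (g x))"
  unfolding smoothstep'_def by (intro continuous_intros)

lemma continuous_on_smoothstep [continuous_intros]:
  fixes g :: "'a::topological_space \<Rightarrow> real"
  shows "continuous_on S g \<Longrightarrow> continuous_on S (\<lambda>x. smoothstep (g x))"
  unfolding smoothstep_def power2_eq_square by (intro continuous_intros)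

lemma smoothstep'_bounds: "0 \<le> smoothstep' s" "smoothstep' s \<le> 2"
  unfolding smoothstep'_def by (auto simp: abs_if)

lemma smoothstep_left: "s \<le> 0 \<Longrightarrow> smoothstep s = 0" "s \<le> 0 \<Longrightarrow> smoothstep' s = 0"
  unfolding smoothstep_def smoothstep'_def by (simp_all add: abs_if power2_eq_square algebra_simps)

lemma smoothstep_right: "s \<ge> 1 \<Longrightarrow> smoothstep s = 1" "s \<ge> 1 \<Longrightarrow> smoothstep' s = 0"
  unfolding smoothstep_def smoothstep'_def by (simp_all add: abs_if power2_eq_square algebra_simps)

lemma smoothstep_bounds: "0 \<le> smoothstep s" "smoothstep s \<le> 1"
proof -
  have mono: "smoothstep r \<le> smoothstep s" if "r \<le> s" for r s
  proof (rule DERIV_nonneg_imp_nondecreasing[OF that])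
    fix x
    show "\<exists>y. (smoothstep has_real_derivative y) (at x) \<and> 0 \<le> y"
      using DERIV_smoothstep[OF DERIV_ident, of x] smoothstep'_bounds[of x] by auto
  qed
  show "0 \<le> smoothstep s" using mono[of "min s 0" s] smoothstep_left(1)[of "min s 0"] by simp
  show "smoothstep s \<le> 1" using mono[of s "max s 1"] smoothstep_right(1)[of "max s 1"] by simp
qed

text \<open>For m > 0 this is 1 where |z| is at most r - 2/m and 0 where |z| is at least r - 1/m.
  One formula serves both directions: m = 1 with r growing for the unbounded variable x, and r = 1
  with m growing for y.\<close>

definition strip_cutoff :: "real \<Rightarrow> real \<Rightarrow> real \<Rightarrow> real" where
  "strip_cutoff m r z = smoothstep (m * (r - z) - 1) * smoothstep (m * (r + z) - 1)"

definition strip_cutoff' :: "real \<Rightarrow> real \<Rightarrow> real \<Rightarrow> real" where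
  "strip_cutoff' m r z = m * (smoothstep (m * (r - z) - 1) * smoothstep' (m * (r + z) - 1)
     - smoothstep' (m * (r - z) - 1) * smoothstep (m * (r + z) - 1))"

lemma strip_cutoff_has_derivative:
  "(strip_cutoff m r has_real_derivative strip_cutoff' m r z) (at z)"
  unfolding strip_cutoff_def[abs_def] strip_cutoff'_def
  by (rule derivative_eq_intros refl)+ (simp add: algebra_simps)

lemma continuous_on_strip_cutoff: "continuous_on S (strip_cutoff m r)" "continuous_on S (strip_cutoff' m r)"
  unfolding strip_cutoff_def[abs_def] strip_cutoff'_def[abs_def] by (intro continuous_intros)+

lemma abs_strip_cutoff_le: "\<bar>strip_cutoff m r z\<bar> \<le> 1"
  unfolding strip_cutoff_def abs_mult
  using smoothstep_bounds by (intro mult_le_one) auto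

lemma strip_cutoff_outside:
  assumes "m > 0" and "r - 1 / m < \<bar>z\<bar>"
  shows "strip_cutoff m r z = 0"
proof -
  have "m * (r - \<bar>z\<bar>) < m * (1 / m)"
    using assms by (intro mult_strict_left_mono) auto
  then have "m * (r - \<bar>z\<bar>) - 1 \<le> 0" using assms by simp
  then have "smoothstep (m * (r - \<bar>z\<bar>) - 1) = 0" by (rule smoothstep_left(1))
  then show ?thesis by (cases "z \<ge> 0") (auto simp: strip_cutoff_def)
qed

lemma strip_cutoff_inside:
  assumes "2 \<le> m * (r - \<bar>z\<bar>)" and "m > 0"
  shows "strip_cutoff m r z = 1" and "strip_cutoff' m r z = 0"
proof -
  have "m * (r - \<bar>z\<bar>) \<le> m * (r - z)" "m * (r - \<bar>z\<bar>) \<le> m * (r + z)"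
    using assms by (auto intro!: mult_left_mono)
  then have "1 \<le> m * (r - z) - 1" "1 \<le> m * (r + z) - 1" using assms by linarith+
  then show "strip_cutoff m r z = 1" "strip_cutoff' m r z = 0"
    by (simp_all add: strip_cutoff_def strip_cutoff'_def smoothstep_right)
qed

lemma abs_strip_cutoff'_le:
  assumes "m > 0"
  shows "\<bar>strip_cutoff' m r z\<bar> \<le> 2 * m"
proof -
  let ?a = "smoothstep (m * (r - z) - 1)" and ?b = "smoothstep (m * (r + z) - 1)"
  let ?a' = "smoothstep' (m * (r - z) - 1)" and ?b' = "smoothstep' (m * (r + z) - 1)"
  have "0 \<le> ?a * ?b'" "?a * ?b' \<le> 1 * 2" "0 \<le> ?a' * ?b" "?a' * ?b \<le> 2 * 1"
    by (intro mult_nonneg_nonneg mult_mono smoothstep_bounds smoothstep'_bounds; simp)+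
  then have "\<bar>?a * ?b' - ?a' * ?b\<bar> \<le> 2" by linarith
  then show ?thesis
    unfolding strip_cutoff'_def abs_mult using assms by simp
qed

text \<open>The cutoff has slope of order \<open>m\<close>, but only at distance at most \<open>2 / m\<close> from \<open>\<bar>z\<bar> = r\<close>, where a
  Lipschitz function vanishing at \<open>\<bar>z\<bar> = r\<close> is of order \<open>1 / m\<close>.\<close>

lemma strip_cutoff'_mult_bound:
  assumes "m > 0" and "\<bar>z\<bar> < r" and b: "cmod w \<le> L * (r - \<bar>z\<bar>)" and "L \<ge> 0"
  shows "\<bar>strip_cutoff' m r z\<bar> * cmod w \<le> 4 * L"
proof (cases "2 \<le> m * (r - \<bar>z\<bar>)")
  case True
  then show ?thesis using strip_cutoff_inside(2) assms by simp
next
  case False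
  have "\<bar>strip_cutoff' m r z\<bar> * cmod w \<le> (2 * m) * (L * (r - \<bar>z\<bar>))"
    using assms abs_strip_cutoff'_le by (intro mult_mono) auto
  also have "\<dots> = 2 * L * (m * (r - \<bar>z\<bar>))" by simp
  also have "\<dots> \<le> 2 * L * 2" using False \<open>L \<ge> 0\<close> by (intro mult_left_mono) auto
  finally show ?thesis by simp
qed

text \<open>The function is Lipschitz with constant \<open>L\<close>, and 1 - |y| is the distance to
  the nearer end point, where it vanishes.\<close>

lemma has_vector_derivative_zero_boundary_bound:
  fixes b :: "real \<Rightarrow> complex"
  assumes b: "\<And>y. (b has_vector_derivative b1 y) (at y)" and b1: "\<And>y. cmod (b1 y) \<le> L"
    and zero: "b (-1) = 0" "b 1 = 0" and y: "\<bar>y\<bar> < 1"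
  shows "cmod (b y) \<le> L * (1 - \<bar>y\<bar>)"
proof -
  have lip: "norm (b y - b z) \<le> L * norm (y - z)" for z
  proof (rule differentiable_bound[where S=UNIV and f'="\<lambda>x h. h *\<^sub>R b1 x"])
    show "(b has_derivative (\<lambda>h. h *\<^sub>R b1 x)) (at x within UNIV)" for x
      using b[of x] by (simp add: has_vector_derivative_def)
    show "onorm (\<lambda>h. h *\<^sub>R b1 x) \<le> L" for x
      by (rule onorm_le) (use b1 in \<open>auto simp: mult.commute[of L] intro: mult_left_mono\<close>)
  qed auto
  show ?thesis
    using lip[of 1] lip[of "-1"] zero y by (cases "y \<ge> 0") (auto simp: abs_if add.commute)
qed

text \<open>The cutoff in y vanishes already at distance 1/m from the boundary, and the one in x at
  |x| = r - 1, so the support lies in a compact rectangle inside the open strip. Vanishing at the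
  boundary alone would not achieve this.\<close>

lemma C1_compact_cutoff:
  assumes a: "\<And>x. (a has_vector_derivative a1 x) (at x)" "continuous_on UNIV a1"
    and b: "\<And>y. (b has_vector_derivative b1 y) (at y)" "continuous_on UNIV b1"
    and "m > 0"
  shows "C1_compact strip (\<lambda>p. (of_real (strip_cutoff 1 r (fst p)) * a (fst p)) * (of_real (strip_cutoff m 1 (snd p)) * b (snd p)))
    (\<lambda>p. (of_real (strip_cutoff' 1 r (fst p)) * a (fst p) + of_real (strip_cutoff 1 r (fst p)) * a1 (fst p))
       * (of_real (strip_cutoff m 1 (snd p)) * b (snd p)))
    (\<lambda>p. (of_real (strip_cutoff 1 r (fst p)) * a (fst p))
       * (of_real (strip_cutoff' m 1 (snd p)) * b (snd p) + of_real (strip_cutoff m 1 (snd p)) * b1 (snd p)))"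
  unfolding C1_compact_def
proof (intro conjI allI)
  have cut: "((\<lambda>z. complex_of_real (strip_cutoff m r z)) has_vector_derivative of_real (strip_cutoff' m r z)) (at z)" for m r z
    using has_vector_derivative_of_real[OF strip_cutoff_has_derivative] .
  have d: "((\<lambda>z. of_real (strip_cutoff m r z) * g z) has_vector_derivative
      of_real (strip_cutoff' m r z) * g z + of_real (strip_cutoff m r z) * g' z) (at z)"
    if "\<And>z. (g has_vector_derivative g' z) (at z)" for m r z and g g' :: "real \<Rightarrow> complex"
    using has_vector_derivative_mult[OF cut that] by (simp add: add.commute)
  fix x y :: real
  show "((\<lambda>z. (of_real (strip_cutoff 1 r (fst (z, y))) * a (fst (z, y))) * (of_real (strip_cutoff m 1 (snd (z, y))) * b (snd (z, y))))
    has_vector_derivative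
      (of_real (strip_cutoff' 1 r (fst (x, y))) * a (fst (x, y)) + of_real (strip_cutoff 1 r (fst (x, y))) * a1 (fst (x, y)))
       * (of_real (strip_cutoff m 1 (snd (x, y))) * b (snd (x, y)))) (at x)"
    using has_vector_derivative_mult_left[OF d[OF a(1)]] by simp
  show "((\<lambda>z. (of_real (strip_cutoff 1 r (fst (x, z))) * a (fst (x, z))) * (of_real (strip_cutoff m 1 (snd (x, z))) * b (snd (x, z))))
    has_vector_derivative
      (of_real (strip_cutoff 1 r (fst (x, y))) * a (fst (x, y)))
       * (of_real (strip_cutoff' m 1 (snd (x, y))) * b (snd (x, y)) + of_real (strip_cutoff m 1 (snd (x, y))) * b1 (snd (x, y)))) (at y)"
    using has_vector_derivative_mult_right[OF d[OF b(1)]] by simp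
next
  have ca: "continuous_on UNIV a" "continuous_on UNIV b"
    using a b by (auto intro!: continuous_at_imp_continuous_on has_vector_derivative_continuous)
  have f: "continuous_on UNIV (\<lambda>p::real \<times> real. g (fst p))" and s: "continuous_on UNIV (\<lambda>p::real \<times> real. g (snd p))"
    if "continuous_on UNIV g" for g :: "real \<Rightarrow> 'c::topological_space"
    using that by (auto intro!: continuous_on_compose2[OF that] continuous_intros)
  note cont = f[OF ca(1)] f[OF a(2)] s[OF ca(2)] s[OF b(2)] f[OF continuous_on_strip_cutoff(1)]
    f[OF continuous_on_strip_cutoff(2)] s[OF continuous_on_strip_cutoff(1)] s[OF continuous_on_strip_cutoff(2)]
  show "continuous_on UNIV (\<lambda>p. (of_real (strip_cutoff' 1 r (fst p)) * a (fst p) + of_real (strip_cutoff 1 r (fst p)) * a1 (fst p))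
       * (of_real (strip_cutoff m 1 (snd p)) * b (snd p)))"
    by (intro continuous_on_add continuous_on_mult continuous_on_of_real cont)
  show "continuous_on UNIV (\<lambda>p. (of_real (strip_cutoff 1 r (fst p)) * a (fst p))
       * (of_real (strip_cutoff' m 1 (snd p)) * b (snd p) + of_real (strip_cutoff m 1 (snd p)) * b1 (snd p)))"
    by (intro continuous_on_add continuous_on_mult continuous_on_of_real cont)
  show "\<exists>K. compact K \<and> K \<subseteq> strip \<and> (\<forall>p. p \<notin> K \<longrightarrow> (of_real (strip_cutoff 1 r (fst p)) * a (fst p)) * (of_real (strip_cutoff m 1 (snd p)) * b (snd p)) = 0)"
  proof (intro exI[of _ "{-(r - 1)..r - 1} \<times> {-(1 - 1 / m)..1 - 1 / m}"] conjI allI impI)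
    show "compact ({-(r - 1)..r - 1} \<times> {-(1 - 1 / m)..1 - 1 / m})" by (intro compact_Times compact_Icc)
    show "{-(r - 1)..r - 1} \<times> {-(1 - 1 / m)..1 - 1 / m} \<subseteq> strip"
    proof -
      have "1 / m > 0" using \<open>m > 0\<close> by simp
      have "{-(1 - 1 / m)..1 - 1 / m} \<subseteq> {-1<..<1}"
      proof
        fix z assume "z \<in> {-(1 - 1 / m)..1 - 1 / m}"
        then have "-(1 - 1 / m) \<le> z" "z \<le> 1 - 1 / m" by (simp_all only: atLeastAtMost_iff)
        with \<open>1 / m > 0\<close> have "-1 < z" "z < 1" by linarith+
        then show "z \<in> {-1<..<1}" by simp
      qed
      then show ?thesis unfolding strip_def by (intro Sigma_mono subset_UNIV)
    qed
    fix p :: "real \<times> real" assume "p \<notin> {-(r - 1)..r - 1} \<times> {-(1 - 1 / m)..1 - 1 / m}"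
    then have "r - 1 / 1 < \<bar>fst p\<bar> \<or> 1 - 1 / m < \<bar>snd p\<bar>"
      by (cases p) (auto simp: abs_if)
    then show "(of_real (strip_cutoff 1 r (fst p)) * a (fst p)) * (of_real (strip_cutoff m 1 (snd p)) * b (snd p)) = 0"
      using strip_cutoff_outside[of 1 r] strip_cutoff_outside[OF \<open>m > 0\<close>, of 1] by auto
  qed
qed


text \<open>Cutoff products are admissible in the weak formulation, and dominated convergence
  removes the cutoffs. The majorant combines the square-integrable gradient with w(x) K. The
  delicate factor is the derivative of the cutoff in y, of order n + 1, which stays bounded after
  multiplication by \<open>b\<close>.\<close>

lemma weak_form_tensor:
  fixes fx fy :: "real \<Rightarrow> real \<times> real \<Rightarrow> complex" and V :: "real \<Rightarrow> real \<Rightarrow> real" and \<nu> \<sigma> :: real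
  assumes weak: "\<And>\<phi> \<phi>x \<phi>y. C1_compact strip \<phi> \<phi>x \<phi>y \<Longrightarrow>
       (LINT p:strip|lborel. u p * \<phi> p) - (LINT p:strip|lborel. u0 p * \<phi> p)
       = - (LINT (s, p):{0..t} \<times> strip|lborel. of_real (V s (snd p)) * fx s p * \<phi> p
             + of_real \<nu> * (of_real \<sigma> * fx s p * \<phi>x p + fy s p * \<phi>y p))"
    and u: "square_integrable strip u" and u0: "square_integrable strip u0"
    and fx: "square_integrable ({0..T} \<times> strip) (\<lambda>(s, p). fx s p)"
    and fy: "square_integrable ({0..T} \<times> strip) (\<lambda>(s, p). fy s p)"
    and t: "t \<in> {0..T}" and V: "continuous_on ({0..T} \<times> {-1..1}) (\<lambda>(t, y). V t y)"
    and a: "\<And>x. (a has_vector_derivative a1 x) (at x)" "continuous_on UNIV a1"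
      "square_integrable UNIV a" "square_integrable UNIV a1"
    and b: "\<And>y. (b has_vector_derivative b1 y) (at y)" "continuous_on UNIV b1"
      "\<And>y. cmod (b y) \<le> B" "\<And>y. cmod (b1 y) \<le> B1" "b (-1) = 0" "b 1 = 0"
  defines "I \<equiv> (\<lambda>(s, p). of_real (V s (snd p)) * fx s p * (a (fst p) * b (snd p))
       + of_real \<nu> * (of_real \<sigma> * fx s p * (a1 (fst p) * b (snd p)) + fy s p * (a (fst p) * b1 (snd p))))"
  shows "set_integrable lborel ({0..t} \<times> strip) I"
    and "strip_pairing u a b - strip_pairing u0 a b
       = - (LINT q:{0..t} \<times> strip|lborel. I q)"
proof -
  let ?D = "{0..t} \<times> strip"
  define c c' where "c n x = complex_of_real (strip_cutoff 1 (real n) x)" and "c' n x = complex_of_real (strip_cutoff' 1 (real n) x)" for n x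
  \<comment> \<open>\<open>Suc\<close> keeps the scale positive for n = 0, as the cutoff estimates
    require.\<close>
  define e e' where "e n y = complex_of_real (strip_cutoff (real (Suc n)) 1 y)" and "e' n y = complex_of_real (strip_cutoff' (real (Suc n)) 1 y)" for n y
  define A A1 where "A n x = c n x * a x" and "A1 n x = c' n x * a x + c n x * a1 x" for n x
  define Bn Bn1 where "Bn n y = e n y * b y" and "Bn1 n y = e' n y * b y + e n y * b1 y" for n y
  \<comment> \<open>In \<open>w\<close> the factor 2 is the slope bound of the cutoff at scale 1. In
    the constant \<open>K\<close> below, 4 \<open>B1\<close> bounds the slope of the y-cutoff times
    \<open>b\<close>, one further \<open>B1\<close> bounds the cutoff times \<open>b1\<close>, and
    |B| bounds the cutoff times \<open>b\<close>.\<close>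
  define w where "w x = 2 * cmod (a x) + cmod (a1 x)" for x
  define K where "K = \<bar>B\<bar> + 5 * B1"
  have "0 \<le> B1" using b(4)[of 0] norm_ge_zero order_trans by blast
  have "\<bar>B\<bar> \<ge> cmod (b y)" for y using b(3)[of y] by linarith
  have "continuous_on UNIV a" "continuous_on UNIV b"
    using a b by (auto intro!: continuous_at_imp_continuous_on has_vector_derivative_continuous)
  note cont = this a(2) b(2)
  have [measurable]: "a \<in> borel_measurable borel" "a1 \<in> borel_measurable borel"
      "b \<in> borel_measurable borel" "b1 \<in> borel_measurable borel"
    using cont by (auto intro: borel_measurable_continuous_onI)
  have cm: "(\<lambda>x. complex_of_real (strip_cutoff m r x)) \<in> borel_measurable borel"
    "(\<lambda>x. complex_of_real (strip_cutoff' m r x)) \<in> borel_measurable borel" for m r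
    by (intro borel_measurable_continuous_onI continuous_on_of_real continuous_on_strip_cutoff)+
  have [measurable]: "A n \<in> borel_measurable borel" "A1 n \<in> borel_measurable borel"
     "Bn n \<in> borel_measurable borel" "Bn1 n \<in> borel_measurable borel" for n
    using cm unfolding A_def A1_def Bn_def Bn1_def c_def c'_def e_def e'_def by measurable
  have c_le: "cmod (c n x) \<le> 1" "cmod (c' n x) \<le> 2" for n x
    using abs_strip_cutoff_le[of 1 "real n" x] abs_strip_cutoff'_le[of 1 "real n" x] by (simp_all add: c_def c'_def)
  have e_le: "cmod (e n y) \<le> 1" for n y
    using abs_strip_cutoff_le by (simp add: e_def)
  have A_le: "cmod (A n x) \<le> w x" for n x
  proof -
    have "cmod (A n x) \<le> 1 * cmod (a x)"
      unfolding A_def norm_mult by (intro mult_right_mono c_le) simp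
    then show ?thesis unfolding w_def using norm_ge_zero[of "a x"] norm_ge_zero[of "a1 x"] by linarith
  qed
  have A1_le: "cmod (A1 n x) \<le> w x" for n x
  proof -
    have "cmod (A1 n x) \<le> 2 * cmod (a x) + 1 * cmod (a1 x)"
      unfolding A1_def by (intro order_trans[OF norm_triangle_ineq] add_mono; unfold norm_mult; intro mult_right_mono c_le; simp)
    then show ?thesis by (simp add: w_def)
  qed
  have Bn_le: "cmod (Bn n y) \<le> K" for n y
  proof -
    have "cmod (Bn n y) \<le> 1 * \<bar>B\<bar>"
      unfolding Bn_def norm_mult by (intro mult_mono e_le \<open>cmod (b y) \<le> \<bar>B\<bar>\<close>) auto
    then show ?thesis using \<open>0 \<le> B1\<close> by (simp add: K_def)
  qed
  have Bn1_le: "cmod (Bn1 n y) \<le> K" if "\<bar>y\<bar> < 1" for n y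
  proof -
    have "\<bar>strip_cutoff' (real (Suc n)) 1 y\<bar> * cmod (b y) \<le> 4 * B1"
      by (rule strip_cutoff'_mult_bound[OF _ that has_vector_derivative_zero_boundary_bound[OF b(1,4,5,6) that] \<open>0 \<le> B1\<close>]) simp
    then have 1: "cmod (e' n y * b y) \<le> 4 * B1"
      by (simp add: e'_def norm_mult del: of_nat_Suc)
    have "cmod (e n y * b1 y) \<le> 1 * B1"
      unfolding norm_mult by (intro mult_mono e_le b(4)) auto
    then have "cmod (Bn1 n y) \<le> 5 * B1"
      using 1 norm_triangle_ineq[of "e' n y * b y" "e n y * b1 y"] unfolding Bn1_def by linarith
    then show ?thesis by (simp add: K_def)
  qed
  have A_lim: "(\<lambda>n. A n x) \<longlonglongrightarrow> a x" "(\<lambda>n. A1 n x) \<longlonglongrightarrow> a1 x" for x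
  proof -
    have ev: "\<forall>\<^sub>F n in sequentially. c n x = 1 \<and> c' n x = 0"
      using eventually_ge_at_top[of "nat \<lceil>\<bar>x\<bar> + 2\<rceil>"]
    proof eventually_elim
      case (elim n)
      then have "\<bar>x\<bar> + 2 \<le> real n" by (simp only: nat_le_iff ceiling_le_iff of_int_of_nat_eq)
      then have "2 \<le> 1 * (real n - \<bar>x\<bar>)" by simp
      then show ?case using strip_cutoff_inside[of 1 "real n" x] by (simp add: c_def c'_def)
    qed
    show "(\<lambda>n. A n x) \<longlonglongrightarrow> a x" "(\<lambda>n. A1 n x) \<longlonglongrightarrow> a1 x"
      using ev unfolding A_def A1_def by (auto intro!: tendsto_eventually elim: eventually_mono)
  qed
  have B_lim: "(\<lambda>n. Bn n y) \<longlonglongrightarrow> b y" "(\<lambda>n. Bn1 n y) \<longlonglongrightarrow> b1 y" if "\<bar>y\<bar> < 1" for y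
  proof -
    have ev: "\<forall>\<^sub>F n in sequentially. e n y = 1 \<and> e' n y = 0"
      using eventually_ge_at_top[of "nat \<lceil>2 / (1 - \<bar>y\<bar>)\<rceil>"]
    proof eventually_elim
      case (elim n)
      then have "2 / (1 - \<bar>y\<bar>) \<le> real n" by (simp only: nat_le_iff ceiling_le_iff of_int_of_nat_eq)
      then have "2 / (1 - \<bar>y\<bar>) \<le> real (Suc n)" by simp
      then have "2 \<le> real (Suc n) * (1 - \<bar>y\<bar>)" using that by (simp add: pos_divide_le_eq)
      then show ?case using strip_cutoff_inside[of "real (Suc n)" 1 y] by (simp add: e_def e'_def)
    qed
    show "(\<lambda>n. Bn n y) \<longlonglongrightarrow> b y" "(\<lambda>n. Bn1 n y) \<longlonglongrightarrow> b1 y"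
      using ev unfolding Bn_def Bn1_def by (auto intro!: tendsto_eventually elim: eventually_mono)
  qed
  have w_sq: "square_integrable UNIV (\<lambda>x. complex_of_real (w x))"
  proof (rule square_integrableI)
    show "(\<lambda>x. indicator UNIV x *\<^sub>R complex_of_real (w x)) \<in> borel_measurable borel"
      unfolding w_def by measurable
    show "set_integrable lborel UNIV (\<lambda>x. 8 * (cmod (a x))\<^sup>2 + 2 * (cmod (a1 x))\<^sup>2)"
      using a(3,4) by (auto simp: square_integrable_def)
    show "(cmod (complex_of_real (w x)))\<^sup>2 \<le> 8 * (cmod (a x))\<^sup>2 + 2 * (cmod (a1 x))\<^sup>2" for x
      using sum_squares_bound[of "2 * cmod (a x)" "cmod (a1 x)"]
      unfolding norm_of_real power2_abs w_def by (simp add: power2_sum power_mult_distrib)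
  qed
  have w_nonneg: "0 \<le> w x" for x by (simp add: w_def)
  have K_nonneg: "0 \<le> K" using Bn_le[of 0 0] norm_ge_zero order_trans by blast
  have lim_u: "(\<lambda>n. LINT p:strip|lborel. g p * (A n (fst p) * Bn n (snd p))) \<longlonglongrightarrow>
      strip_pairing g a b" if g: "square_integrable strip g" for g
    unfolding set_lebesgue_integral_def
  proof (rule integral_dominated_convergence)
    have [measurable]: "(\<lambda>p. indicator strip p *\<^sub>R g p) \<in> borel_measurable borel"
      using g by (rule square_integrable_measurable)
    have "(\<lambda>p. (indicator strip p *\<^sub>R g p) * (a (fst p) * b (snd p))) \<in> borel_measurable borel"
      "(\<lambda>p. (indicator strip p *\<^sub>R g p) * (A n (fst p) * Bn n (snd p))) \<in> borel_measurable borel" for n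
      by measurable
    then show "(\<lambda>p. indicator strip p *\<^sub>R (g p * (a (fst p) * b (snd p)))) \<in> borel_measurable lborel"
      "(\<lambda>p. indicator strip p *\<^sub>R (g p * (A n (fst p) * Bn n (snd p)))) \<in> borel_measurable lborel" for n
      by simp_all
    have "square_integrable strip (\<lambda>p. complex_of_real (w (fst p)) * complex_of_real K)"
      using w_sq by (rule square_integrable_tensor) auto
    from square_integrable_set_mult[OF g this]
    show "integrable lborel (\<lambda>p. norm (indicator strip p *\<^sub>R (g p * (complex_of_real (w (fst p)) * complex_of_real K))))"
      unfolding set_integrable_def by (rule integrable_norm)
    show "AE p in lborel. norm (indicator strip p *\<^sub>R (g p * (A n (fst p) * Bn n (snd p))))
      \<le> norm (indicator strip p *\<^sub>R (g p * (complex_of_real (w (fst p)) * complex_of_real K)))" for n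
      unfolding norm_scaleR norm_mult norm_of_real abs_of_nonneg[OF w_nonneg] abs_of_nonneg[OF K_nonneg]
      by (intro AE_I2 mult_left_mono mult_mono A_le Bn_le) (auto simp: w_nonneg)
    show "AE p in lborel. (\<lambda>n. indicator strip p *\<^sub>R (g p * (A n (fst p) * Bn n (snd p))))
       \<longlonglongrightarrow> indicator strip p *\<^sub>R (g p * (a (fst p) * b (snd p)))"
    proof (intro AE_I2)
      fix p :: "real \<times> real"
      show "(\<lambda>n. indicator strip p *\<^sub>R (g p * (A n (fst p) * Bn n (snd p))))
       \<longlonglongrightarrow> indicator strip p *\<^sub>R (g p * (a (fst p) * b (snd p)))"
      proof (cases "p \<in> strip")
        case True
        then have "\<bar>snd p\<bar> < 1" by (auto simp: strip_def)
        then show ?thesis by (intro tendsto_intros A_lim B_lim)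
      qed simp
    qed
  qed
  define In where "In n = (\<lambda>(s, p). of_real (V s (snd p)) * fx s p * (A n (fst p) * Bn n (snd p))
       + of_real \<nu> * (of_real \<sigma> * fx s p * (A1 n (fst p) * Bn n (snd p)) + fy s p * (A n (fst p) * Bn1 n (snd p))))" for n
  have weak_n: "strip_pairing u (A n) (Bn n) - strip_pairing u0 (A n) (Bn n)
       = - (LINT q:?D|lborel. In n q)" for n
    unfolding In_def A_def A1_def Bn_def Bn1_def c_def c'_def e_def e'_def
    by (rule weak[OF C1_compact_cutoff[OF a(1,2) b(1,2)]]) simp
  have D_meas: "?D \<in> sets borel" by (simp add: borel_Times)
  have D_sub: "?D \<subseteq> {0..T} \<times> strip" using t by auto
  have fx_meas: "(\<lambda>q. indicator ?D q *\<^sub>R fx (fst q) (snd q)) \<in> borel_measurable borel"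
    and fy_meas: "(\<lambda>q. indicator ?D q *\<^sub>R fy (fst q) (snd q)) \<in> borel_measurable borel"
  proof -
    have "(\<lambda>q. indicator ?D q *\<^sub>R g (fst q) (snd q)) \<in> borel_measurable borel"
      if "square_integrable ({0..T} \<times> strip) (\<lambda>(s, p). g s p)" for g :: "real \<Rightarrow> real \<times> real \<Rightarrow> complex"
    proof -
      have "(\<lambda>q. indicator ?D q *\<^sub>R (indicator ({0..T} \<times> strip) q *\<^sub>R (\<lambda>(s, p). g s p) q)) \<in> borel_measurable borel"
        using square_integrable_measurable[OF that] D_meas by measurable
      also have "(\<lambda>q. indicator ?D q *\<^sub>R (indicator ({0..T} \<times> strip) q *\<^sub>R (\<lambda>(s, p). g s p) q))
          = (\<lambda>q. indicator ?D q *\<^sub>R g (fst q) (snd q))"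
      proof
        fix q
        show "indicat_real ?D q *\<^sub>R (indicat_real ({0..T} \<times> strip) q *\<^sub>R (\<lambda>(s, p). g s p) q) = indicat_real ?D q *\<^sub>R g (fst q) (snd q)"
          using subsetD[OF D_sub, of q] by (cases "q \<in> ?D") (simp_all add: case_prod_beta')
      qed
      finally show ?thesis .
    qed
    then show "(\<lambda>q. indicator ?D q *\<^sub>R fx (fst q) (snd q)) \<in> borel_measurable borel"
       "(\<lambda>q. indicator ?D q *\<^sub>R fy (fst q) (snd q)) \<in> borel_measurable borel"
      using fx fy by blast+
  qed
  have V_meas: "(\<lambda>q. indicator ?D q *\<^sub>R complex_of_real (V (fst q) (snd (snd q)))) \<in> borel_measurable borel"
  proof (rule borel_measurable_continuous_on_indicator[OF D_meas])
    have "continuous_on ?D (\<lambda>q. (\<lambda>(t, y). V t y) (fst q, snd (snd q)))"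
      by (rule continuous_on_compose2[OF V]) (use t in \<open>auto simp: strip_def intro!: continuous_intros\<close>)
    then show "continuous_on ?D (\<lambda>q. complex_of_real (V (fst q) (snd (snd q))))"
      by (intro continuous_on_of_real) simp
  qed
  have meas: "(\<lambda>q. indicator ?D q *\<^sub>R (of_real (V (fst q) (snd (snd q))) * fx (fst q) (snd q) * (\<alpha> (fst (snd q)) * \<beta> (snd (snd q)))
       + of_real \<nu> * (of_real \<sigma> * fx (fst q) (snd q) * (\<alpha>1 (fst (snd q)) * \<beta> (snd (snd q)))
          + fy (fst q) (snd q) * (\<alpha> (fst (snd q)) * \<beta>1 (snd (snd q)))))) \<in> borel_measurable borel"
    if [measurable]: "\<alpha> \<in> borel_measurable borel" "\<alpha>1 \<in> borel_measurable borel"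
      "\<beta> \<in> borel_measurable borel" "\<beta>1 \<in> borel_measurable borel" for \<alpha> \<alpha>1 \<beta> \<beta>1 :: "real \<Rightarrow> complex"
  proof -
    define fX where "fX q = indicator ?D q *\<^sub>R fx (fst q) (snd q)" for q
    define fY where "fY q = indicator ?D q *\<^sub>R fy (fst q) (snd q)" for q
    define W where "W q = indicator ?D q *\<^sub>R complex_of_real (V (fst q) (snd (snd q)))" for q
    have [measurable]: "fX \<in> borel_measurable borel" "fY \<in> borel_measurable borel" "W \<in> borel_measurable borel"
      using fx_meas fy_meas V_meas by (simp_all add: fX_def[abs_def] fY_def[abs_def] W_def[abs_def])
    have "(\<lambda>q. W q * fX q * (\<alpha> (fst (snd q)) * \<beta> (snd (snd q)))
       + of_real \<nu> * (of_real \<sigma> * fX q * (\<alpha>1 (fst (snd q)) * \<beta> (snd (snd q)))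
          + fY q * (\<alpha> (fst (snd q)) * \<beta>1 (snd (snd q))))) \<in> borel_measurable borel"
      by measurable
    then show ?thesis
      by (rule measurable_cong[THEN iffD1, rotated]) (simp add: fX_def fY_def W_def indicator_def)
  qed
  obtain M where M: "M \<ge> 0" "\<And>s y. s \<in> {0..T} \<Longrightarrow> y \<in> {-1..1} \<Longrightarrow> \<bar>V s y\<bar> \<le> M"
    using continuous_bounded_on_rectangle[OF compact_Icc V] by blast
  define N where "N = \<bar>M\<bar> + \<bar>\<nu>\<bar> * \<bar>\<sigma>\<bar> + \<bar>\<nu>\<bar>"
  define Dm where "Dm q = N * (cmod (fx (fst q) (snd q)) * (w (fst (snd q)) * K) + cmod (fy (fst q) (snd q)) * (w (fst (snd q)) * K))" for q
  have In_le: "norm (In n q) \<le> Dm q" if "q \<in> ?D" for n q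
  proof -
    obtain s x y where q: "q = (s, x, y)" by (cases q) auto
    have y: "\<bar>y\<bar> < 1" and s: "s \<in> {0..T}" using that t by (auto simp: q strip_def)
    have "-1 \<le> y" "y \<le> 1" using y by linarith+
    then have V_le: "\<bar>V s y\<bar> \<le> \<bar>M\<bar>" using M(2)[of s y] s M(1) by simp
    let ?W = "w x * K"
    have AB: "cmod (A n x * Bn n y) \<le> ?W" "cmod (A1 n x * Bn n y) \<le> ?W" "cmod (A n x * Bn1 n y) \<le> ?W"
      unfolding norm_mult by (intro mult_mono A_le A1_le Bn_le Bn1_le y; simp add: w_nonneg)+
    have "0 \<le> ?W" using w_nonneg K_nonneg by simp
    have "norm (In n q) \<le> \<bar>M\<bar> * (cmod (fx s (x, y)) * ?W) + \<bar>\<nu>\<bar> * (\<bar>\<sigma>\<bar> * (cmod (fx s (x, y)) * ?W) + cmod (fy s (x, y)) * ?W)"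
    proof -
      have 1: "cmod (of_real (V s y) * fx s (x, y) * (A n x * Bn n y)) \<le> \<bar>M\<bar> * (cmod (fx s (x, y)) * ?W)"
        unfolding norm_mult[of _ "A n x * Bn n y"] norm_mult[of "of_real _"] norm_of_real mult.assoc
        by (intro mult_mono V_le AB mult_left_mono mult_nonneg_nonneg) (auto simp: \<open>0 \<le> ?W\<close>)
      have 2: "cmod (of_real \<sigma> * fx s (x, y) * (A1 n x * Bn n y)) \<le> \<bar>\<sigma>\<bar> * (cmod (fx s (x, y)) * ?W)"
        unfolding norm_mult[of _ "A1 n x * Bn n y"] norm_mult[of "of_real _"] norm_of_real mult.assoc
        by (intro mult_left_mono AB) auto
      have 3: "cmod (fy s (x, y) * (A n x * Bn1 n y)) \<le> cmod (fy s (x, y)) * ?W"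
        unfolding norm_mult[of _ "A n x * Bn1 n y"] by (intro mult_left_mono AB) auto
      have "cmod (of_real \<nu> * (of_real \<sigma> * fx s (x, y) * (A1 n x * Bn n y) + fy s (x, y) * (A n x * Bn1 n y)))
         \<le> \<bar>\<nu>\<bar> * (\<bar>\<sigma>\<bar> * (cmod (fx s (x, y)) * ?W) + cmod (fy s (x, y)) * ?W)"
        unfolding norm_mult[of "of_real \<nu>"] norm_of_real
        by (intro mult_left_mono order_trans[OF norm_triangle_ineq add_mono[OF 2 3]]) simp
      from order_trans[OF norm_triangle_ineq add_mono[OF 1 this]] show ?thesis
        unfolding In_def q by simp
    qed
    also have "\<dots> = (\<bar>M\<bar> + \<bar>\<nu>\<bar> * \<bar>\<sigma>\<bar>) * (cmod (fx s (x, y)) * ?W) + \<bar>\<nu>\<bar> * (cmod (fy s (x, y)) * ?W)"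
      by (simp add: algebra_simps)
    also have "\<dots> \<le> N * (cmod (fx s (x, y)) * ?W) + N * (cmod (fy s (x, y)) * ?W)"
      unfolding N_def by (rule add_mono[OF mult_right_mono mult_right_mono]) (simp_all add: \<open>0 \<le> ?W\<close>)
    finally show ?thesis by (simp add: Dm_def q distrib_left)
  qed
  have Dm_int: "set_integrable lborel ?D Dm"
  proof -
    \<comment> \<open>The majorant does not depend on time and the time interval is bounded, so it
      is square integrable in space-time and its products with \<open>fx\<close> and
      \<open>fy\<close> are integrable.\<close>
    have "square_integrable ({0..T} \<times> strip) (\<lambda>q. complex_of_real (w (fst (snd q)) * K))"
    proof (rule square_integrableI)
      have [measurable]: "w \<in> borel_measurable borel" unfolding w_def[abs_def] by measurable
      show "(\<lambda>q::real \<times> real \<times> real. indicator ({0..T} \<times> strip) q *\<^sub>R complex_of_real (w (fst (snd q)) * K)) \<in> borel_measurable borel"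
      proof -
        have [measurable]: "{0..T} \<times> strip \<in> sets borel" by (simp add: borel_Times)
        show ?thesis by measurable
      qed
      have "square_integrable strip (\<lambda>p. complex_of_real (w (fst p)) * complex_of_real K)"
        using w_sq by (rule square_integrable_tensor) auto
      then have "integrable lborel (\<lambda>p. indicat_real strip p *\<^sub>R (cmod (complex_of_real (w (fst p)) * complex_of_real K))\<^sup>2)"
        unfolding square_integrable_def set_integrable_def by simp
      then have "integrable lborel (\<lambda>q. indicat_real {0..T} (fst q) * (indicat_real strip (snd q) *\<^sub>R (cmod (complex_of_real (w (fst (snd q))) * complex_of_real K))\<^sup>2))"
        by (intro integrable_tensor integrable_real_indicator) (auto simp: emeasure_lborel_Icc_eq)
      then show "set_integrable lborel ({0..T} \<times> strip) (\<lambda>q. (cmod (complex_of_real (w (fst (snd q))) * complex_of_real K))\<^sup>2)"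
        unfolding set_integrable_def by (simp add: indicator_times mult.assoc)
    qed simp
    note wK = this
    have int: "set_integrable lborel ?D (\<lambda>q. cmod (g (fst q) (snd q)) * (w (fst (snd q)) * K))"
      if "square_integrable ({0..T} \<times> strip) (\<lambda>(s, p). g s p)" for g :: "real \<Rightarrow> real \<times> real \<Rightarrow> complex"
    proof -
      have "set_integrable lborel ({0..T} \<times> strip) (\<lambda>q. (\<lambda>(s, p). g s p) q * complex_of_real (w (fst (snd q)) * K))"
        by (rule square_integrable_set_mult[OF that wK])
      then have "set_integrable lborel ?D (\<lambda>q. (\<lambda>(s, p). g s p) q * complex_of_real (w (fst (snd q)) * K))"
        by (rule set_integrable_subset) (use D_meas D_sub in auto)
      then have "integrable lborel (\<lambda>q. norm (indicator ?D q *\<^sub>R ((\<lambda>(s, p). g s p) q * complex_of_real (w (fst (snd q)) * K))))"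
        unfolding set_integrable_def by (rule integrable_norm)
      then show ?thesis
        unfolding set_integrable_def using w_nonneg K_nonneg by (simp add: case_prod_beta' norm_mult abs_mult)
    qed
    show ?thesis
      unfolding Dm_def by (intro set_integrable_mult_right set_integral_add(1) int fx fy)
  qed
  have pair: "(\<lambda>(s, p). G s p) = (\<lambda>q. G (fst q) (snd q))" for G :: "real \<Rightarrow> real \<times> real \<Rightarrow> complex"
    by (simp add: case_prod_beta')
  have I_meas: "(\<lambda>q. indicator ?D q *\<^sub>R I q) \<in> borel_measurable lborel"
    unfolding I_def pair using meas[of a a1 b b1] by simp
  have In_meas: "(\<lambda>q. indicator ?D q *\<^sub>R In n q) \<in> borel_measurable lborel" for n
    unfolding In_def pair using meas[of "A n" "A1 n" "Bn n" "Bn1 n"] by simp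
  have In_lim: "AE q in lborel. (\<lambda>n. indicator ?D q *\<^sub>R In n q) \<longlonglongrightarrow> indicator ?D q *\<^sub>R I q"
  proof (intro AE_I2)
    fix q :: "real \<times> real \<times> real"
    show "(\<lambda>n. indicator ?D q *\<^sub>R In n q) \<longlonglongrightarrow> indicator ?D q *\<^sub>R I q"
    proof (cases "q \<in> ?D")
      case True
      then have "\<bar>snd (snd q)\<bar> < 1" by (auto simp: strip_def)
      then show ?thesis
        unfolding In_def I_def pair by (intro tendsto_intros A_lim B_lim)
    qed simp
  qed
  have Dm': "integrable lborel (\<lambda>q. indicator ?D q *\<^sub>R Dm q)"
    using Dm_int by (simp add: set_integrable_def)
  have In_bound: "AE q in lborel. norm (indicator ?D q *\<^sub>R In n q) \<le> indicator ?D q *\<^sub>R Dm q" for n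
    using In_le by (intro AE_I2) (auto simp: indicator_def)
  note dc = I_meas In_meas Dm' In_lim In_bound
  show "set_integrable lborel ?D I"
    unfolding set_integrable_def by (rule integrable_dominated_convergence[OF dc])
  have "(\<lambda>n. LINT q:?D|lborel. In n q) \<longlonglongrightarrow> (LINT q:?D|lborel. I q)"
    unfolding set_lebesgue_integral_def by (rule integral_dominated_convergence[OF dc])
  then have "(\<lambda>n. - (LINT q:?D|lborel. In n q)) \<longlonglongrightarrow> - (LINT q:?D|lborel. I q)"
    by (rule tendsto_minus)
  moreover have "(\<lambda>n. - (LINT q:?D|lborel. In n q)) \<longlonglongrightarrow>
     strip_pairing u a b - strip_pairing u0 a b"
    unfolding weak_n[symmetric] by (intro tendsto_diff lim_u u u0)
  ultimately show "strip_pairing u a b - strip_pairing u0 a b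
       = - (LINT q:?D|lborel. I q)"
    by (rule LIMSEQ_unique[symmetric])
qed

section \<open>Testing the solution with a sine in y\<close>

lemma sine_mode_has_derivatives:
  "((\<lambda>y. complex_of_real (sine_mode n y)) has_vector_derivative
      of_real (real (Suc n) * pi / 2 * cos (real (Suc n) * (pi * (y + 1) / 2)))) (at y)"
  "((\<lambda>y. complex_of_real (real (Suc n) * pi / 2 * cos (real (Suc n) * (pi * (y + 1) / 2)))) has_vector_derivative
      - of_real ((real (Suc n) * pi / 2)\<^sup>2) * of_real (sine_mode n y)) (at y)"
proof -
  define \<theta> where "\<theta> y = real (Suc n) * (pi * (y + 1) / 2)" for y
  have d\<theta>: "(\<theta> has_real_derivative real (Suc n) * pi / 2) (at y)"
    unfolding \<theta>_def[abs_def] by (auto intro!: derivative_eq_intros)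
  have "(sine_mode n has_real_derivative real (Suc n) * pi / 2 * cos (real (Suc n) * (pi * (y + 1) / 2))) (at y)"
    using DERIV_chain2[OF DERIV_sin d\<theta>] unfolding sine_mode_def[abs_def] \<theta>_def[symmetric]
    by (simp only: mult.commute)
  from has_vector_derivative_of_real[OF this]
  show "((\<lambda>y. complex_of_real (sine_mode n y)) has_vector_derivative
      of_real (real (Suc n) * pi / 2 * cos (real (Suc n) * (pi * (y + 1) / 2)))) (at y)" .
  have "((\<lambda>y. real (Suc n) * pi / 2 * cos (real (Suc n) * (pi * (y + 1) / 2))) has_real_derivative
     - (real (Suc n) * pi / 2)\<^sup>2 * sine_mode n y) (at y)"
    using DERIV_cmult[OF DERIV_chain2[OF DERIV_cos d\<theta>], of "real (Suc n) * pi / 2"]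
    unfolding sine_mode_def[abs_def] \<theta>_def[symmetric]
    by (simp add: power2_eq_square mult_ac)
  from has_vector_derivative_of_real[OF this]
  show "((\<lambda>y. complex_of_real (real (Suc n) * pi / 2 * cos (real (Suc n) * (pi * (y + 1) / 2)))) has_vector_derivative
      - of_real ((real (Suc n) * pi / 2)\<^sup>2) * of_real (sine_mode n y)) (at y)"
    by (simp only: of_real_mult of_real_minus)
qed

text \<open>The velocity is controlled on [-1, 1] only; the indicator makes its product with the
  mode a bounded Borel function on the whole line, the form in which factors in y are
  handled.\<close>

definition slice_mult :: "(real \<Rightarrow> real \<Rightarrow> real) \<Rightarrow> real \<Rightarrow> nat \<Rightarrow> real \<Rightarrow> complex" where
  "slice_mult V s n y = indicator {-1..1} y *\<^sub>R of_real (V s y) * of_real (sine_mode n y)"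

lemma slice_mult:
  assumes V: "continuous_on ({0..T} \<times> {-1..1}) (\<lambda>(t, y). V t y)"
    and M: "\<And>s y. s \<in> {0..T} \<Longrightarrow> y \<in> {-1..1} \<Longrightarrow> \<bar>V s y\<bar> \<le> M" and "0 \<le> M" and s: "s \<in> {0..T}"
  shows "slice_mult V s n \<in> borel_measurable borel" and "cmod (slice_mult V s n y) \<le> M"
proof -
  have [measurable]: "(\<lambda>y. indicator {-1..1} y *\<^sub>R complex_of_real (V s y)) \<in> borel_measurable borel"
    using set_borel_measurable_continuous_slice[OF V s] by (simp add: set_borel_measurable_def)
  show "slice_mult V s n \<in> borel_measurable borel"
    unfolding slice_mult_def[abs_def] by measurable
  show "cmod (slice_mult V s n y) \<le> M"
  proof (cases "y \<in> {-1..1}")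
    case True
    then have "\<bar>V s y\<bar> * \<bar>sine_mode n y\<bar> \<le> M * 1"
      by (intro mult_mono M s abs_sine_mode_le \<open>0 \<le> M\<close>) auto
    then show ?thesis using True by (simp add: slice_mult_def norm_mult)
  qed (simp add: slice_mult_def \<open>0 \<le> M\<close>)
qed

lemma set_integral_AE_cong_left:
  assumes "square_integrable A f" and "square_integrable A g" and "square_integrable A h"
    and "AE x in lborel. x \<in> A \<longrightarrow> f x = g x"
  shows "(LINT x:A|lborel. f x * h x) = (LINT x:A|lborel. g x * h x)"
  unfolding set_lebesgue_integral_def
proof (rule integral_cong_AE)
  show "(\<lambda>x. indicator A x *\<^sub>R (f x * h x)) \<in> borel_measurable lborel"
    "(\<lambda>x. indicator A x *\<^sub>R (g x * h x)) \<in> borel_measurable lborel"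
    using square_integrable_set_mult[OF assms(1,3)] square_integrable_set_mult[OF assms(2,3)]
    unfolding set_integrable_def by (auto dest: borel_measurable_integrable)
  show "AE x in lborel. indicator A x *\<^sub>R (f x * h x) = indicator A x *\<^sub>R (g x * h x)"
    using assms(4) by eventually_elim (auto simp: indicator_def)
qed

text \<open>All derivatives are moved from the solution to the test function, so that only f(s)
  itself is paired with separated functions; this is the form that a Fourier transform in x can
  handle. The formula for \<open>g\<close> holds for almost every time, because f(s) is known to
  have a gradient and zero trace only for almost every s.\<close>

lemma solution_tensor:
  assumes sol: "is_solution \<sigma> \<nu> T V f\<^sub>0 f" and f0: "f\<^sub>0 \<in> H10"
    and V: "continuous_on ({0..T} \<times> {-1..1}) (\<lambda>(t, y). V t y)"
    and a: "\<And>x. (a has_vector_derivative a1 x) (at x)" "\<And>x. (a1 has_vector_derivative a2 x) (at x)"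
      "continuous_on UNIV a2" "square_integrable UNIV a" "square_integrable UNIV a1" "square_integrable UNIV a2"
    and t: "t \<in> {0..T}"
  obtains g where "set_integrable lborel {0..t} g"
    and "AE s in lborel. s \<in> {0..t} \<longrightarrow> g s =
       - strip_pairing (f s) a1 (slice_mult V s n)
       - of_real (\<nu> * \<sigma>) * strip_pairing (f s) a2 (\<lambda>y. of_real (sine_mode n y))
       + of_real (\<nu> * (real (Suc n) * pi / 2)\<^sup>2) * strip_pairing (f s) a (\<lambda>y. of_real (sine_mode n y))"
    and "strip_pairing (f t) a (\<lambda>y. of_real (sine_mode n y))
       - strip_pairing (f 0) a (\<lambda>y. of_real (sine_mode n y)) = - (LINT s:{0..t}|lborel. g s)"
proof -
  obtain fx fy where f_cont: "L2_continuous_on {0..T} strip f"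
    and init: "AE p in lborel. p \<in> strip \<longrightarrow> f 0 p = f\<^sub>0 p"
    and fx: "square_integrable ({0..T} \<times> strip) (\<lambda>(t, p). fx t p)"
    and fy: "square_integrable ({0..T} \<times> strip) (\<lambda>(t, p). fy t p)"
    and H: "AE t in lborel. t \<in> {0..T} \<longrightarrow> H10_grad (f t) (fx t) (fy t)"
    and weak: "\<And>\<phi> \<phi>x \<phi>y t. C1_compact strip \<phi> \<phi>x \<phi>y \<Longrightarrow> t \<in> {0..T} \<Longrightarrow>
              (LINT p:strip|lborel. f t p * \<phi> p) - (LINT p:strip|lborel. f\<^sub>0 p * \<phi> p)
              = - (LINT (s, p):{0..t} \<times> strip|lborel.
                     of_real (V s (snd p)) * fx s p * \<phi> p
                     + of_real \<nu> * (of_real \<sigma> * fx s p * \<phi>x p + fy s p * \<phi>y p))"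
    using sol unfolding is_solution_def by blast
  define b where "b y = complex_of_real (sine_mode n y)" for y
  define b1 where "b1 y = complex_of_real (real (Suc n) * pi / 2 * cos (real (Suc n) * (pi * (y + 1) / 2)))" for y
  define b2 where "b2 y = - of_real ((real (Suc n) * pi / 2)\<^sup>2) * b y" for y
  have db: "(b has_vector_derivative b1 y) (at y)" and db1: "(b1 has_vector_derivative b2 y) (at y)" for y
    using sine_mode_has_derivatives[of n y] unfolding b_def[abs_def] b1_def[abs_def] b2_def by blast+
  have b_le: "cmod (b y) \<le> 1" for y by (simp add: b_def abs_sine_mode_le)
  have b1_le: "cmod (b1 y) \<le> real (Suc n) * pi / 2" for y
    unfolding b1_def norm_of_real abs_mult using mult_left_mono[OF abs_cos_le_one, of "real (Suc n) * pi / 2"]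
    by (simp add: abs_mult)
  have b2_le: "cmod (b2 y) \<le> (real (Suc n) * pi / 2)\<^sup>2 * 1" for y
    unfolding b2_def norm_mult norm_minus_cancel norm_of_real by (intro mult_mono b_le) auto
  have cont: "continuous_on UNIV a" "continuous_on UNIV a1" "continuous_on UNIV b" "continuous_on UNIV b1"
    using a db db1 by (auto intro!: continuous_at_imp_continuous_on has_vector_derivative_continuous)
  then have b2_cont: "continuous_on UNIV b2"
    unfolding b2_def[abs_def] by (intro continuous_intros)
  have b_meas: "b \<in> borel_measurable borel" "b1 \<in> borel_measurable borel"
    using cont by (auto intro: borel_measurable_continuous_onI)
  have bd: "b (-1) = 0" "b 1 = 0" by (simp_all add: b_def sine_mode_boundary)
  obtain M where M: "M \<ge> 0" "\<And>s y. s \<in> {0..T} \<Longrightarrow> y \<in> {-1..1} \<Longrightarrow> \<bar>V s y\<bar> \<le> M"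
    using continuous_bounded_on_rectangle[OF compact_Icc V] by blast
  have f_sq: "square_integrable strip (f s)" if "s \<in> {0..T}" for s
    using f_cont that by (simp add: L2_continuous_on_def)
  have f0_sq: "square_integrable strip f\<^sub>0"
    using f0 by (auto simp: H10_def H10_grad_def H1_def)
  define I where "I = (\<lambda>(s, p). of_real (V s (snd p)) * fx s p * (a (fst p) * b (snd p))
       + of_real \<nu> * (of_real \<sigma> * fx s p * (a1 (fst p) * b (snd p)) + fy s p * (a (fst p) * b1 (snd p))))"
  note wf = weak_form_tensor[OF weak[OF _ t] f_sq[OF t] f0_sq fx fy t V a(1) cont(2) a(4,5) db cont(4) b_le b1_le bd,
      folded I_def]
  have I_int: "integrable lborel (\<lambda>q. indicator ({0..t} \<times> strip) q *\<^sub>R I q)"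
    using wf(1) by (simp add: set_integrable_def)
  define g where "g s = (LINT p:strip|lborel. I (s, p))" for s
  have inner: "(\<integral>p. indicator ({0..t} \<times> strip) (s, p) *\<^sub>R I (s, p) \<partial>lborel) = indicator {0..t} s *\<^sub>R g s" for s
    unfolding g_def set_lebesgue_integral_def indicator_times
    by (simp flip: scaleR_scaleR)
  show thesis
  proof (rule that[of g])
    show "set_integrable lborel {0..t} g"
      using lborel_Fubini(3)[OF I_int] unfolding inner set_integrable_def .
    have "(LINT q:{0..t} \<times> strip|lborel. I q) = (LINT s:{0..t}|lborel. g s)"
      using lborel_Fubini(1)[OF I_int] unfolding inner set_lebesgue_integral_def by simp
    moreover have "strip_pairing f\<^sub>0 a b = strip_pairing (f 0) a b"
    proof (rule set_integral_AE_cong_left[OF f0_sq f_sq square_integrable_tensor[OF a(4) b_meas(1) b_le]])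
      show "AE p in lborel. p \<in> strip \<longrightarrow> f\<^sub>0 p = f 0 p"
        using init by eventually_elim auto
    qed (use t in auto)
    ultimately show "strip_pairing (f t) a (\<lambda>y. of_real (sine_mode n y))
       - strip_pairing (f 0) a (\<lambda>y. of_real (sine_mode n y)) = - (LINT s:{0..t}|lborel. g s)"
      using wf(2) by (simp add: b_def)
    show "AE s in lborel. s \<in> {0..t} \<longrightarrow> g s =
       - strip_pairing (f s) a1 (slice_mult V s n)
       - of_real (\<nu> * \<sigma>) * strip_pairing (f s) a2 (\<lambda>y. of_real (sine_mode n y))
       + of_real (\<nu> * (real (Suc n) * pi / 2)\<^sup>2) * strip_pairing (f s) a (\<lambda>y. of_real (sine_mode n y))"
      using H
    proof eventually_elim
      case (elim s)
      show ?case
      proof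
        assume "s \<in> {0..t}"
        then have s: "s \<in> {0..T}" using t by auto
        let ?c = "slice_mult V s n"
        note c = slice_mult[OF V M(2,1) s, of n]
        have sq: "square_integrable strip (f s)" "square_integrable strip (fx s)" "square_integrable strip (fy s)"
          and tr: "has_trace (f s) (fx s) (fy s) (\<lambda>_ _. 0)"
          using elim s unfolding H10_grad_def H1_def by auto
        note i1 = square_integrable_set_mult[OF sq(2) square_integrable_tensor[OF a(4) c]]
        note i2 = square_integrable_set_mult[OF sq(2) square_integrable_tensor[OF a(5) b_meas(1) b_le]]
        note i3 = square_integrable_set_mult[OF sq(3) square_integrable_tensor[OF a(4) b_meas(2) b1_le]]
        have "g s = (LINT p:strip|lborel. fx s p * (a (fst p) * ?c (snd p))
            + (of_real (\<nu> * \<sigma>) * (fx s p * (a1 (fst p) * b (snd p))) + of_real \<nu> * (fy s p * (a (fst p) * b1 (snd p)))))"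
          unfolding g_def I_def
          by (rule set_lebesgue_integral_cong, use strip_borel in simp)
             (auto simp: strip_def slice_mult_def b_def[symmetric] algebra_simps)
        also have "\<dots> = strip_pairing (fx s) a ?c
            + (of_real (\<nu> * \<sigma>) * strip_pairing (fx s) a1 b
             + of_real \<nu> * strip_pairing (fy s) a b1)"
          using i1 i2 i3 by (simp only: set_integral_add set_integral_mult_right set_integrable_mult_right)
        also have "strip_pairing (fx s) a ?c = - strip_pairing (f s) a1 ?c"
          by (rule has_trace_ibp_x[OF tr sq(1,2) a(1) cont(2) a(4,5) c])
        also have "strip_pairing (fx s) a1 b = - strip_pairing (f s) a2 b"
          by (rule has_trace_ibp_x[OF tr sq(1,2) a(2,3) a(5,6) b_meas(1) b_le])
        \<comment> \<open>The factor here is the cosine \<open>b1\<close>, which does not vanish at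
          the boundary: the boundary terms disappear because of the zero trace of f. Its derivative
          \<open>b2\<close> is minus the eigenvalue times \<open>b\<close>.\<close>
        also have "strip_pairing (fy s) a b1 = - strip_pairing (f s) a b2"
          by (rule has_trace_ibp_y[OF tr sq(1,3) a(4) db1 b2_cont b1_le b2_le])
        also have "strip_pairing (f s) a b2
            = - of_real ((real (Suc n) * pi / 2)\<^sup>2) * strip_pairing (f s) a b"
          unfolding set_integral_mult_right[symmetric] b2_def by (simp add: mult_ac)
        finally show "g s = - strip_pairing (f s) a1 ?c
         - of_real (\<nu> * \<sigma>) * strip_pairing (f s) a2 (\<lambda>y. of_real (sine_mode n y))
         + of_real (\<nu> * (real (Suc n) * pi / 2)\<^sup>2) * strip_pairing (f s) a (\<lambda>y. of_real (sine_mode n y))"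
          unfolding b_def[symmetric] by (simp add: mult.assoc)
      qed
    qed
  qed
qed

subsection \<open>Fourier transform of the tested equation\<close>

lemma lborel_Fubini_snd:
  fixes f :: "'a::euclidean_space \<times> 'b::euclidean_space \<Rightarrow> 'c::{banach, second_countable_topology}"
  assumes "integrable lborel f"
  shows "integrable lborel (\<lambda>y. \<integral>x. f (x, y) \<partial>lborel)"
proof -
  have "integrable (lborel \<Otimes>\<^sub>M lborel) f" using assms by (simp add: lborel_prod)
  then have "integrable lborel (\<lambda>(y, x). f (x, y))"
    using lborel_pair.integrable_product_swap[of f] by (simp add: lborel_prod)
  from lborel_Fubini(3)[OF this] show ?thesis by simp
qed

lemma borel_measurable_integral_snd:
  fixes f :: "'a::euclidean_space \<times> 'b::euclidean_space \<Rightarrow> 'c::{banach, second_countable_topology}"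
  assumes "f \<in> borel_measurable borel"
  shows "(\<lambda>x. \<integral>y. f (x, y) \<partial>lborel) \<in> borel_measurable borel"
proof -
  have "f \<in> borel_measurable (lborel \<Otimes>\<^sub>M lborel)" using assms by (simp add: lborel_prod)
  then have "(\<lambda>x. \<integral>y. f (x, y) \<partial>lborel) \<in> borel_measurable lborel"
    by (intro lborel.borel_measurable_lebesgue_integral) simp
  then show ?thesis by simp
qed

lemma is_fourier_x_joint_measurable:
  assumes "is_fourier_x T f F" and "t \<in> {0..T}"
  shows "(\<lambda>p. indicator {-1..1} (snd p) *\<^sub>R F (fst p) t (snd p)) \<in> borel_measurable borel"
proof -
  have "(\<lambda>p. indicator (UNIV \<times> {-1..1::real}) p *\<^sub>R (\<lambda>(k, y). F k t y) p) \<in> borel_measurable borel"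
    using assms by (auto simp: is_fourier_x_def set_borel_measurable_def)
  also have "(\<lambda>p. indicator (UNIV \<times> {-1..1::real}) p *\<^sub>R (\<lambda>(k, y). F k t y) p)
      = (\<lambda>p. indicator {-1..1} (snd p) *\<^sub>R F (fst p) t (snd p))"
    by (auto simp: indicator_def)
  finally show ?thesis .
qed

lemma is_fourier_x_measurable:
  assumes "is_fourier_x T f F" and "t \<in> {0..T}" and c: "c \<in> borel_measurable borel"
  shows "(\<lambda>k. LINT y:{-1..1}|lborel. F k t y * c y) \<in> borel_measurable borel"
    and "(\<lambda>k. L2_norm {-1..1} (F k t)) \<in> borel_measurable borel"
proof -
  define G where "G p = indicator {-1..1} (snd p) *\<^sub>R F (fst p) t (snd p)" for p
  have [measurable]: "G \<in> borel_measurable borel"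
    unfolding G_def[abs_def] by (rule is_fourier_x_joint_measurable[OF assms(1,2)])
  note c[measurable]
  have "(\<lambda>p. G p * c (snd p)) \<in> borel_measurable borel" by measurable
  from borel_measurable_integral_snd[OF this]
  show "(\<lambda>k. LINT y:{-1..1}|lborel. F k t y * c y) \<in> borel_measurable borel"
    by (simp add: G_def set_lebesgue_integral_def)
  have "(\<lambda>p. (cmod (G p))\<^sup>2) \<in> borel_measurable borel" by measurable
  from borel_measurable_integral_snd[OF this]
  have "(\<lambda>k. \<integral>y. (cmod (G (k, y)))\<^sup>2 \<partial>lborel) \<in> borel_measurable borel" .
  also have "(\<lambda>k. \<integral>y. (cmod (G (k, y)))\<^sup>2 \<partial>lborel) = (\<lambda>k. LINT y:{-1..1}|lborel. (cmod (F k t y))\<^sup>2)"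
    unfolding set_lebesgue_integral_def
    by (intro ext Bochner_Integration.integral_cong) (auto simp: G_def indicator_def)
  finally show "(\<lambda>k. L2_norm {-1..1} (F k t)) \<in> borel_measurable borel"
    unfolding L2_norm_def by measurable
qed

text \<open>The multiplication formula is applied on almost every line y = const and integrated in
  y. The bound \<open>M\<close> on the support of \<open>h\<close> makes h(k) F(k, t, y) c(y)
  integrable in (k, y), which justifies changing the order of integration.\<close>

lemma fourier_strip:
  assumes F: "is_fourier_x T f F" and t: "t \<in> {0..T}" and f: "square_integrable strip (f t)"
    and h: "bounded_compact_support h" and c: "c \<in> borel_measurable borel" "\<And>y. cmod (c y) \<le> C"
    and M: "\<And>k. h k \<noteq> 0 \<Longrightarrow> square_integrable {-1..1} (F k t) \<and> L2_norm {-1..1} (F k t) \<le> M"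
  shows "integrable lborel (\<lambda>k. h k * (LINT y:{-1..1}|lborel. F k t y * c y))"
    and "strip_pairing (f t) (fourier_integral h) c
      = (\<integral>k. h k * (LINT y:{-1..1}|lborel. F k t y * c y) \<partial>lborel)"
proof -
  let ?I = "{-1..1::real}"
  note h_int = bounded_compact_support_integrable[OF h]
  have [measurable]: "h \<in> borel_measurable borel" "c \<in> borel_measurable borel"
    using h_int c by auto
  have c_sq: "square_integrable ?I c"
    using c by (intro square_integrable_bounded) auto
  define G where "G p = indicator ?I (snd p) *\<^sub>R F (fst p) t (snd p)" for p
  have [measurable]: "G \<in> borel_measurable borel"
    unfolding G_def[abs_def] by (rule is_fourier_x_joint_measurable[OF F t])
  define H where "H p = G p * h (fst p) * c (snd p)" for p
  have H_meas [measurable]: "H \<in> borel_measurable borel"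
    unfolding H_def[abs_def] by measurable
  have H_eq: "H (k, y) = h k * (indicator ?I y *\<^sub>R (F k t y * c y))" for k y
    by (simp add: H_def G_def mult_ac)
  have slice: "integrable lborel (\<lambda>y. H (k, y))" for k
  proof (cases "h k = 0")
    case False
    then show ?thesis
      using M[OF False] square_integrable_set_mult[OF _ c_sq, of "F k t"]
      unfolding H_eq set_integrable_def by (intro integrable_mult_right) auto
  qed (simp add: H_eq)
  have slice_le: "(\<integral>y. norm (H (k, y)) \<partial>lborel) \<le> norm (h k * of_real (\<bar>M\<bar> * L2_norm ?I c))" for k
  proof (cases "h k = 0")
    case False
    \<comment> \<open>Absolute integrability in y is required, not just a bound for the integral, so
      Cauchy-Schwarz is applied to the moduli of both factors.\<close>
    have n: "square_integrable ?I (\<lambda>y. complex_of_real (cmod (g y)))" "L2_norm ?I (\<lambda>y. complex_of_real (cmod (g y))) = L2_norm ?I g"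
      if g: "square_integrable ?I g" for g
    proof -
      have [measurable]: "(\<lambda>y. indicator ?I y *\<^sub>R g y) \<in> borel_measurable borel"
        using g by (rule square_integrable_measurable)
      have "(\<lambda>y. complex_of_real (cmod (indicator ?I y *\<^sub>R g y))) \<in> borel_measurable borel"
        by measurable
      then have "(\<lambda>y. indicator ?I y *\<^sub>R complex_of_real (cmod (g y))) \<in> borel_measurable borel"
        by (rule measurable_cong[THEN iffD1, rotated]) (simp add: indicator_def)
      then show "square_integrable ?I (\<lambda>y. complex_of_real (cmod (g y)))"
        using g by (simp add: square_integrable_def set_borel_measurable_def)
      show "L2_norm ?I (\<lambda>y. complex_of_real (cmod (g y))) = L2_norm ?I g"
        by (simp add: L2_norm_def)
    qed
    have Fsq: "square_integrable ?I (F k t)" "L2_norm ?I (F k t) \<le> M" using M[OF False] by auto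
    have "(\<integral>y. norm (H (k, y)) \<partial>lborel) = cmod (h k) * (LINT y:?I|lborel. cmod (F k t y) * cmod (c y))"
    proof -
      have "norm (H (k, y)) = cmod (h k) * (indicator ?I y *\<^sub>R (cmod (F k t y) * cmod (c y)))" for y
        unfolding H_eq by (simp add: norm_mult)
      then show ?thesis
        unfolding set_lebesgue_integral_def by (simp only: integral_mult_right_zero)
    qed
    also have "(LINT y:?I|lborel. cmod (F k t y) * cmod (c y))
      \<le> cmod (LINT y:?I|lborel. complex_of_real (cmod (F k t y)) * complex_of_real (cmod (c y)))"
      unfolding of_real_mult[symmetric] set_integral_complex_of_real norm_of_real by simp
    also have "\<dots> \<le> L2_norm ?I (F k t) * L2_norm ?I c"
      using L2_Cauchy_Schwarz[OF n(1)[OF Fsq(1)] n(1)[OF c_sq]] by (simp add: n(2)[OF Fsq(1)] n(2)[OF c_sq])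
    also have "\<dots> \<le> \<bar>M\<bar> * L2_norm ?I c"
      using Fsq(2) by (intro mult_right_mono) auto
    finally show ?thesis
      by (simp add: norm_mult abs_mult mult_left_mono)
  qed (simp add: H_eq)
  have "integrable (lborel \<Otimes>\<^sub>M lborel) H"
  proof (rule lborel_pair.Fubini_integrable)
    show "H \<in> borel_measurable (lborel \<Otimes>\<^sub>M lborel)" using H_meas by (simp add: lborel_prod)
    show "integrable lborel (\<lambda>k. \<integral>y. norm (H (k, y)) \<partial>lborel)"
    proof (rule Bochner_Integration.integrable_bound)
      show "integrable lborel (\<lambda>k. h k * of_real (\<bar>M\<bar> * L2_norm ?I c))"
        using h_int by (rule integrable_mult_left)
      show "(\<lambda>k. \<integral>y. norm (H (k, y)) \<partial>lborel) \<in> borel_measurable lborel"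
        using borel_measurable_integral_snd[of "\<lambda>p. norm (H p)"] by simp
    qed (use slice_le in \<open>auto intro!: AE_I2 simp: integral_nonneg\<close>)
  qed (use slice in simp)
  then have H_int: "integrable lborel H" by (simp add: lborel_prod)
  have inner_k: "(\<integral>y. H (k, y) \<partial>lborel) = h k * (LINT y:?I|lborel. F k t y * c y)" for k
    unfolding H_eq set_lebesgue_integral_def by (rule integral_mult_right_zero)
  show "integrable lborel (\<lambda>k. h k * (LINT y:?I|lborel. F k t y * c y))"
    using lborel_Fubini(3)[OF H_int] unfolding inner_k .
  let ?L = "\<lambda>p. indicator strip p *\<^sub>R (f t p * (fourier_integral h (fst p) * c (snd p)))"
  have L_int: "integrable lborel ?L"
    using square_integrable_set_mult[OF f square_integrable_tensor[OF square_integrable_fourier_integral[OF h] c]]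
    by (simp add: set_integrable_def)
  have four: "AE y in lborel. y \<in> ?I \<longrightarrow> is_fourier (\<lambda>x. f t (x, y)) (\<lambda>k. F k t y)"
    using F t unfolding is_fourier_x_def by blast
  have "strip_pairing (f t) (fourier_integral h) c = (\<integral>y. (\<integral>x. ?L (x, y) \<partial>lborel) \<partial>lborel)"
    unfolding set_lebesgue_integral_def by (rule lborel_Fubini(2)[OF L_int, symmetric])
  also have "\<dots> = (\<integral>y. (\<integral>k. H (k, y) \<partial>lborel) \<partial>lborel)"
  proof (rule integral_cong_AE)
    show "(\<lambda>y. \<integral>x. ?L (x, y) \<partial>lborel) \<in> borel_measurable lborel"
      "(\<lambda>y. \<integral>k. H (k, y) \<partial>lborel) \<in> borel_measurable lborel"
      using lborel_Fubini_snd[OF L_int] lborel_Fubini_snd[OF H_int] by (auto dest: borel_measurable_integrable)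
    \<comment> \<open>The end points are discarded because the strip is open, while \<open>F\<close>
      is considered on the closed interval.\<close>
    show "AE y in lborel. (\<integral>x. ?L (x, y) \<partial>lborel) = (\<integral>k. H (k, y) \<partial>lborel)"
      using four AE_lborel_singleton[of "-1::real"] AE_lborel_singleton[of "1::real"]
    proof eventually_elim
      case (elim y)
      show ?case
      proof (cases "y \<in> ?I")
        case True
        then have y: "y \<in> {-1<..<1}" using elim by auto
        have "(\<integral>x. ?L (x, y) \<partial>lborel) = (\<integral>x. c y * (f t (x, y) * fourier_integral h x) \<partial>lborel)"
          using y by (simp add: indicator_strip mult_ac)
        also have "\<dots> = c y * (\<integral>k. F k t y * h k \<partial>lborel)"
          using is_fourier_multiplication_formula[OF _ h] elim(1) True by simp
        also have "\<dots> = (\<integral>k. c y * (F k t y * h k) \<partial>lborel)"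
          by simp
        also have "\<dots> = (\<integral>k. H (k, y) \<partial>lborel)"
          using True by (simp add: H_eq mult_ac)
        finally show ?thesis .
      qed (auto simp: H_eq indicator_strip)
    qed
  qed
  also have "\<dots> = (\<integral>k. (\<integral>y. H (k, y) \<partial>lborel) \<partial>lborel)"
    using lborel_Fubini(1,2)[OF H_int] by simp
  finally show "strip_pairing (f t) (fourier_integral h) c
      = (\<integral>k. h k * (LINT y:?I|lborel. F k t y * c y) \<partial>lborel)"
    unfolding inner_k .
qed

section \<open>Sampling at grid times and joint measurability\<close>

text \<open>The largest multiple of 1/(m + 1) not above s. Approximation from below stays in [0, T]
  even for s = T, and all grid points together form a countable set.\<close>

definition grid_point :: "nat \<Rightarrow> real \<Rightarrow> real" where
  "grid_point m s = of_int \<lfloor>s * real (Suc m)\<rfloor> / real (Suc m)"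

lemma grid_point_bounds: "0 \<le> s \<Longrightarrow> 0 \<le> grid_point m s" "grid_point m s \<le> s" "s - 1 / real (Suc m) \<le> grid_point m s"
proof -
  have *: "of_int \<lfloor>s * real (Suc m)\<rfloor> \<le> s * real (Suc m)" "s * real (Suc m) - 1 \<le> of_int \<lfloor>s * real (Suc m)\<rfloor>"
    by linarith+
  show "grid_point m s \<le> s"
    unfolding grid_point_def using *(1) by (subst pos_divide_le_eq) auto
  show "s - 1 / real (Suc m) \<le> grid_point m s"
  proof -
    have "s - 1 / real (Suc m) = (s * real (Suc m) - 1) / real (Suc m)"
      by (simp add: diff_divide_distrib del: of_nat_Suc)
    then show ?thesis
      unfolding grid_point_def using *(2) by (simp only: divide_right_mono of_nat_0_le_iff)
  qed
  show "0 \<le> grid_point m s" if "0 \<le> s"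
    unfolding grid_point_def using that by (intro divide_nonneg_nonneg) auto
qed

lemma grid_point_tendsto: "(\<lambda>m. grid_point m s) \<longlonglongrightarrow> s"
proof (rule tendsto_sandwich)
  have "(\<lambda>m. s - 1 / real (Suc m)) \<longlonglongrightarrow> s - 0"
    by (intro tendsto_intros LIMSEQ_Suc[OF lim_const_over_n])
  then show "(\<lambda>m. s - 1 / real (Suc m)) \<longlonglongrightarrow> s" by simp
qed (use grid_point_bounds in auto)

text \<open>A function measurable in k and continuous in s is the limit of its samples at grid
  times, and each sample is glued from countably many measurable functions of k, selected by the
  integer part of s (m + 1).\<close>

lemma borel_measurable_Caratheodory:
  fixes G :: "real \<Rightarrow> real \<Rightarrow> complex"
  assumes meas: "\<And>s. s \<in> {0..T} \<Longrightarrow> (\<lambda>k. indicator A k *\<^sub>R G k s) \<in> borel_measurable borel"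
    and cont: "\<And>k. k \<in> A \<Longrightarrow> continuous_on {0..T} (G k)"
  shows "(\<lambda>p. indicator {0..T} (snd p) *\<^sub>R (indicator A (fst p) *\<^sub>R G (fst p) (snd p))) \<in> borel_measurable borel"
proof (rule borel_measurable_LIMSEQ_metric)
  \<comment> \<open>The index is an integer rather than a time, so that the gluing is countable.
    Outside [0, T] nothing is assumed about \<open>G\<close>, and the sample is set to 0.\<close>
  define P where "P m i p = (if of_int i / real (Suc m) \<in> {0..T} then indicator A (fst p) *\<^sub>R G (fst p) (of_int i / real (Suc m)) else 0)"
    for m i and p :: "real \<times> real"
  have P_meas: "P m i \<in> borel_measurable borel" for m i
  proof (cases "of_int i / real (Suc m) \<in> {0..T}")
    case True
    then show ?thesis
      unfolding P_def[abs_def] if_P[OF True] by (intro borel_measurable_fst_comp meas)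
  next
    case False
    then show ?thesis
      unfolding P_def[abs_def] if_not_P[OF False] by simp
  qed
  have "(\<lambda>p. P m \<lfloor>snd p * real (Suc m)\<rfloor> p) \<in> borel_measurable (borel :: (real \<times> real) measure)" for m
  proof (rule measurable_compose_countable[OF P_meas])
    show "(\<lambda>p. \<lfloor>snd p * real (Suc m)\<rfloor>) \<in> measurable (borel :: (real \<times> real) measure) (count_space UNIV)"
      by measurable
  qed
  then show "(\<lambda>p. indicator {0..T} (snd p) *\<^sub>R P m \<lfloor>snd p * real (Suc m)\<rfloor> p) \<in> borel_measurable borel" for m
    by measurable
  fix p :: "real \<times> real"
  show "(\<lambda>m. indicator {0..T} (snd p) *\<^sub>R P m \<lfloor>snd p * real (Suc m)\<rfloor> p)
      \<longlonglongrightarrow> indicator {0..T} (snd p) *\<^sub>R (indicator A (fst p) *\<^sub>R G (fst p) (snd p))"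
  proof (cases "snd p \<in> {0..T} \<and> fst p \<in> A")
    case True
    then have mem: "grid_point m (snd p) \<in> {0..T}" for m
      using True grid_point_bounds(1)[of "snd p" m] grid_point_bounds(2)[of m "snd p"] by auto
    have "(\<lambda>m. G (fst p) (grid_point m (snd p))) \<longlonglongrightarrow> G (fst p) (snd p)"
      by (rule continuous_on_tendsto_compose[OF cont grid_point_tendsto]) (use True mem in auto)
    moreover have "P m \<lfloor>snd p * real (Suc m)\<rfloor> p = G (fst p) (grid_point m (snd p))" for m
      using mem[of m] True by (simp add: P_def grid_point_def del: of_nat_Suc)
    ultimately show ?thesis using True by simp
  next
    case False
    moreover have "P m i p = 0" if "fst p \<notin> A" for m i using that by (simp add: P_def)
    ultimately show ?thesis by (cases "fst p \<in> A") simp_all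
  qed
qed

subsection \<open>The equation of a single Fourier mode\<close>

locale fourier_modes =
  fixes \<sigma> \<nu> T :: real and V :: "real \<Rightarrow> real \<Rightarrow> real" and f\<^sub>0 :: "real \<times> real \<Rightarrow> complex"
    and f :: "real \<Rightarrow> real \<times> real \<Rightarrow> complex" and F :: "real \<Rightarrow> real \<Rightarrow> real \<Rightarrow> complex"
  assumes solution: "is_solution \<sigma> \<nu> T V f\<^sub>0 f" and initial: "f\<^sub>0 \<in> H10"
    and V_cont: "continuous_on ({0..T} \<times> {-1..1}) (\<lambda>(t, y). V t y)"
    and fourier: "is_fourier_x T f F" and T_pos: "T > 0"
begin

definition mode_rate :: "nat \<Rightarrow> real \<Rightarrow> real" where
  "mode_rate n k = \<nu> * (\<sigma> * k\<^sup>2 + (real (Suc n) * pi / 2)\<^sup>2)"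

definition mode_force :: "nat \<Rightarrow> real \<Rightarrow> real \<Rightarrow> complex" where
  "mode_force n k s = \<i> * of_real k * sine_coeff n (\<lambda>y. of_real (V s y) * F k s y)
     + of_real (mode_rate n k) * sine_coeff n (F k s)"

text \<open>The integrated form of the equation for the n-th coefficient: it makes sense without
  differentiability in time and can be tested in k at a fixed t.\<close>

definition mode_defect :: "nat \<Rightarrow> real \<Rightarrow> real \<Rightarrow> complex" where
  "mode_defect n t k = sine_coeff n (F k t) - sine_coeff n (F k 0) + (LINT s:{0..t}|lborel. mode_force n k s)"

lemma continuous_on_mode_force:
  assumes "L2_continuous_on {0..T} {-1..1} (F k)"
  shows "continuous_on {0..T} (mode_force n k)"
  unfolding mode_force_def[abs_def]
  by (intro continuous_intros continuous_on_sine_coeff L2_continuous_on_mult V_cont compact_Icc assms)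

lemma sine_coeff_V:
  "sine_coeff n (\<lambda>y. of_real (V s y) * F k s y) = (LINT y:{-1..1}|lborel. F k s y * slice_mult V s n y)"
  unfolding sine_coeff_def
  by (rule set_lebesgue_integral_cong) (auto simp: slice_mult_def)

lemma mode_force_measurable:
  assumes "s \<in> {0..T}"
  shows "(\<lambda>k. mode_force n k s) \<in> borel_measurable borel"
proof -
  obtain M where M: "M \<ge> 0" "\<And>s y. s \<in> {0..T} \<Longrightarrow> y \<in> {-1..1} \<Longrightarrow> \<bar>V s y\<bar> \<le> M"
    using continuous_bounded_on_rectangle[OF compact_Icc V_cont] by blast
  have [measurable]: "(\<lambda>k. sine_coeff n (F k s)) \<in> borel_measurable borel"
    unfolding sine_coeff_def by (rule is_fourier_x_measurable(1)[OF fourier assms]) measurable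
  have [measurable]: "(\<lambda>k. sine_coeff n (\<lambda>y. of_real (V s y) * F k s y)) \<in> borel_measurable borel"
    unfolding sine_coeff_V
    by (rule is_fourier_x_measurable(1)[OF fourier assms slice_mult(1)[OF V_cont M(2,1) assms]])
  show ?thesis unfolding mode_force_def mode_rate_def by measurable
qed

lemma cmod_sine_coeff_le:
  assumes "square_integrable {-1..1} g"
  shows "cmod (sine_coeff n g) \<le> L2_norm {-1..1} g"
proof (rule power2_le_imp_le)
  have "(cmod (sine_coeff n g))\<^sup>2 \<le> (\<Sum>m<Suc n. (cmod (sine_coeff m g))\<^sup>2)"
    by (rule member_le_sum) auto
  then show "(cmod (sine_coeff n g))\<^sup>2 \<le> (L2_norm {-1..1} g)\<^sup>2"
    using sine_Bessel[OF assms, of "Suc n"] by linarith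
qed simp

text \<open>On \<open>A\<close> both the frequencies and the norms of \<open>F k s\<close> are
  bounded, so all exchanges of integrals are legitimate. With h the indicator of the part of
  \<open>A\<close> inside an arbitrary Borel set, the tested equation says that the defect
  integrates to 0 over that part; hence it vanishes almost everywhere on \<open>A\<close>.\<close>

lemma mode_defect_AE_zero_on:
  assumes A: "A \<in> sets borel" and A_M: "\<And>k. k \<in> A \<Longrightarrow> \<bar>k\<bar> \<le> M"
    and A_cont: "\<And>k. k \<in> A \<Longrightarrow> L2_continuous_on {0..T} {-1..1} (F k)"
    and A_le: "\<And>k s. k \<in> A \<Longrightarrow> s \<in> {0..T} \<Longrightarrow> L2_norm {-1..1} (F k s) \<le> M"
    and t: "t \<in> {0..T}"
  shows "AE k in lborel. k \<in> A \<longrightarrow> mode_defect n t k = 0"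
proof -
  let ?ev = "(real (Suc n) * pi / 2)\<^sup>2"
  obtain W where W: "W \<ge> 0" "\<And>s y. s \<in> {0..T} \<Longrightarrow> y \<in> {-1..1} \<Longrightarrow> \<bar>V s y\<bar> \<le> W"
    using continuous_bounded_on_rectangle[OF compact_Icc V_cont] by blast
  have F_sq: "square_integrable {-1..1} (F k s)" if "k \<in> A" "s \<in> {0..T}" for k s
    using A_cont[OF that(1)] that(2) by (simp add: L2_continuous_on_def)
  have f_sq: "square_integrable strip (f s)" if "s \<in> {0..T}" for s
    using solution that by (auto simp: is_solution_def L2_continuous_on_def)
  define K where "K = \<bar>M\<bar> * (W * \<bar>M\<bar>) + (\<bar>\<nu>\<bar> * (\<bar>\<sigma>\<bar> * M\<^sup>2 + ?ev)) * \<bar>M\<bar>"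
  have force_le: "cmod (mode_force n k s) \<le> K" if k: "k \<in> A" and s: "s \<in> {0..T}" for k s
  proof -
    have V_meas: "set_borel_measurable lborel {-1..1} (\<lambda>y. complex_of_real (V s y))"
      using V_cont s by (rule set_borel_measurable_continuous_slice)
    have le: "L2_norm {-1..1} (F k s) \<le> \<bar>M\<bar>" using A_le[OF k s] by linarith
    have VF: "square_integrable {-1..1} (\<lambda>y. of_real (V s y) * F k s y)"
      "L2_norm {-1..1} (\<lambda>y. of_real (V s y) * F k s y) \<le> W * L2_norm {-1..1} (F k s)"
      using square_integrable_bounded_mult[OF V_meas _ F_sq[OF k s], of W] W s by auto
    have 1: "cmod (sine_coeff n (\<lambda>y. of_real (V s y) * F k s y)) \<le> W * \<bar>M\<bar>"
      using cmod_sine_coeff_le[OF VF(1)] VF(2) mult_left_mono[OF le W(1)] by (meson order_trans)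
    have 2: "cmod (sine_coeff n (F k s)) \<le> \<bar>M\<bar>"
      using cmod_sine_coeff_le[OF F_sq[OF k s]] le by (meson order_trans)
    have "k\<^sup>2 \<le> M\<^sup>2" using A_M[OF k] by (intro abs_le_square_iff[THEN iffD1]) linarith
    then have "\<bar>\<sigma> * k\<^sup>2 + ?ev\<bar> \<le> \<bar>\<sigma>\<bar> * M\<^sup>2 + ?ev"
      by (intro order_trans[OF abs_triangle_ineq] add_mono) (auto simp: abs_mult mult_left_mono)
    then have 3: "\<bar>mode_rate n k\<bar> \<le> \<bar>\<nu>\<bar> * (\<bar>\<sigma>\<bar> * M\<^sup>2 + ?ev)"
      unfolding mode_rate_def abs_mult by (rule mult_left_mono) simp
    have "cmod (mode_force n k s) \<le> \<bar>k\<bar> * cmod (sine_coeff n (\<lambda>y. of_real (V s y) * F k s y))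
        + \<bar>mode_rate n k\<bar> * cmod (sine_coeff n (F k s))"
      unfolding mode_force_def by (rule order_trans[OF norm_triangle_ineq]) (simp add: norm_mult)
    also have "\<dots> \<le> K"
      unfolding K_def using A_M[OF k] W(1)
      by (intro add_mono mult_mono 1 2 3) (auto intro: order_trans)
    finally show ?thesis .
  qed
  \<comment> \<open>On this set of finite measure the force is bounded by \<open>K\<close> and
    jointly measurable, so it is integrable in (k, s).\<close>
  define Z where "Z p = indicator {0..T} (snd p) *\<^sub>R (indicator A (fst p) *\<^sub>R mode_force n (fst p) (snd p))" for p
  have A'[measurable]: "A \<in> sets borel" by (rule A)
  have Z_meas: "Z \<in> borel_measurable borel"
    unfolding Z_def[abs_def]
  proof (rule borel_measurable_Caratheodory)
    show "(\<lambda>k. indicator A k *\<^sub>R mode_force n k s) \<in> borel_measurable borel" if "s \<in> {0..T}" for s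
      using mode_force_measurable[OF that] by measurable
  qed (use continuous_on_mode_force[OF A_cont] in blast)
  have "A \<subseteq> {-M..M}"
  proof
    fix k assume "k \<in> A"
    from A_M[OF this] show "k \<in> {-M..M}" by auto
  qed
  then have "emeasure lborel A \<le> emeasure lborel {-M..M}"
    by (intro emeasure_mono) auto
  also have "\<dots> < \<infinity>" by (simp add: emeasure_lborel_Icc_eq)
  finally have A_fin: "emeasure lborel A < \<infinity>" .
  have Z_int: "integrable lborel Z"
  proof (rule Bochner_Integration.integrable_bound)
    show "integrable lborel (\<lambda>p. (K * indicat_real A (fst p)) * indicat_real {0..T} (snd p))"
      using A_fin by (intro integrable_tensor integrable_mult_right integrable_real_indicator)
        (auto simp: emeasure_lborel_Icc_eq A)
    show "AE p in lborel. norm (Z p) \<le> norm ((K * indicat_real A (fst p)) * indicat_real {0..T} (snd p))"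
      using force_le by (intro AE_I2) (auto simp: Z_def indicator_def intro: order_trans[OF _ abs_ge_self])
  qed (use Z_meas in simp)
  have key: "integrable lborel (\<lambda>k. indicator B k *\<^sub>R (indicator A k *\<^sub>R mode_defect n t k))
      \<and> (\<integral>k. indicator B k *\<^sub>R (indicator A k *\<^sub>R mode_defect n t k) \<partial>lborel) = 0"
    if B[measurable]: "B \<in> sets borel" for B
  proof -
    define h where "h k = complex_of_real (indicator (A \<inter> B) k)" for k
    \<comment> \<open>\<open>h1\<close> and \<open>h2\<close> are the densities whose transforms are
      the first and second x-derivatives of the test function
      \<open>fourier_integral h\<close>.\<close>
    define h1 where "h1 k = - \<i> * of_real k * h k" for k
    define h2 where "h2 k = - \<i> * of_real k * h1 k" for k
    have h_bcs: "bounded_compact_support h"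
      unfolding bounded_compact_support_def
    proof (intro conjI exI allI impI)
      show "h \<in> borel_measurable borel" unfolding h_def[abs_def] by measurable
      show "cmod (h k) \<le> 1" for k by (simp add: h_def indicator_def)
      show "h k = 0" if "M < \<bar>k\<bar>" for k using A_M[of k] that by (auto simp: h_def indicator_def)
    qed
    have "bounded_compact_support (\<lambda>k. - \<i> * of_real k * h k)" if "bounded_compact_support h" for h
      using bounded_compact_support_power_mult[OF that, of "-\<i>" 1] by (simp only: power_one_right)
    then have h1_bcs: "bounded_compact_support h1" and h2_bcs: "bounded_compact_support h2"
      using h_bcs unfolding h1_def[abs_def] h2_def[abs_def] by blast+
    note dh = fourier_integral_has_vector_derivative[OF h_bcs, folded h1_def]
      fourier_integral_has_vector_derivative[OF h1_bcs, folded h2_def]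
    obtain g where g_int: "set_integrable lborel {0..t} g"
      and g_AE: "AE s in lborel. s \<in> {0..t} \<longrightarrow> g s =
         - strip_pairing (f s) (fourier_integral h1) (slice_mult V s n)
         - of_real (\<nu> * \<sigma>) * strip_pairing (f s) (fourier_integral h2) (\<lambda>y. of_real (sine_mode n y))
         + of_real (\<nu> * ?ev) * strip_pairing (f s) (fourier_integral h) (\<lambda>y. of_real (sine_mode n y))"
      and g_eq: "strip_pairing (f t) (fourier_integral h) (\<lambda>y. of_real (sine_mode n y))
         - strip_pairing (f 0) (fourier_integral h) (\<lambda>y. of_real (sine_mode n y)) = - (LINT s:{0..t}|lborel. g s)"
      using solution_tensor[OF solution initial V_cont dh fourier_integral_continuous[OF h2_bcs]
          square_integrable_fourier_integral[OF h_bcs] square_integrable_fourier_integral[OF h1_bcs]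
          square_integrable_fourier_integral[OF h2_bcs] t, of n] by blast
    have supp: "k \<in> A" if "h k \<noteq> 0" for k using that by (auto simp: h_def indicator_def split: if_splits)
    have sine_le: "cmod (complex_of_real (sine_mode n y)) \<le> 1" for y by (simp add: abs_sine_mode_le)
    have sine_meas: "(\<lambda>y. complex_of_real (sine_mode n y)) \<in> borel_measurable borel" by measurable
    have bound: "square_integrable {-1..1} (F k s) \<and> L2_norm {-1..1} (F k s) \<le> M" if "h k \<noteq> 0" "s \<in> {0..T}" for k s
      using supp[OF that(1)] F_sq A_le that(2) by blast
    have bound1: "square_integrable {-1..1} (F k s) \<and> L2_norm {-1..1} (F k s) \<le> M" if "h1 k \<noteq> 0" "s \<in> {0..T}" for k s
      using bound[of k s] that by (auto simp: h1_def)
    have bound2: "square_integrable {-1..1} (F k s) \<and> L2_norm {-1..1} (F k s) \<le> M" if "h2 k \<noteq> 0" "s \<in> {0..T}" for k s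
      using bound1[of k s] that by (auto simp: h2_def)
    have S0: "integrable lborel (\<lambda>k. h k * sine_coeff n (F k s))"
      "strip_pairing (f s) (fourier_integral h) (\<lambda>y. of_real (sine_mode n y))
        = (\<integral>k. h k * sine_coeff n (F k s) \<partial>lborel)" if "s \<in> {0..T}" for s
      unfolding sine_coeff_def
      by (intro fourier_strip[OF fourier that f_sq[OF that] h_bcs sine_meas sine_le bound[OF _ that]]; assumption)+
    have S2: "integrable lborel (\<lambda>k. h2 k * sine_coeff n (F k s))"
      "strip_pairing (f s) (fourier_integral h2) (\<lambda>y. of_real (sine_mode n y))
        = (\<integral>k. h2 k * sine_coeff n (F k s) \<partial>lborel)" if "s \<in> {0..T}" for s
      unfolding sine_coeff_def
      by (intro fourier_strip[OF fourier that f_sq[OF that] h2_bcs sine_meas sine_le bound2[OF _ that]]; assumption)+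
    have S1: "integrable lborel (\<lambda>k. h1 k * sine_coeff n (\<lambda>y. of_real (V s y) * F k s y))"
      "strip_pairing (f s) (fourier_integral h1) (slice_mult V s n)
        = (\<integral>k. h1 k * sine_coeff n (\<lambda>y. of_real (V s y) * F k s y) \<partial>lborel)" if "s \<in> {0..T}" for s
      unfolding sine_coeff_V
      by (intro fourier_strip[OF fourier that f_sq[OF that] h1_bcs slice_mult[OF V_cont W(2,1) that] bound1[OF _ that]]; assumption)+
    have g_force: "g s = (\<integral>k. h k * mode_force n k s \<partial>lborel)"
      if s: "s \<in> {0..T}" and gs: "g s =
         - strip_pairing (f s) (fourier_integral h1) (slice_mult V s n)
         - of_real (\<nu> * \<sigma>) * strip_pairing (f s) (fourier_integral h2) (\<lambda>y. of_real (sine_mode n y))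
         + of_real (\<nu> * ?ev) * strip_pairing (f s) (fourier_integral h) (\<lambda>y. of_real (sine_mode n y))" for s
    proof -
      \<comment> \<open>The multipliers i k of transport and k^2 of diffusion in x are, up to sign,
        those contained in \<open>h1\<close> and \<open>h2\<close>.\<close>
      have "h k * mode_force n k s = - (h1 k * sine_coeff n (\<lambda>y. of_real (V s y) * F k s y))
          - of_real (\<nu> * \<sigma>) * (h2 k * sine_coeff n (F k s)) + of_real (\<nu> * ?ev) * (h k * sine_coeff n (F k s))" for k
      proof -
        have "h1 k = - (\<i> * of_real k * h k)" by (simp add: h1_def)
        moreover have "h2 k = - (of_real (k\<^sup>2) * h k)"
          by (simp add: h1_def h2_def power2_eq_square algebra_simps)
        ultimately show ?thesis
          unfolding mode_force_def mode_rate_def by (simp add: algebra_simps)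
      qed
      then show ?thesis
        unfolding gs S0(2)[OF s] S2(2)[OF s] S1(2)[OF s]
        using S0(1)[OF s] S2(1)[OF s] S1(1)[OF s] by simp
    qed
    \<comment> \<open>This is h(k) times the force, restricted to [0, t]; writing it through
      \<open>Z\<close> lets it inherit integrability.\<close>
    define Y where "Y p = (indicat_real B (fst p) * indicat_real {0..t} (snd p)) *\<^sub>R Z p" for p
    have [measurable]: "Z \<in> borel_measurable borel" by (rule Z_meas)
    have Y_int: "integrable lborel Y"
    proof (rule Bochner_Integration.integrable_bound[OF Z_int])
      show "Y \<in> borel_measurable lborel" unfolding Y_def[abs_def] by simp
    qed (auto simp: Y_def indicator_def)
    have Y_s: "(\<integral>s. Y (k, s) \<partial>lborel) = h k * (LINT s:{0..t}|lborel. mode_force n k s)" for k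
    proof -
      have "Y (k, s) = h k * (indicator {0..t} s *\<^sub>R mode_force n k s)" for s
        using t by (auto simp: Y_def Z_def h_def indicator_def)
      then show ?thesis unfolding set_lebesgue_integral_def by (simp only: integral_mult_right_zero)
    qed
    have Y_k: "(\<integral>k. Y (k, s) \<partial>lborel) = indicator {0..t} s *\<^sub>R (\<integral>k. h k * mode_force n k s \<partial>lborel)" for s
    proof -
      have "Y (k, s) = indicator {0..t} s *\<^sub>R (h k * mode_force n k s)" for k
        using t by (auto simp: Y_def Z_def h_def indicator_def)
      then show ?thesis by simp
    qed
    have "(LINT s:{0..t}|lborel. g s) = (\<integral>s. (\<integral>k. Y (k, s) \<partial>lborel) \<partial>lborel)"
      unfolding set_lebesgue_integral_def
    proof (rule integral_cong_AE)
      show "(\<lambda>s. indicator {0..t} s *\<^sub>R g s) \<in> borel_measurable lborel"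
        using g_int unfolding set_integrable_def by (rule borel_measurable_integrable)
      show "(\<lambda>s. \<integral>k. Y (k, s) \<partial>lborel) \<in> borel_measurable lborel"
        using lborel_Fubini_snd[OF Y_int] by (rule borel_measurable_integrable)
      show "AE s in lborel. indicator {0..t} s *\<^sub>R g s = (\<integral>k. Y (k, s) \<partial>lborel)"
        using g_AE
      proof eventually_elim
        case (elim s)
        show ?case
        proof (cases "s \<in> {0..t}")
          case True
          then have "s \<in> {0..T}" using t by auto
          then show ?thesis using g_force elim True unfolding Y_k by simp
        qed (simp add: Y_k)
      qed
    qed
    also have "\<dots> = (\<integral>k. h k * (LINT s:{0..t}|lborel. mode_force n k s) \<partial>lborel)"
      unfolding Y_s[symmetric] using lborel_Fubini(1,2)[OF Y_int] by simp
    finally have g_total: "(LINT s:{0..t}|lborel. g s) = (\<integral>k. h k * (LINT s:{0..t}|lborel. mode_force n k s) \<partial>lborel)" .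
    have z: "0 \<in> {0..T}" using T_pos by simp
    have force_int: "integrable lborel (\<lambda>k. h k * (LINT s:{0..t}|lborel. mode_force n k s))"
      using lborel_Fubini(3)[OF Y_int] unfolding Y_s .
    have split: "indicator B k *\<^sub>R (indicator A k *\<^sub>R mode_defect n t k)
       = h k * sine_coeff n (F k t) - h k * sine_coeff n (F k 0) + h k * (LINT s:{0..t}|lborel. mode_force n k s)" for k
      by (simp add: mode_defect_def h_def indicator_def)
    show ?thesis
      unfolding split
    proof
      show "integrable lborel (\<lambda>k. h k * sine_coeff n (F k t) - h k * sine_coeff n (F k 0) + h k * (LINT s:{0..t}|lborel. mode_force n k s))"
        by (intro Bochner_Integration.integrable_add Bochner_Integration.integrable_diff S0(1) t z force_int)
      have "(\<integral>k. h k * sine_coeff n (F k t) - h k * sine_coeff n (F k 0) + h k * (LINT s:{0..t}|lborel. mode_force n k s) \<partial>lborel)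
        = (\<integral>k. h k * sine_coeff n (F k t) \<partial>lborel) - (\<integral>k. h k * sine_coeff n (F k 0) \<partial>lborel)
          + (\<integral>k. h k * (LINT s:{0..t}|lborel. mode_force n k s) \<partial>lborel)"
        using S0(1)[OF t] S0(1)[OF z] force_int by simp
      also have "\<dots> = 0"
        using g_eq unfolding S0(2)[OF t] S0(2)[OF z] g_total by simp
      finally show "(\<integral>k. h k * sine_coeff n (F k t) - h k * sine_coeff n (F k 0) + h k * (LINT s:{0..t}|lborel. mode_force n k s) \<partial>lborel) = 0" .
    qed
  qed
  have "AE k in lborel. indicator A k *\<^sub>R mode_defect n t k = 0"
  proof (rule sigma_finite_measure.density_zero[OF sigma_finite_lborel])
    show "integrable lborel (\<lambda>k. indicator A k *\<^sub>R mode_defect n t k)"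
      using key[of UNIV] by simp
    show "(LINT k:B|lborel. indicator A k *\<^sub>R mode_defect n t k) = 0" if "B \<in> sets lborel" for B
      using key[of B] that unfolding set_lebesgue_integral_def by simp
  qed
  then show ?thesis by eventually_elim (auto simp: indicator_def)
qed

text \<open>For each n, each time and each bound M there is a null set of bad frequencies.
  Restricting to grid times and natural M keeps the union null, and continuity in time then reaches
  all of [0, T]. Every good frequency lies in some \<open>A M\<close>, because the norm of
  \<open>F k s\<close> is continuous in s on a compact interval.\<close>

lemma mode_equation:
  "AE k in lborel. L2_continuous_on {0..T} {-1..1} (F k) \<and> (\<forall>n. \<forall>t\<in>{0..T}. mode_defect n t k = 0)"
proof -
  let ?I = "{-1..1::real}"
  have "AE k in lborel. L2_continuous_on {0..T} ?I (F k)"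
    using fourier by (simp add: is_fourier_x_def)
  then obtain N where N: "N \<in> null_sets lborel" and cont: "\<And>k. k \<notin> N \<Longrightarrow> L2_continuous_on {0..T} ?I (F k)"
    unfolding eventually_ae_filter by auto
  define r where "r i m = real_of_int i / real (Suc m)" for i m
  have grid: "grid_point m s = r \<lfloor>s * real (Suc m)\<rfloor> m" for m s
    by (simp add: grid_point_def r_def)
  have grid_mem: "grid_point m s \<in> {0..T}" if "s \<in> {0..T}" for m s
    using that grid_point_bounds(1)[of s m] grid_point_bounds(2)[of m s] by auto
  \<comment> \<open>The norm bound is imposed at grid times only, which makes \<open>A M\<close> a
    countable intersection of Borel sets; continuity in time extends the bound to all of
    [0, T].\<close>
  define S where "S M i m = {k. r i m \<in> {0..T} \<longrightarrow> L2_norm ?I (F k (r i m)) \<le> real M}" for M :: nat and i m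
  define A where "A M = {k. k \<notin> N \<and> \<bar>k\<bar> \<le> real M} \<inter> (\<Inter>i m. S M i m)" for M :: nat
  have A_iff: "k \<in> A M \<longleftrightarrow> k \<notin> N \<and> \<bar>k\<bar> \<le> real M \<and> (\<forall>i m. k \<in> S M i m)" for k M
    by (simp add: A_def)
  have A_sets: "A M \<in> sets borel" for M
  proof -
    have "N \<in> sets borel" using N by auto
    moreover have "{k. k \<notin> N \<and> \<bar>k\<bar> \<le> real M} = {-real M..real M} - N" by auto
    ultimately have 1: "{k. k \<notin> N \<and> \<bar>k\<bar> \<le> real M} \<in> sets borel" by simp
    have 2: "S M i m \<in> sets borel" for i m
    proof (cases "r i m \<in> {0..T}")
      case True
      have [measurable]: "(\<lambda>k. L2_norm ?I (F k (r i m))) \<in> borel_measurable borel"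
        by (rule is_fourier_x_measurable(2)[OF fourier True borel_measurable_const])
      have "{k \<in> space borel. L2_norm ?I (F k (r i m)) \<le> real M} \<in> sets borel"
        by measurable
      then show ?thesis using True by (simp add: S_def)
    next
      case False
      then have "S M i m = UNIV" unfolding S_def by blast
      then show ?thesis by simp
    qed
    have 3: "(\<Inter>m. S M i m) \<in> sets borel" for i
      by (rule sets.countable_INT''[OF _ _ 2]) simp_all
    have "(\<Inter>i m. S M i m) \<in> sets borel"
      by (rule sets.countable_INT''[OF _ _ 3]) simp_all
    with 1 show ?thesis
      unfolding A_def by (rule sets.Int)
  qed
  have A_le: "L2_norm ?I (F k s) \<le> real M" if k: "k \<in> A M" and s: "s \<in> {0..T}" for k s M
  proof (rule LIMSEQ_le_const2)
    show "(\<lambda>m. L2_norm ?I (F k (grid_point m s))) \<longlonglongrightarrow> L2_norm ?I (F k s)"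
      using k s by (intro continuous_on_tendsto_compose[OF L2_continuous_on_norm grid_point_tendsto])
        (auto simp: A_iff grid_mem[OF s] intro!: cont always_eventually simp del: atLeastAtMost_iff)
    show "\<exists>j. \<forall>m\<ge>j. L2_norm ?I (F k (grid_point m s)) \<le> real M"
    proof (intro exI allI impI)
      fix m
      have "k \<in> S M \<lfloor>s * real (Suc m)\<rfloor> m" using k A_iff by blast
      then show "L2_norm ?I (F k (grid_point m s)) \<le> real M"
        using grid_mem[OF s, of m] unfolding S_def grid by blast
    qed
  qed
  have "AE k in lborel. k \<in> A M \<longrightarrow> mode_defect n (r i m) k = 0" if "r i m \<in> {0..T}" for M n i m
    by (rule mode_defect_AE_zero_on[OF A_sets _ _ A_le that]) (auto simp: A_iff intro: cont)
  then have "AE k in lborel. \<forall>M n i m. r i m \<in> {0..T} \<longrightarrow> k \<in> A M \<longrightarrow> mode_defect n (r i m) k = 0"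
    unfolding AE_all_countable by auto
  moreover have "AE k in lborel. k \<notin> N"
    using N by (rule AE_not_in)
  ultimately show ?thesis
  proof eventually_elim
    case (elim k)
    note Fk = cont[OF elim(2)]
    obtain U where U: "\<And>s. s \<in> {0..T} \<Longrightarrow> L2_norm ?I (F k s) \<le> U"
      using L2_continuous_on_bounded[OF compact_Icc Fk] by blast
    obtain M :: nat where M: "max \<bar>k\<bar> U \<le> real M" by (rule real_arch_simple[THEN exE])
    have "k \<in> S M i m" for i m
    proof -
      have "L2_norm ?I (F k (r i m)) \<le> real M" if "r i m \<in> {0..T}"
        using U[OF that] M by simp
      then show ?thesis unfolding S_def by blast
    qed
    then have k: "k \<in> A M" using elim(2) M by (simp add: A_iff)
    have "mode_defect n t k = 0" if t: "t \<in> {0..T}" for n t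
    proof (rule LIMSEQ_unique)
      have "continuous_on {0..T} (\<lambda>t. LINT s:{0..t}|lborel. mode_force n k s)"
        unfolding continuous_on_eq_continuous_within
        by (intro ballI has_vector_derivative_continuous[OF
              has_vector_derivative_set_integral[OF continuous_on_mode_force[OF Fk]]])
      then have "continuous_on {0..T} (\<lambda>t. mode_defect n t k)"
        unfolding mode_defect_def by (intro continuous_intros continuous_on_sine_coeff Fk)
      then show "(\<lambda>m. mode_defect n (grid_point m t) k) \<longlonglongrightarrow> mode_defect n t k"
        by (rule continuous_on_tendsto_compose[OF _ grid_point_tendsto]) (use t grid_mem[OF t] in auto)
      have "mode_defect n (grid_point m t) k = 0" for m
        using elim(1) k grid_mem[OF t, of m] unfolding grid by blast
      then show "(\<lambda>m. mode_defect n (grid_point m t) k) \<longlonglongrightarrow> 0" by simp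
    qed
    with Fk show ?case by blast
  qed
qed

text \<open>The lowest Dirichlet eigenvalue of \<open>-\<partial>\<^sub>y\<^sup>2\<close> on \<open>[-1, 1]\<close> is \<open>\<pi>\<^sup>2 / 4 > 1\<close>.\<close>

lemma L2_decay:
  assumes "\<sigma> \<ge> 0" and "\<nu> > 0"
  shows "AE k in lborel. \<forall>t\<in>{0..T}. L2_norm {-1..1} (F k t) \<le> exp (- \<nu> * t) * L2_norm {-1..1} (F k 0)"
  using mode_equation
proof eventually_elim
  case (elim k)
  show ?case
  proof
    fix t assume t: "t \<in> {0..T}"
    have rate: "\<nu> \<le> mode_rate n k" for n
    proof -
      \<comment> \<open>The bound pi >= 2 is enough to make (n + 1) pi / 2, and with it the
        eigenvalue, at least 1.\<close>
      have "1 * 2 \<le> real (Suc n) * pi" using pi_ge_two by (intro mult_mono) auto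
      then have "1\<^sup>2 \<le> (real (Suc n) * pi / 2)\<^sup>2" by (intro power_mono) auto
      moreover have "0 \<le> \<sigma> * k\<^sup>2" using \<open>\<sigma> \<ge> 0\<close> by simp
      ultimately have "1 \<le> \<sigma> * k\<^sup>2 + (real (Suc n) * pi / 2)\<^sup>2" by simp
      from mult_left_mono[OF this, of \<nu>] show ?thesis using \<open>\<nu> > 0\<close> by (simp add: mode_rate_def)
    qed
    show "L2_norm {-1..1} (F k t) \<le> exp (- \<nu> * t) * L2_norm {-1..1} (F k 0)"
    proof (rule energy_decay[OF _ V_cont _ rate t])
      show "L2_continuous_on {0..T} {-1..1} (F k)" using elim by blast
      fix n t assume "t \<in> {0..T}"
      then have "mode_defect n t k = 0" using elim by blast
      then show "sine_coeff n (F k t) = sine_coeff n (F k 0)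
        - (LINT s:{0..t}|lborel. \<i> * of_real k * sine_coeff n (\<lambda>y. of_real (V s y) * F k s y)
            + of_real (mode_rate n k) * sine_coeff n (F k s))"
        unfolding mode_defect_def mode_force_def by (simp add: add_eq_0_iff algebra_simps)
    qed
  qed
qed

end

theorem theorem1p3:
  fixes m\<^sub>0 :: nat and r\<^sub>0 C\<^sub>2 C\<^sub>3 M\<^sub>1 M\<^sub>2 :: real
  assumes "r\<^sub>0 > 0" and "C\<^sub>2 \<ge> 1" and "C\<^sub>3 \<ge> 1"
  shows "\<exists>\<delta>. 0 < \<delta> \<and> \<delta> < 1 \<and>
    (\<forall>(\<sigma>::real) (\<nu>::real) (T::real) (V :: real \<Rightarrow> real \<Rightarrow> real)
       (f\<^sub>0 :: real \<times> real \<Rightarrow> complex) (f :: real \<Rightarrow> real \<times> real \<Rightarrow> complex)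
       (F :: real \<Rightarrow> real \<Rightarrow> real \<Rightarrow> complex).
       \<sigma> \<in> {0, 1} \<longrightarrow> \<nu> > 0 \<longrightarrow> T > 0 \<longrightarrow>
       C1t_C2y T V \<longrightarrow>
       sup_norm T (dy V) = M\<^sub>1 \<longrightarrow> sup_norm T (dy (dy V)) = M\<^sub>2 \<longrightarrow>
       (\<forall>t\<in>{0..T}. finite (critical_points V t)) \<longrightarrow>
       sup_norm T (dt T (dy V)) \<le> C\<^sub>2 * \<nu> \<longrightarrow>
       (\<forall>t\<in>{0..T}. \<forall>y\<^sub>i\<in>critical_points V t. \<forall>y\<in>{-1..1}.
          \<bar>y - y\<^sub>i\<bar> \<le> r\<^sub>0 \<longrightarrow> \<bar>y - y\<^sub>i\<bar> ^ m\<^sub>0 \<le> C\<^sub>3 * \<bar>dy V t y\<bar>) \<longrightarrow>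
       f\<^sub>0 \<in> H10 \<longrightarrow> is_solution \<sigma> \<nu> T V f\<^sub>0 f \<longrightarrow> is_fourier_x T f F \<longrightarrow>
       (AE k in lborel. 0 < \<bar>k\<bar> \<and> \<bar>k\<bar> \<le> \<nu> \<longrightarrow>
          (\<forall>t\<in>{0..T}. L2_norm {-1..1} (F k t)
             \<le> exp 1 * L2_norm {-1..1} (F k 0) * exp (- \<delta> * (\<bar>k\<bar>\<^sup>2 / \<nu>) * t))))"
proof (intro exI[of _ "1/2"] conjI allI impI)
  fix \<sigma> \<nu> T :: real and V :: "real \<Rightarrow> real \<Rightarrow> real"
    and f\<^sub>0 :: "real \<times> real \<Rightarrow> complex" and f :: "real \<Rightarrow> real \<times> real \<Rightarrow> complex"
    and F :: "real \<Rightarrow> real \<Rightarrow> real \<Rightarrow> complex"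
  assume \<sigma>: "\<sigma> \<in> {0, 1}" and \<nu>: "\<nu> > 0" and "T > 0" and "C1t_C2y T V"
    and "f\<^sub>0 \<in> H10" "is_solution \<sigma> \<nu> T V f\<^sub>0 f" "is_fourier_x T f F"
  then interpret fourier_modes \<sigma> \<nu> T V f\<^sub>0 f F
    by unfold_locales (auto simp: C1t_C2y_def)
  have "\<sigma> \<ge> 0" using \<sigma> by auto
  from L2_decay[OF this \<nu>]
  show "AE k in lborel. 0 < \<bar>k\<bar> \<and> \<bar>k\<bar> \<le> \<nu> \<longrightarrow>
          (\<forall>t\<in>{0..T}. L2_norm {-1..1} (F k t)
             \<le> exp 1 * L2_norm {-1..1} (F k 0) * exp (- (1/2) * (\<bar>k\<bar>\<^sup>2 / \<nu>) * t))"
  proof eventually_elim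
    case (elim k)
    show ?case
    proof (intro impI ballI)
      fix t assume k: "0 < \<bar>k\<bar> \<and> \<bar>k\<bar> \<le> \<nu>" and t: "t \<in> {0..T}"
      have "\<bar>k\<bar>\<^sup>2 \<le> \<nu> * \<nu>"
        unfolding power2_eq_square using k \<nu> by (intro mult_mono) auto
      then have "\<bar>k\<bar>\<^sup>2 / \<nu> \<le> \<nu>"
        using \<nu> by (simp only: pos_divide_le_eq)
      \<comment> \<open>The constant 1/2 stands for any number in (0, 1): the rate \<nu> is already
        at least |k|^2 / \<nu>.\<close>
      then have "1/2 * (\<bar>k\<bar>\<^sup>2 / \<nu>) \<le> 1 * \<nu>"
        using \<nu> by (intro mult_mono) auto
      then have "1/2 * (\<bar>k\<bar>\<^sup>2 / \<nu>) * t \<le> \<nu> * t"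
        using t by (intro mult_right_mono) auto
      then have "exp (- \<nu> * t) \<le> exp (- (1/2) * (\<bar>k\<bar>\<^sup>2 / \<nu>) * t)"
        by simp
      then have "exp (- \<nu> * t) * L2_norm {-1..1} (F k 0)
          \<le> exp (- (1/2) * (\<bar>k\<bar>\<^sup>2 / \<nu>) * t) * L2_norm {-1..1} (F k 0)"
        by (rule mult_right_mono) simp
      also have "\<dots> = 1 * (L2_norm {-1..1} (F k 0) * exp (- (1/2) * (\<bar>k\<bar>\<^sup>2 / \<nu>) * t))"
        by simp
      \<comment> \<open>The energy argument yields the prefactor 1, which is weakened to e.\<close>
      also have "\<dots> \<le> exp 1 * (L2_norm {-1..1} (F k 0) * exp (- (1/2) * (\<bar>k\<bar>\<^sup>2 / \<nu>) * t))"
        by (intro mult_right_mono) auto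
      finally show "L2_norm {-1..1} (F k t)
             \<le> exp 1 * L2_norm {-1..1} (F k 0) * exp (- (1/2) * (\<bar>k\<bar>\<^sup>2 / \<nu>) * t)"
        using elim t by (fastforce simp: mult.assoc)
    qed
  qed
qed auto

end
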